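(* Let $p\ge3$. The realizations of the surface $\Sigma_{p,4}$ in $\mathbb{R}^3$ obtained via projections of the wedge product $\mathcal{W}_{p,1}\subset\mathbb{R}^{2+p}$ have at least $6p$ moduli. That is: let $W\subset\mathbb{R}^{2+p}$ be a polytope combinatorially equivalent to $\mathcal{W}_{p,1}$ such that all faces of $W$ corresponding to $\Sigma_{p,4}$ are preserved by the projection to the first four coordinates and their images lie on the lower hull, with respect to the fourth coordinate, of the projected $4$-polytope; let $S\subset\mathbb{R}^3$ be the realization of $\Sigma_{p,4}$ obtained by projecting these faces to the first three coordinates. Then $\mu(S)\ge 6p$.
   Context: Notation: $[n]=\{0,1,\dots,n-1\}$. Let $C_p=\{x\in\mathbb{R}^2 : a_ix\le1,\ i\in[p]\}$ be a convex $p$-gon with its $p$ edges labeled in cyclic order, and $\Delta_1=\{y\in\mathbb{R} : b_jy\le1,\ j\in[2]\}$ an interval (both given by their facet inequalities). The wedge product is the simple polytope $$\mathcal{W}_{p,1}=C_p\triangleleft\Delta_1=\{(x,y_0,\dots,y_{p-1})\in\mathbb{R}^{2+p} : a_ix+b_jy_i\le1\ \text{for all } i\in[p],\ j\in[2]\},$$ with facet hyperplanes $h_{i,j}: a_ix+b_jy_i=1$. A face $G$ is denoted by the vector $(H_0,\dots,H_{p-1})$, $H_i\subseteq[2]$, where $j\in H_i\iff G\subset h_{i,j}$. $\Sigma_{p,4}$ is the polytopal subcomplex of the boundary of $\mathcal{W}_{p,1}$ consisting of all faces $(\{j_0\},\dots,\{j_{p-1}\})$ with $j_k\in[2]$ (all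 of these are $p$-gons), together with all their edges and vertices. It is a closed connected orientable $2$-manifold and contains all vertices of $\mathcal{W}_{p,1}$. Preserved faces: let $P\subset\mathbb{R}^d$ be a polytope and $\pi:\mathbb{R}^d\to\mathbb{R}^k$ an affine projection. A non-empty face $F$ of $P$ is preserved by $\pi$ if (D1) $\pi(F)$ is a face of $\pi(P)$, (D2) $\pi(F)$ is combinatorially equivalent to $F$, and (D3) $\pi^{-1}(\pi(F))\cap P=F$. The lower hull of a polytope with respect to a coordinate is the complex of all faces that have a (outer) normal vector whose entry in that coordinate is negative. Moduli: for a surface $S$ realized in $\mathbb{R}^3$ with planar convex polygons, the number of moduli $\mu(S)$ is the local dimension, near $S$, of the realization space of $S$, i.e. of the set of all vertex coordinates (in $(\mathbb{R}^3)^{V}$, $V$ the vertex set) of embedded polyhedral surfaces with planar convex faces combinatorially equivalent to $S$. *)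

theory Defs
  imports "HOL-Analysis.Analysis" "HOL-Library.Extended_Nat"
begin

section \<open>Polytopes, combinatorial equivalence, projections\<close>

definition inclusion_iso :: "('a set \<Rightarrow> 'b set) \<Rightarrow> 'a set set \<Rightarrow> 'b set set \<Rightarrow> bool" where
  "inclusion_iso \<phi> A B \<longleftrightarrow>
     bij_betw \<phi> A B \<and> (\<forall>F\<in>A. \<forall>G\<in>A. F \<subseteq> G \<longleftrightarrow> \<phi> F \<subseteq> \<phi> G)"

definition face_lattice_iso ::
  "('a::euclidean_space set \<Rightarrow> 'b::euclidean_space set) \<Rightarrow> 'a set \<Rightarrow> 'b set \<Rightarrow> bool" where
  "face_lattice_iso \<phi> P Q \<longleftrightarrow> inclusion_iso \<phi> {F. F face_of P} {G. G face_of Q}"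

definition combinatorially_equivalent ::
  "'a::euclidean_space set \<Rightarrow> 'b::euclidean_space set \<Rightarrow> bool" where
  "combinatorially_equivalent P Q \<longleftrightarrow> (\<exists>\<phi>. face_lattice_iso \<phi> P Q)"

definition preserved_by ::
  "('a::euclidean_space \<Rightarrow> 'b::euclidean_space) \<Rightarrow> 'a set \<Rightarrow> 'a set \<Rightarrow> bool" where
  "preserved_by \<pi> P F \<longleftrightarrow>
     F face_of P \<and> F \<noteq> {} \<and>
     (\<pi> ` F) face_of (\<pi> ` P) \<and>
     combinatorially_equivalent F (\<pi> ` F) \<and>
     \<pi> -` (\<pi> ` F) \<inter> P = F"

text \<open>Here \<open>c\<close> is an outer normal vector of the face of \<open>Q\<close> on which the linear functional
  \<open>c \<bullet> _\<close> is maximal.\<close>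

definition lower_hull :: "'n \<Rightarrow> (real^'n::finite) set \<Rightarrow> (real^'n) set set" where
  "lower_hull k Q =
     {F. F face_of Q \<and> F \<noteq> {} \<and>
         (\<exists>c \<beta>. c $ k < 0 \<and> Q \<subseteq> {x. c \<bullet> x \<le> \<beta>} \<and> F = Q \<inter> {x. c \<bullet> x = \<beta>})}"


section \<open>The wedge product of a polygon and an interval\<close>

definition ineq_set :: "(nat \<Rightarrow> 'a::euclidean_space) \<Rightarrow> nat \<Rightarrow> 'a set" where
  "ineq_set a m = {x. \<forall>i<m. a i \<bullet> x \<le> 1}"

definition ineq_facet :: "(nat \<Rightarrow> 'a::euclidean_space) \<Rightarrow> nat \<Rightarrow> nat \<Rightarrow> 'a set" where
  "ineq_facet a m i = ineq_set a m \<inter> {x. a i \<bullet> x = 1}"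

text \<open>The \<open>m\<close> inequalities are the facet inequalities, without repetition, of a polytope; it is
  full-dimensional because \<open>0\<close> satisfies all of them strictly.\<close>

definition facet_inequalities :: "(nat \<Rightarrow> 'a::euclidean_space) \<Rightarrow> nat \<Rightarrow> bool" where
  "facet_inequalities a m \<longleftrightarrow>
     polytope (ineq_set a m) \<and>
     (\<forall>i<m. ineq_facet a m i facet_of ineq_set a m) \<and>
     inj_on (ineq_facet a m) {..<m}"

definition cyclic_polygon_inequalities :: "(nat \<Rightarrow> real^2) \<Rightarrow> nat \<Rightarrow> bool" where
  "cyclic_polygon_inequalities a p \<longleftrightarrow>
     facet_inequalities a p \<and>
     (\<forall>i<p. ineq_facet a p i \<inter> ineq_facet a p (Suc i mod p) \<noteq> {})"

text \<open>Points of \<open>\<real>\<^bsup>2+p\<^esup>\<close> are pairs \<open>(x, y)\<close> with \<open>x :: real^2\<close> and \<open>y :: real^'p\<close>, where the function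
  \<open>e\<close> enumerates the index type \<open>'p\<close> by \<open>0, \<dots>, p - 1\<close>: the coordinate \<open>y\<^sub>i\<close> is \<open>y $ e i\<close>.\<close>

definition wedge_product ::
  "(nat \<Rightarrow> 'p::finite) \<Rightarrow> nat \<Rightarrow> (nat \<Rightarrow> real^2) \<Rightarrow> (nat \<Rightarrow> real) \<Rightarrow> ((real^2) \<times> (real^'p)) set" where
  "wedge_product e p a b = {(x, y). \<forall>i<p. \<forall>j<2. a i \<bullet> x + b j * y $ e i \<le> 1}"

definition wedge_hyperplane ::
  "(nat \<Rightarrow> 'p::finite) \<Rightarrow> (nat \<Rightarrow> real^2) \<Rightarrow> (nat \<Rightarrow> real) \<Rightarrow> nat \<Rightarrow> nat \<Rightarrow> ((real^2) \<times> (real^'p)) set" where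
  "wedge_hyperplane e a b i j = {(x, y). a i \<bullet> x + b j * y $ e i = 1}"

text \<open>The vector \<open>(H\<^sub>0, \<dots>, H\<^bsub>p-1\<^esub>)\<close> that denotes a face.\<close>

definition face_vector ::
  "(nat \<Rightarrow> 'p::finite) \<Rightarrow> (nat \<Rightarrow> real^2) \<Rightarrow> (nat \<Rightarrow> real) \<Rightarrow> ((real^2) \<times> (real^'p)) set \<Rightarrow> nat \<Rightarrow> nat set" where
  "face_vector e a b G i = {j. j < 2 \<and> G \<subseteq> wedge_hyperplane e a b i j}"

definition sigma_surface ::
  "(nat \<Rightarrow> 'p::finite) \<Rightarrow> nat \<Rightarrow> (nat \<Rightarrow> real^2) \<Rightarrow> (nat \<Rightarrow> real) \<Rightarrow> ((real^2) \<times> (real^'p)) set set" where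
  "sigma_surface e p a b =
     {F. F \<noteq> {} \<and>
         (\<exists>G. G face_of wedge_product e p a b \<and>
              (\<forall>i<p. \<exists>j<2. face_vector e a b G i = {j}) \<and>
              F face_of G)}"

definition first4 :: "(nat \<Rightarrow> 'p::finite) \<Rightarrow> (real^2) \<times> (real^'p) \<Rightarrow> real^4" where
  "first4 e = (\<lambda>(x, y). vector [x $ 1, x $ 2, y $ e 0, y $ e 1])"

definition first3 :: "(nat \<Rightarrow> 'p::finite) \<Rightarrow> (real^2) \<times> (real^'p) \<Rightarrow> real^3" where
  "first3 e = (\<lambda>(x, y). vector [x $ 1, x $ 2, y $ e 0])"


section \<open>Realization spaces and moduli\<close>

text \<open>Complexes are represented by their non-empty faces.\<close>

definition polytopal_complex :: "'a::euclidean_space set set \<Rightarrow> bool" where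
  "polytopal_complex K \<longleftrightarrow>
     finite K \<and>
     (\<forall>F\<in>K. polytope F \<and> F \<noteq> {}) \<and>
     (\<forall>F\<in>K. \<forall>G. G face_of F \<and> G \<noteq> {} \<longrightarrow> G \<in> K) \<and>
     (\<forall>F\<in>K. \<forall>G\<in>K. (F \<inter> G) face_of F \<and> (F \<inter> G) face_of G)"

definition complex_vertices :: "'a set set \<Rightarrow> 'a set" where
  "complex_vertices S = {v. {v} \<in> S}"

definition face_with_coordinates :: "'a::euclidean_space set set \<Rightarrow> ('a \<Rightarrow> 'a) \<Rightarrow> 'a set \<Rightarrow> 'a set" where
  "face_with_coordinates S \<rho> F = convex hull (\<rho> ` (F \<inter> complex_vertices S))"

text \<open>Vertex coordinates \<open>\<rho>\<close> in \<open>(\<real>\<^sup>3)\<^bsup>V\<^esup>\<close> for which the faces spanned by the vertex sets of the faces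
  of \<open>S\<close> form an embedded complex with the same face poset. For a surface \<open>S\<close>, the isomorphism and
  closure under faces force the image of each polygon of \<open>S\<close> to be a (planar, strictly) convex
  polygon with the images of the same vertices and edges.\<close>

definition realization_space :: "(real^3) set set \<Rightarrow> (real^3 \<Rightarrow> real^3) set" where
  "realization_space S =
     {\<rho> \<in> complex_vertices S \<rightarrow>\<^sub>E UNIV.
        polytopal_complex (face_with_coordinates S \<rho> ` S) \<and>
        inclusion_iso (face_with_coordinates S \<rho>) S (face_with_coordinates S \<rho> ` S)}"

text \<open>The largest \<open>d\<close> such that every neighbourhood of \<open>x\<close> contains a \<open>d\<close>-cell. For semialgebraic
  sets, such as realization spaces, this is the usual local dimension at \<open>x\<close>. The value is \<open>0\<close> if
  \<open>x\<close> is not a point of the space.\<close>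

definition local_dimension :: "'a topology \<Rightarrow> 'a \<Rightarrow> enat" where
  "local_dimension X x =
     (SUP d \<in> {d. x \<in> topspace X \<and>
                 (\<forall>U. openin X U \<and> x \<in> U \<longrightarrow>
                    (\<exists>B\<subseteq>U. subtopology X B homeomorphic_space Euclidean_space d))}. enat d)"

text \<open>The point of the realization space that represents \<open>S\<close> itself is the identity on the
  vertex set.\<close>

definition moduli :: "(real^3) set set \<Rightarrow> enat" where
  "moduli S =
     local_dimension
       (subtopology (product_topology (\<lambda>_. euclidean) (complex_vertices S)) (realization_space S))
       (restrict id (complex_vertices S))"

end

theory Submission
  imports Defs
begin

text \<open>A polygon of the surface lies in \<open>p\<close> facets of the simple polytope \<open>W\<close>, a vertex in \<open>p + 2\<close>.
  Small changes of the facet normals therefore move the vertices continuously, keep the polygons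
  planar, and (since strict inequalities persist) keep them on the lower hull, so that projecting to
  three coordinates yields realizations near \<open>S\<close>.  Conversely, the projected vertices determine every
  slack function up to a factor: it is fixed on one polygon by its zero edge, and it propagates
  between adjacent polygons.  So the surface determines the perturbed polytope up to affine maps
  that commute with the projection and up to rescaling of the facet inequalities.

  A slice transversal to these maps with \<open>6p\<close> parameters: fix \<open>p - 1\<close> of the facets through one polygon,
  whose normals \<open>n\<^sub>k\<close> together with the three visible coordinates form a basis; add an arbitrary
  visible vector to each of the other \<open>p + 1\<close> normals; and for each \<open>k\<close> add multiples of \<open>n\<^sub>k\<close> to three
  of these \<open>p + 1\<close> normals, leaving the \<open>n\<^sub>k\<close>-coefficient of another one fixed at a nonzero value,
  which normalizes the scale.  This gives \<open>3 (p + 1) + 3 (p - 1)\<close> parameters.\<close>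

section \<open>Spanning families of vectors\<close>

text \<open>The delicate point is the scale of the facet inequalities. All facets are written
  relative to a point \<open>z0\<close> that lies on the \<open>p - 1\<close> fixed facets and
  strictly inside the others, and the right-hand sides relative to \<open>z0\<close> never change.
  For a free facet this number is positive, which fixes the scale of the inequality. For a fixed
  facet it is 0, so its scale stays undetermined and has to be pinned by a coefficient that no
  parameter touches. Of the \<open>p + 1\<close> free labels one is spent on this, and
  \<open>p \<ge> 3\<close> leaves room for three multiples. No equations are counted. The
  parametrization is continuous and injective near 0, and on a compact ball such a map into a
  Hausdorff space is an embedding; this fits a local dimension defined by cells. Since each vertex
  solves a square linear system in the facets through it, the conditions to be preserved reduce to
  spanning properties and strict inequalities at finitely many vertices.\<close>

definition spanning :: "('j \<Rightarrow> 'a::euclidean_space) \<Rightarrow> 'j set \<Rightarrow> bool" where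
  "spanning u J \<longleftrightarrow> (\<forall>z. (\<forall>j\<in>J. u j \<bullet> z = 0) \<longrightarrow> z = 0)"

lemma spanningD: "spanning u J \<Longrightarrow> (\<And>j. j \<in> J \<Longrightarrow> u j \<bullet> z = 0) \<Longrightarrow> z = 0"
  by (auto simp: spanning_def)

lemma spanning_span:
  assumes "spanning u J"
  shows "span (u ` J) = UNIV"
proof (rule ccontr)
  assume "span (u ` J) \<noteq> UNIV"
  then obtain a where "a \<noteq> 0" and a: "\<And>x. x \<in> span (u ` J) \<Longrightarrow> a \<bullet> x = 0"
    using span_not_UNIV_orthogonal by blast
  have "u j \<bullet> a = 0" if "j \<in> J" for j
    using a[of "u j"] that by (simp add: span_base inner_commute)
  with assms \<open>a \<noteq> 0\<close> show False
    by (auto simp: spanning_def)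
qed

text \<open>The sum on the right is a norm in \<open>z\<close>, so its minimum on the compact unit
  sphere is positive. This turns \<open>spanning\<close> into an estimate that can absorb a
  perturbation.\<close>

lemma spanning_lower_bound:
  fixes u :: "'j \<Rightarrow> 'a::euclidean_space"
  assumes "finite J" "spanning u J"
  obtains \<delta> where "\<delta> > 0" "\<And>z. \<delta> * norm z \<le> (\<Sum>j\<in>J. \<bar>u j \<bullet> z\<bar>)"
proof -
  let ?f = "\<lambda>z. \<Sum>j\<in>J. \<bar>u j \<bullet> z\<bar>"
  have "continuous_on (sphere 0 1) ?f"
    by (intro continuous_intros)
  moreover have "sphere (0::'a) 1 \<noteq> {}"
    using vector_choose_size[of 1] by force
  ultimately obtain x where x: "x \<in> sphere 0 1" and le: "\<And>y. y \<in> sphere 0 1 \<Longrightarrow> ?f x \<le> ?f y"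
    using continuous_attains_inf[OF compact_sphere] by blast
  have "?f x \<noteq> 0"
  proof
    assume "?f x = 0"
    then have "\<forall>j\<in>J. \<bar>u j \<bullet> x\<bar> = 0"
      using assms(1) by (subst (asm) sum_nonneg_eq_0_iff) auto
    with assms(2) have "x = 0"
      by (auto simp: spanning_def)
    with x show False
      by simp
  qed
  moreover have "?f x \<ge> 0"
    by (simp add: sum_nonneg)
  ultimately have pos: "?f x > 0"
    by linarith
  have "?f x * norm z \<le> ?f z" for z
  proof (cases "z = 0")
    case False
    have "?f x \<le> ?f (z /\<^sub>R norm z)"
      using False by (intro le) (simp add: dist_norm)
    also have "\<dots> = ?f z / norm z"
      by (simp add: abs_mult divide_inverse sum_distrib_left mult.commute)
    finally show ?thesis
      using False by (simp add: field_simps)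
  qed simp
  with pos show thesis
    by (rule that)
qed

text \<open>Half of the constant for \<open>u0\<close> is given up to the perturbation of the
  vectors, so that a single \<delta> serves all nearby \<open>t\<close>.\<close>

lemma spanning_uniform_lower_bound:
  fixes u :: "'t \<Rightarrow> 'j \<Rightarrow> 'a::euclidean_space"
  assumes "finite J" "spanning u0 J"
    and lim: "\<forall>j\<in>J. ((\<lambda>t. u t j) \<longlongrightarrow> u0 j) F"
  obtains \<delta> where "\<delta> > 0" "\<forall>\<^sub>F t in F. \<forall>z. \<delta> * norm z \<le> (\<Sum>j\<in>J. \<bar>u t j \<bullet> z\<bar>)"
proof -
  obtain \<delta> where \<delta>: "\<delta> > 0" "\<And>z. \<delta> * norm z \<le> (\<Sum>j\<in>J. \<bar>u0 j \<bullet> z\<bar>)"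
    by (rule spanning_lower_bound[OF assms(1,2)]) (rule that, assumption+)
  have "((\<lambda>t. \<Sum>j\<in>J. norm (u t j - u0 j)) \<longlongrightarrow> (\<Sum>j\<in>J. norm (u0 j - u0 j))) F"
    by (intro tendsto_intros lim[rule_format])
  then have ev: "\<forall>\<^sub>F t in F. (\<Sum>j\<in>J. norm (u t j - u0 j)) < \<delta> / 2"
    by (rule order_tendstoD) (use \<delta> in simp)
  show thesis
  proof (rule that[of "\<delta> / 2"])
    show "\<forall>\<^sub>F t in F. \<forall>z. \<delta> / 2 * norm z \<le> (\<Sum>j\<in>J. \<bar>u t j \<bullet> z\<bar>)"
      using ev
    proof (rule eventually_mono, intro allI)
      fix t z
      assume t: "(\<Sum>j\<in>J. norm (u t j - u0 j)) < \<delta> / 2"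
      have "\<delta> * norm z \<le> (\<Sum>j\<in>J. \<bar>u0 j \<bullet> z\<bar>)"
        by (rule \<delta>)
      also have "\<dots> \<le> (\<Sum>j\<in>J. \<bar>u t j \<bullet> z\<bar> + norm (u t j - u0 j) * norm z)"
      proof (rule sum_mono)
        fix j
        have "\<bar>u0 j \<bullet> z\<bar> \<le> \<bar>u t j \<bullet> z\<bar> + \<bar>(u t j - u0 j) \<bullet> z\<bar>"
          by (simp add: inner_diff_left)
        also have "\<bar>(u t j - u0 j) \<bullet> z\<bar> \<le> norm (u t j - u0 j) * norm z"
          by (rule Cauchy_Schwarz_ineq2)
        finally show "\<bar>u0 j \<bullet> z\<bar> \<le> \<bar>u t j \<bullet> z\<bar> + norm (u t j - u0 j) * norm z"
          by simp
      qed
      also have "\<dots> = (\<Sum>j\<in>J. \<bar>u t j \<bullet> z\<bar>) + (\<Sum>j\<in>J. norm (u t j - u0 j)) * norm z"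
        by (simp add: sum.distrib sum_distrib_right)
      also have "\<dots> \<le> (\<Sum>j\<in>J. \<bar>u t j \<bullet> z\<bar>) + \<delta> / 2 * norm z"
        using t by (intro add_left_mono mult_right_mono) auto
      finally show "\<delta> / 2 * norm z \<le> (\<Sum>j\<in>J. \<bar>u t j \<bullet> z\<bar>)"
        by simp
    qed
  qed (use \<delta> in simp)
qed

lemma eventually_spanning:
  fixes u :: "'t \<Rightarrow> 'j \<Rightarrow> 'a::euclidean_space"
  assumes "finite J" "spanning u0 J"
    and lim: "\<forall>j\<in>J. ((\<lambda>t. u t j) \<longlongrightarrow> u0 j) F"
  shows "\<forall>\<^sub>F t in F. spanning (u t) J"
proof -
  obtain \<delta> where \<delta>: "\<delta> > 0" "\<forall>\<^sub>F t in F. \<forall>z. \<delta> * norm z \<le> (\<Sum>j\<in>J. \<bar>u t j \<bullet> z\<bar>)"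
    by (rule spanning_uniform_lower_bound[OF assms]) (rule that, assumption+)
  from \<delta>(2) show ?thesis
  proof (rule eventually_mono)
    fix t
    assume t: "\<forall>z. \<delta> * norm z \<le> (\<Sum>j\<in>J. \<bar>u t j \<bullet> z\<bar>)"
    show "spanning (u t) J"
      unfolding spanning_def
    proof (intro allI impI)
      fix z
      assume "\<forall>j\<in>J. u t j \<bullet> z = 0"
      with t[rule_format, of z] have "\<delta> * norm z \<le> 0"
        by simp
      with \<delta>(1) show "z = 0"
        by (simp add: mult_le_0_iff)
    qed
  qed
qed

text \<open>Solutions of linear systems depend continuously on the data:
  \<open>u t j \<bullet> (v t - v0)\<close> is a residual that tends to 0, and the uniform lower
  bound turns small residuals into a small error.\<close>

lemma tendsto_solution:
  fixes u :: "'t \<Rightarrow> 'j \<Rightarrow> 'a::euclidean_space"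
  assumes "finite J" "spanning u0 J"
    and lim: "\<forall>j\<in>J. ((\<lambda>t. u t j) \<longlongrightarrow> u0 j) F"
    and b: "\<forall>j\<in>J. ((\<lambda>t. u t j \<bullet> v t) \<longlongrightarrow> u0 j \<bullet> v0) F"
  shows "(v \<longlongrightarrow> v0) F"
proof -
  obtain \<delta> where \<delta>: "\<delta> > 0" "\<forall>\<^sub>F t in F. \<forall>z. \<delta> * norm z \<le> (\<Sum>j\<in>J. \<bar>u t j \<bullet> z\<bar>)"
    by (rule spanning_uniform_lower_bound[OF assms(1-3)]) (rule that, assumption+)
  have "((\<lambda>t. (\<Sum>j\<in>J. \<bar>u t j \<bullet> v t - u t j \<bullet> v0\<bar>) / \<delta>)
      \<longlongrightarrow> (\<Sum>j\<in>J. \<bar>u0 j \<bullet> v0 - u0 j \<bullet> v0\<bar>) / \<delta>) F"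
    using \<delta>(1) by (intro tendsto_intros lim[rule_format] b[rule_format]) auto
  then have "((\<lambda>t. (\<Sum>j\<in>J. \<bar>u t j \<bullet> v t - u t j \<bullet> v0\<bar>) / \<delta>) \<longlongrightarrow> 0) F"
    by simp
  moreover have "\<forall>\<^sub>F t in F. norm (v t - v0) \<le> (\<Sum>j\<in>J. \<bar>u t j \<bullet> v t - u t j \<bullet> v0\<bar>) / \<delta>"
    using \<delta>(2)
  proof (rule eventually_mono)
    fix t
    assume "\<forall>z. \<delta> * norm z \<le> (\<Sum>j\<in>J. \<bar>u t j \<bullet> z\<bar>)"
    from this[rule_format, of "v t - v0"]
    show "norm (v t - v0) \<le> (\<Sum>j\<in>J. \<bar>u t j \<bullet> v t - u t j \<bullet> v0\<bar>) / \<delta>"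
      using \<delta>(1) by (simp add: inner_diff_right field_simps)
  qed
  ultimately have "((\<lambda>t. v t - v0) \<longlongrightarrow> 0) F"
    by (rule Lim_null_comparison[rotated])
  then show ?thesis
    by (simp add: LIM_zero_iff)
qed

lemma spanning_basis:
  fixes u :: "'j \<Rightarrow> 'a::euclidean_space"
  assumes "finite J" "spanning u J" "card J = DIM('a)"
  shows "inj_on u J" "independent (u ` J)"
proof -
  have sp: "span (u ` J) = UNIV"
    by (rule spanning_span) fact
  have "DIM('a) = dim (u ` J)"
    by (metis dim_UNIV dim_span sp)
  also have "\<dots> \<le> card (u ` J)"
    using assms(1) by (intro dim_le_card') auto
  finally have "card (u ` J) = card J"
    using card_image_le[OF assms(1), of u] assms(3) by simp
  with assms(1) show "inj_on u J"
    by (simp add: eq_card_imp_inj_on)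
  show "independent (u ` J)"
    by (rule card_le_dim_spanning[of _ UNIV])
       (use sp assms \<open>card (u ` J) = card J\<close> in auto)
qed

lemma spanning_solve:
  fixes u :: "'j \<Rightarrow> 'a::euclidean_space"
  assumes "finite J" "spanning u J" "card J = DIM('a)"
  shows "\<exists>v. \<forall>j\<in>J. u j \<bullet> v = b j"
proof -
  note basis = spanning_basis[OF assms]
  obtain g :: "'a \<Rightarrow> real" where g: "linear g" "\<And>x. x \<in> u ` J \<Longrightarrow> g x = b (inv_into J u x)"
    using linear_independent_extend[OF basis(2), of "\<lambda>x. b (inv_into J u x)"] by blast
  show ?thesis
  proof (intro exI[of _ "adjoint g 1"] ballI)
    fix j assume "j \<in> J"
    then show "u j \<bullet> adjoint g 1 = b j"
      using g basis(1) by (simp add: adjoint_works)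
  qed
qed

lemma spanning_solution_unique:
  assumes "spanning u J" "\<And>j. j \<in> J \<Longrightarrow> u j \<bullet> v = u j \<bullet> w"
  shows "v = w"
  using spanningD[OF assms(1), of "v - w"] assms(2) by (simp add: inner_diff_right)

lemma spanning_representation:
  fixes u :: "'j \<Rightarrow> 'a::euclidean_space"
  assumes "finite J" "spanning u J" "card J = DIM('a)"
  shows "\<exists>\<alpha>. v = (\<Sum>j\<in>J. \<alpha> j *\<^sub>R u j)"
proof -
  note basis = spanning_basis[OF assms]
  have "v \<in> span (u ` J)"
    using spanning_span[OF assms(2)] by simp
  then obtain c where "v = (\<Sum>x\<in>u ` J. c x *\<^sub>R x)"
    using assms(1) by (subst (asm) span_finite) auto
  then have "v = (\<Sum>j\<in>J. c (u j) *\<^sub>R u j)"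
    by (simp add: sum.reindex[OF basis(1)])
  then show ?thesis
    by (intro exI[of _ "\<lambda>j. c (u j)"])
qed

text \<open>The coefficients of a convergent family of vectors with respect to a convergent family of
  bases converge: they are inner products with the dual basis, which solves a linear system.\<close>

lemma tendsto_representation:
  fixes u :: "'t \<Rightarrow> 'j \<Rightarrow> 'a::euclidean_space"
  assumes J: "finite J" "spanning u0 J" "card J = DIM('a)"
    and lim: "\<forall>j\<in>J. ((\<lambda>t. u t j) \<longlongrightarrow> u0 j) F"
    and r: "(r \<longlongrightarrow> (\<Sum>j\<in>J. \<alpha>0 j *\<^sub>R u0 j)) F"
  obtains \<alpha> where "\<forall>\<^sub>F t in F. r t = (\<Sum>j\<in>J. \<alpha> t j *\<^sub>R u t j)"
    "\<And>j. j \<in> J \<Longrightarrow> ((\<lambda>t. \<alpha> t j) \<longlongrightarrow> \<alpha>0 j) F"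
proof -
  \<comment> \<open>The dual basis. Where \<open>u t\<close> does not span, its value is arbitrary,
    which a limit statement does not see.\<close>
  define w where "w t j = (SOME w. \<forall>i\<in>J. u t i \<bullet> w = (if i = j then 1 else 0))" for t j
  have ev: "\<forall>\<^sub>F t in F. spanning (u t) J"
    by (rule eventually_spanning[OF J(1,2) lim])
  have w: "\<forall>i\<in>J. u t i \<bullet> w t j = (if i = j then 1 else 0)"
    if "spanning (u t) J" for t j
    unfolding w_def
    by (rule someI_ex) (rule spanning_solve[OF J(1) that J(3)])
  have coeff: "(\<Sum>i\<in>J. \<alpha> i *\<^sub>R u t i) \<bullet> w t j = \<alpha> j" if "spanning (u t) J" "j \<in> J" for t j \<alpha>
  proof -
    have "(\<Sum>i\<in>J. \<alpha> i *\<^sub>R u t i) \<bullet> w t j = (\<Sum>i\<in>J. if i = j then \<alpha> i else 0)"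
      unfolding inner_sum_left by (intro sum.cong) (use w[OF that(1), of j] in auto)
    with that(2) J(1) show ?thesis
      by simp
  qed
  define a where "a t j = r t \<bullet> w t j" for t j
  have rep: "r t = (\<Sum>j\<in>J. a t j *\<^sub>R u t j)" if t: "spanning (u t) J" for t
  proof -
    obtain \<alpha> where \<alpha>: "r t = (\<Sum>j\<in>J. \<alpha> j *\<^sub>R u t j)"
      using spanning_representation[OF J(1) t J(3)] by blast
    have "a t j = \<alpha> j" if "j \<in> J" for j
      unfolding a_def by (subst \<alpha>, rule coeff[OF t that])
    with \<alpha> show ?thesis
      by simp
  qed
  have "((\<lambda>t. a t j) \<longlongrightarrow> \<alpha>0 j) F" if j: "j \<in> J" for j
  proof -
    obtain w0 where w0: "\<forall>i\<in>J. u0 i \<bullet> w0 = (if i = j then 1 else 0)"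
      using spanning_solve[OF J, where b = "\<lambda>i. if i = j then 1 else 0"] by blast
    have "((\<lambda>t. w t j) \<longlongrightarrow> w0) F"
    proof (rule tendsto_solution[OF J(1,2) lim], intro ballI)
      fix i assume i: "i \<in> J"
      have "\<forall>\<^sub>F t in F. u t i \<bullet> w t j = (if i = j then 1 else 0)"
        using ev by (rule eventually_mono) (use w i in blast)
      then show "((\<lambda>t. u t i \<bullet> w t j) \<longlongrightarrow> u0 i \<bullet> w0) F"
        using w0 i by (simp add: tendsto_eventually)
    qed
    then have "((\<lambda>t. a t j) \<longlongrightarrow> (\<Sum>i\<in>J. \<alpha>0 i *\<^sub>R u0 i) \<bullet> w0) F"
      unfolding a_def by (intro tendsto_intros r)
    moreover have "(\<Sum>i\<in>J. \<alpha>0 i *\<^sub>R u0 i) \<bullet> w0 = (\<Sum>i\<in>J. if i = j then \<alpha>0 i else 0)"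
      unfolding inner_sum_left by (intro sum.cong) (use w0 in auto)
    then have "(\<Sum>i\<in>J. \<alpha>0 i *\<^sub>R u0 i) \<bullet> w0 = \<alpha>0 j"
      using j J(1) by simp
    ultimately show ?thesis
      by simp
  qed
  moreover have "\<forall>\<^sub>F t in F. r t = (\<Sum>j\<in>J. a t j *\<^sub>R u t j)"
    using ev by (rule eventually_mono) (rule rep)
  ultimately show thesis
    using that by blast
qed

section \<open>Complexes that lift to the lower hull\<close>

lemma convex_hull_Int_supporting_hyperplane:
  fixes T :: "'a::euclidean_space set"
  assumes "finite T" "\<And>x. x \<in> T \<Longrightarrow> n \<bullet> x \<le> \<beta>"
  shows "convex hull T \<inter> {x. n \<bullet> x = \<beta>} = convex hull (T \<inter> {x. n \<bullet> x = \<beta>})"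
    and "convex hull T \<inter> {x. n \<bullet> x = \<beta>} face_of convex hull T"
proof -
  have sub: "convex hull T \<subseteq> {x. n \<bullet> x \<le> \<beta>}"
    using assms(2) by (intro hull_minimal) (auto simp: convex_halfspace_le)
  then show face: "convex hull T \<inter> {x. n \<bullet> x = \<beta>} face_of convex hull T"
    by (intro face_of_Int_supporting_hyperplane_le) auto
  obtain T' where T': "T' \<subseteq> T" "convex hull T \<inter> {x. n \<bullet> x = \<beta>} = convex hull T'"
    using face_of_convex_hull_subset[OF finite_imp_compact[OF assms(1)] face] by blast
  have "T' \<subseteq> T \<inter> {x. n \<bullet> x = \<beta>}"
    using T' hull_subset[of T' convex] by auto
  then have "convex hull T \<inter> {x. n \<bullet> x = \<beta>} \<subseteq> convex hull (T \<inter> {x. n \<bullet> x = \<beta>})"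
    using T'(2) hull_mono by metis
  moreover have "convex hull (T \<inter> {x. n \<bullet> x = \<beta>}) \<subseteq> convex hull T \<inter> {x. n \<bullet> x = \<beta>}"
    by (intro Int_greatest hull_mono hull_minimal) (auto simp: convex_hyperplane)
  ultimately show "convex hull T \<inter> {x. n \<bullet> x = \<beta>} = convex hull (T \<inter> {x. n \<bullet> x = \<beta>})"
    by (rule subset_antisym)
qed

text \<open>\<open>P\<close> is the projected position and \<open>h\<close> the height of a vertex;
  some affine function below all heights touches them exactly on \<open>A\<close>. Vertices are
  abstract indices, so that the same set \<open>A\<close> names a face before and after a
  deformation.\<close>

definition lower_face :: "('v \<Rightarrow> 'a::euclidean_space) \<Rightarrow> ('v \<Rightarrow> real) \<Rightarrow> 'v set \<Rightarrow> 'v set \<Rightarrow> bool" where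
  "lower_face P h V A \<longleftrightarrow>
     finite V \<and> A \<subseteq> V \<and>
     (\<exists>c b. \<forall>x\<in>V. c \<bullet> P x + b \<le> h x \<and> (c \<bullet> P x + b = h x \<longleftrightarrow> x \<in> A))"

lemma lower_faceE:
  assumes "lower_face P h V A"
  obtains c b where "\<And>x. x \<in> V \<Longrightarrow> c \<bullet> P x + b \<le> h x"
    "\<And>x. x \<in> V \<Longrightarrow> c \<bullet> P x + b = h x \<longleftrightarrow> x \<in> A"
  using assms unfolding lower_face_def by metis

text \<open>The average of the two affine functions touches the heights only where both do.\<close>

lemma lower_face_Int:
  assumes "lower_face P h V A" "lower_face P h V B"
  shows "lower_face P h V (A \<inter> B)"
proof -
  obtain c b where cb: "\<And>x. x \<in> V \<Longrightarrow> c \<bullet> P x + b \<le> h x"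
    "\<And>x. x \<in> V \<Longrightarrow> c \<bullet> P x + b = h x \<longleftrightarrow> x \<in> A"
    using lower_faceE[OF assms(1)] by blast
  obtain c' b' where cb': "\<And>x. x \<in> V \<Longrightarrow> c' \<bullet> P x + b' \<le> h x"
    "\<And>x. x \<in> V \<Longrightarrow> c' \<bullet> P x + b' = h x \<longleftrightarrow> x \<in> B"
    using lower_faceE[OF assms(2)] by blast
  have eq: "((c + c') /\<^sub>R 2) \<bullet> P x + (b + b') / 2 = ((c \<bullet> P x + b) + (c' \<bullet> P x + b')) / 2" for x
    by (simp add: inner_add_left field_simps)
  have "((c + c') /\<^sub>R 2) \<bullet> P x + (b + b') / 2 \<le> h x \<and>
      (((c + c') /\<^sub>R 2) \<bullet> P x + (b + b') / 2 = h x \<longleftrightarrow> x \<in> A \<inter> B)" if x: "x \<in> V" for x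
    unfolding eq using cb[OF x] cb'[OF x] by (auto simp: field_simps)
  moreover have "finite V" "A \<inter> B \<subseteq> V"
    using assms(1) by (auto simp: lower_face_def)
  ultimately show ?thesis
    unfolding lower_face_def by blast
qed

lemma lower_face_hull_lift:
  assumes A: "A \<subseteq> V" and q: "q \<in> convex hull (P ` A)"
  obtains t where "(q, t) \<in> convex hull ((\<lambda>x. (P x, h x)) ` A)"
proof -
  have "convex hull (P ` A) = fst ` (convex hull ((\<lambda>x. (P x, h x)) ` A))"
    by (simp add: convex_hull_linear_image[OF linear_fst] image_image)
  with q obtain z where "z \<in> convex hull ((\<lambda>x. (P x, h x)) ` A)" "q = fst z"
    by auto
  then show thesis
    using that[of "snd z"] by simp
qed

lemma lift_hull_above:
  fixes P :: "'v \<Rightarrow> 'a::euclidean_space"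
  assumes "(q, t) \<in> convex hull ((\<lambda>x. (P x, h x)) ` A)" "\<And>x. x \<in> A \<Longrightarrow> c \<bullet> P x + b \<le> h x"
  shows "c \<bullet> q + b \<le> t"
proof -
  have "convex hull ((\<lambda>x. (P x, h x)) ` A) \<subseteq> {z. (c, -1) \<bullet> z \<le> -b}"
    using assms(2) by (intro hull_minimal convex_halfspace_le) (force simp: inner_prod_def)
  with assms(1) show ?thesis
    by (auto simp: inner_prod_def)
qed

lemma lift_hull_on:
  fixes P :: "'v \<Rightarrow> 'a::euclidean_space"
  assumes "(q, t) \<in> convex hull ((\<lambda>x. (P x, h x)) ` A)" "\<And>x. x \<in> A \<Longrightarrow> c \<bullet> P x + b = h x"
  shows "c \<bullet> q + b = t"
proof -
  have "convex hull ((\<lambda>x. (P x, h x)) ` A) \<subseteq> {z. (c, -1) \<bullet> z = -b}"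
    using assms(2) by (intro hull_minimal convex_hyperplane) (force simp: inner_prod_def)
  with assms(1) show ?thesis
    by (auto simp: inner_prod_def)
qed

text \<open>Lift a common point \<open>q\<close> to heights \<open>t\<close> and \<open>s\<close>
  over the two faces. Each affine function lies below the other lift, so \<open>s = t\<close>, and
  the lifted point lies on both supporting hyperplanes; it is then a convex combination of lifted
  vertices of \<open>A \<inter> B\<close>.\<close>

lemma lower_face_hull_Int:
  fixes P :: "'v \<Rightarrow> 'a::euclidean_space"
  assumes A: "lower_face P h V A" and B: "lower_face P h V B"
  shows "convex hull (P ` A) \<inter> convex hull (P ` B) = convex hull (P ` (A \<inter> B))"
proof
  show "convex hull (P ` (A \<inter> B)) \<subseteq> convex hull (P ` A) \<inter> convex hull (P ` B)"
    by (intro Int_greatest hull_mono) auto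
  show "convex hull (P ` A) \<inter> convex hull (P ` B) \<subseteq> convex hull (P ` (A \<inter> B))"
  proof
    fix q assume q: "q \<in> convex hull (P ` A) \<inter> convex hull (P ` B)"
    have AV: "A \<subseteq> V" and BV: "B \<subseteq> V" and fin: "finite A"
      using A B by (auto simp: lower_face_def intro: finite_subset)
    obtain c b where cb: "\<And>x. x \<in> V \<Longrightarrow> c \<bullet> P x + b \<le> h x"
      "\<And>x. x \<in> V \<Longrightarrow> c \<bullet> P x + b = h x \<longleftrightarrow> x \<in> A"
      using lower_faceE[OF A] by blast
    obtain c' b' where cb': "\<And>x. x \<in> V \<Longrightarrow> c' \<bullet> P x + b' \<le> h x"
      "\<And>x. x \<in> V \<Longrightarrow> c' \<bullet> P x + b' = h x \<longleftrightarrow> x \<in> B"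
      using lower_faceE[OF B] by blast
    obtain t where t: "(q, t) \<in> convex hull ((\<lambda>x. (P x, h x)) ` A)"
      using lower_face_hull_lift[OF AV] q by blast
    obtain s where s: "(q, s) \<in> convex hull ((\<lambda>x. (P x, h x)) ` B)"
      using lower_face_hull_lift[OF BV] q by blast
    have "c \<bullet> q + b = t"
      using lift_hull_on[OF t] cb(2) AV by blast
    moreover have "c \<bullet> q + b \<le> s"
      using lift_hull_above[OF s] cb(1) BV by blast
    moreover have "c' \<bullet> q + b' = s"
      using lift_hull_on[OF s] cb'(2) BV by blast
    moreover have "c' \<bullet> q + b' \<le> t"
      using lift_hull_above[OF t] cb'(1) AV by blast
    ultimately have "c' \<bullet> q + b' = t"
      by linarith
    let ?T = "(\<lambda>x. (P x, h x)) ` A"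
    have "(q, t) \<in> convex hull ?T \<inter> {z. (c', -1) \<bullet> z = -b'}"
      using t \<open>c' \<bullet> q + b' = t\<close> by (simp add: inner_prod_def)
    also have "\<dots> = convex hull (?T \<inter> {z. (c', -1) \<bullet> z = -b'})"
      using cb'(1) AV fin by (intro convex_hull_Int_supporting_hyperplane) (force simp: inner_prod_def)+
    finally have "(q, t) \<in> convex hull (?T \<inter> {z. (c', -1) \<bullet> z = -b'})" .
    moreover have "?T \<inter> {z. (c', -1) \<bullet> z = -b'} \<subseteq> (\<lambda>x. (P x, h x)) ` (A \<inter> B)"
    proof
      fix z assume "z \<in> ?T \<inter> {z. (c', -1) \<bullet> z = -b'}"
      then obtain x where x: "x \<in> A" "z = (P x, h x)" and "c' \<bullet> P x - h x = -b'"
        by (auto simp: inner_prod_def)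
      then have "c' \<bullet> P x + b' = h x"
        by linarith
      then have "x \<in> B"
        using cb'(2) x AV by blast
      with x show "z \<in> (\<lambda>x. (P x, h x)) ` (A \<inter> B)"
        by blast
    qed
    ultimately have "(q, t) \<in> convex hull ((\<lambda>x. (P x, h x)) ` (A \<inter> B))"
      using hull_mono by blast
    then have "fst (q, t) \<in> fst ` (convex hull ((\<lambda>x. (P x, h x)) ` (A \<inter> B)))"
      by (rule imageI)
    then show "q \<in> convex hull (P ` (A \<inter> B))"
      by (simp add: convex_hull_linear_image[OF linear_fst] image_image)
  qed
qed

text \<open>The same squeeze between two supporting functions, applied to one vertex: a vertex of a
  lower face cannot lie in the projection of a lower face to which it does not belong.\<close>

lemma lower_face_hull_subset_iff:
  fixes P :: "'v \<Rightarrow> 'a::euclidean_space"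
  assumes A: "lower_face P h V A" and B: "lower_face P h V B"
  shows "convex hull (P ` A) \<subseteq> convex hull (P ` B) \<longleftrightarrow> A \<subseteq> B"
proof
  assume sub: "convex hull (P ` A) \<subseteq> convex hull (P ` B)"
  show "A \<subseteq> B"
  proof
    fix x assume x: "x \<in> A"
    have AV: "A \<subseteq> V" and BV: "B \<subseteq> V"
      using A B by (auto simp: lower_face_def)
    obtain c b where cb: "\<And>x. x \<in> V \<Longrightarrow> c \<bullet> P x + b \<le> h x"
      "\<And>x. x \<in> V \<Longrightarrow> c \<bullet> P x + b = h x \<longleftrightarrow> x \<in> A"
      using lower_faceE[OF A] by blast
    obtain c' b' where cb': "\<And>x. x \<in> V \<Longrightarrow> c' \<bullet> P x + b' \<le> h x"
      "\<And>x. x \<in> V \<Longrightarrow> c' \<bullet> P x + b' = h x \<longleftrightarrow> x \<in> B"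
      using lower_faceE[OF B] by blast
    have "P x \<in> convex hull (P ` B)"
      using sub x by (meson hull_inc image_eqI subset_iff)
    then obtain s where s: "(P x, s) \<in> convex hull ((\<lambda>x. (P x, h x)) ` B)"
      using lower_face_hull_lift[OF BV] by blast
    have "c' \<bullet> P x + b' = s"
      using lift_hull_on[OF s] cb'(2) BV by blast
    moreover have "c \<bullet> P x + b \<le> s"
      using lift_hull_above[OF s] cb(1) BV by blast
    moreover have "c \<bullet> P x + b = h x" "c' \<bullet> P x + b' \<le> h x"
      using cb cb' x AV by blast+
    ultimately have "c' \<bullet> P x + b' = h x"
      by linarith
    then show "x \<in> B"
      using cb'(2) x AV by blast
  qed
qed (auto intro!: hull_mono)

text \<open>On \<open>B\<close> the heights coincide with the affine function of \<open>B\<close>,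
  so the difference of the two affine functions vanishes on \<open>A\<close> and is negative on the
  rest of \<open>B\<close>. It involves only projected positions and therefore supports the
  projected face.\<close>

lemma lower_face_hull_face_of:
  fixes P :: "'v \<Rightarrow> 'a::euclidean_space"
  assumes A: "lower_face P h V A" and B: "lower_face P h V B" and sub: "A \<subseteq> B"
  shows "convex hull (P ` A) face_of convex hull (P ` B)"
proof -
  have BV: "B \<subseteq> V" and fin: "finite (P ` B)"
    using B by (auto simp: lower_face_def intro: finite_subset)
  obtain c b where cb: "\<And>x. x \<in> V \<Longrightarrow> c \<bullet> P x + b \<le> h x"
    "\<And>x. x \<in> V \<Longrightarrow> c \<bullet> P x + b = h x \<longleftrightarrow> x \<in> A"
    using lower_faceE[OF A] by blast
  obtain c' b' where cb': "\<And>x. x \<in> V \<Longrightarrow> c' \<bullet> P x + b' \<le> h x"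
    "\<And>x. x \<in> V \<Longrightarrow> c' \<bullet> P x + b' = h x \<longleftrightarrow> x \<in> B"
    using lower_faceE[OF B] by blast
  have le: "(c - c') \<bullet> P x \<le> b' - b \<and> ((c - c') \<bullet> P x = b' - b \<longleftrightarrow> x \<in> A)" if "x \<in> B" for x
  proof -
    have "x \<in> V" "c' \<bullet> P x + b' = h x"
      using that BV cb'(2) by auto
    then show ?thesis
      using cb(1)[of x] cb(2)[of x] by (auto simp: inner_diff_left)
  qed
  have "P ` B \<inter> {q. (c - c') \<bullet> q = b' - b} = P ` A"
    using le sub by blast
  moreover have "q \<in> P ` B \<Longrightarrow> (c - c') \<bullet> q \<le> b' - b" for q
    using le by auto
  ultimately show ?thesis
    using convex_hull_Int_supporting_hyperplane[OF fin] by metis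
qed

section \<open>Local dimension\<close>

lemma euclidean_homeomorphic_Euclidean_space:
  "(euclidean :: 'e::euclidean_space topology) homeomorphic_space Euclidean_space DIM('e)"
proof -
  obtain b where b: "bij_betw b {..<DIM('e)} (Basis :: 'e set)"
    using ex_bij_betw_nat_finite[OF finite_Basis] by (auto simp: atLeast0LessThan)
  \<comment> \<open>Points of \<open>Euclidean_space d\<close> are sequences that vanish from index
    \<open>d\<close> on; hence the padding with 0.\<close>
  let ?f = "\<lambda>(x::'e) i. if i < DIM('e) then x \<bullet> b i else 0"
  let ?g = "\<lambda>y. \<Sum>i<DIM('e). y i *\<^sub>R b i"
  have "continuous_map euclidean (Euclidean_space DIM('e)) ?f"
    by (subst continuous_map_componentwise_Euclidean_space) (auto intro: continuous_intros)
  moreover have "continuous_map (Euclidean_space DIM('e)) euclidean ?g"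
  proof -
    have "continuous_map (Euclidean_space DIM('e)) euclidean (\<lambda>y. y i *\<^sub>R b i)" for i
    proof -
      have "continuous_map (Euclidean_space DIM('e)) euclideanreal (\<lambda>y. y i)"
        unfolding Euclidean_space_def
        by (intro continuous_map_from_subtopology continuous_map_product_projection) auto
      moreover have "continuous_map euclideanreal euclidean (\<lambda>r. r *\<^sub>R b i)"
        by (auto intro: continuous_intros)
      ultimately show ?thesis
        using continuous_map_compose[of _ _ "\<lambda>y. y i" _ "\<lambda>r. r *\<^sub>R b i"] by (simp add: o_def)
    qed
    then show ?thesis
      by (intro continuous_map_sum) auto
  qed
  moreover have "?g (?f x) = x" for x
  proof -
    have "?g (?f x) = (\<Sum>i<DIM('e). (x \<bullet> b i) *\<^sub>R b i)"
      by simp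
    also have "\<dots> = (\<Sum>v\<in>Basis. (x \<bullet> v) *\<^sub>R v)"
      by (rule sum.reindex_bij_betw[OF b])
    finally show ?thesis
      by (simp add: euclidean_representation)
  qed
  moreover have "?f (?g y) = y" if y: "y \<in> topspace (Euclidean_space DIM('e))" for y
  proof
    fix i
    show "?f (?g y) i = y i"
    proof (cases "i < DIM('e)")
      case True
      have "b j \<bullet> b i = (if j = i then 1 else 0)" if "j < DIM('e)" for j
      proof -
        have "b j \<in> Basis" "b i \<in> Basis" "b j = b i \<longleftrightarrow> j = i"
          using b that True by (auto simp: bij_betw_def inj_on_def)
        then show ?thesis
          by (simp add: inner_Basis)
      qed
      then have "?g y \<bullet> b i = (\<Sum>j<DIM('e). if j = i then y j else 0)"
        unfolding inner_sum_left by (intro sum.cong) auto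
      with True show ?thesis
        by simp
    next
      case False
      with y show ?thesis
        by (simp add: topspace_Euclidean_space)
    qed
  qed
  ultimately have "homeomorphic_maps euclidean (Euclidean_space DIM('e)) ?f ?g"
    by (simp add: homeomorphic_maps_def)
  then show ?thesis
    by (auto simp: homeomorphic_space_def)
qed

text \<open>A continuous injection of a closed ball into a Hausdorff space is an embedding, since it
  is a closed map on a compact space. Hence every neighbourhood of \<open>\<Psi> 0\<close> contains
  the image of a small open ball, and this image is a cell.\<close>

lemma local_dimension_ge:
  fixes \<Psi> :: "'e::euclidean_space \<Rightarrow> 'v"
  assumes "Hausdorff_space X" "r > 0"
    and cont: "continuous_map (top_of_set (ball 0 r)) X \<Psi>" and inj: "inj_on \<Psi> (ball 0 r)"
  shows "enat DIM('e) \<le> local_dimension X (\<Psi> 0)"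
proof -
  have mem: "\<Psi> 0 \<in> topspace X"
    using cont \<open>r > 0\<close> by (auto simp: continuous_map_def)
  have "\<exists>B\<subseteq>U. subtopology X B homeomorphic_space Euclidean_space DIM('e)"
    if U: "openin X U" "\<Psi> 0 \<in> U" for U
  proof -
    have "openin (top_of_set (ball 0 r)) {\<xi> \<in> ball 0 r. \<Psi> \<xi> \<in> U}"
      using openin_continuous_map_preimage[OF cont U(1)] by simp
    then have "open {\<xi> \<in> ball 0 r. \<Psi> \<xi> \<in> U}"
      using openin_open_trans by blast
    moreover have "0 \<in> {\<xi> \<in> ball 0 r. \<Psi> \<xi> \<in> U}"
      using U(2) \<open>r > 0\<close> by simp
    ultimately obtain s where s: "s > 0" "cball 0 s \<subseteq> {\<xi> \<in> ball 0 r. \<Psi> \<xi> \<in> U}"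
      by (meson open_contains_cball)
    have contc: "continuous_map (top_of_set (cball 0 s)) X \<Psi>"
      by (rule continuous_map_from_subtopology_mono[OF cont]) (use s in auto)
    have "closed_map (top_of_set (cball 0 s)) X \<Psi>"
      by (rule continuous_imp_closed_map[OF contc _ assms(1)]) (simp add: compact_space_subtopology)
    moreover have "inj_on \<Psi> (cball 0 s)"
      using inj by (rule inj_on_subset) (use s in auto)
    ultimately have "embedding_map (top_of_set (cball 0 s)) X \<Psi>"
      using injective_closed_imp_embedding_map[OF contc] by simp
    then have hom: "homeomorphic_map (top_of_set (cball 0 s)) (subtopology X (\<Psi> ` cball 0 s)) \<Psi>"
      by (simp add: embedding_map_def)
    have "homeomorphic_map (subtopology (top_of_set (cball 0 s)) (ball 0 s))
        (subtopology (subtopology X (\<Psi> ` cball 0 s)) (\<Psi> ` ball 0 s)) \<Psi>"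
    proof (rule homeomorphic_map_subtopologies[OF hom])
      have "\<Psi> ` cball 0 s \<subseteq> topspace X"
        using contc by (auto simp: continuous_map_def)
      moreover have "\<Psi> ` ball 0 s \<subseteq> \<Psi> ` cball 0 s"
        by (intro image_mono) auto
      ultimately show "\<Psi> ` (topspace (top_of_set (cball 0 s)) \<inter> ball 0 s)
          = topspace (subtopology X (\<Psi> ` cball 0 s)) \<inter> \<Psi> ` ball 0 s"
        by (auto simp: Int_absorb1)
    qed
    moreover have "cball 0 s \<inter> ball 0 s = ball (0::'e) s" "\<Psi> ` cball 0 s \<inter> \<Psi> ` ball 0 s = \<Psi> ` ball 0 s"
      by auto
    ultimately have "homeomorphic_map (top_of_set (ball 0 s)) (subtopology X (\<Psi> ` ball 0 s)) \<Psi>"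
      by (simp add: subtopology_subtopology)
    then have "top_of_set (ball (0::'e) s) homeomorphic_space subtopology X (\<Psi> ` ball 0 s)"
      by (rule homeomorphic_map_imp_homeomorphic_space)
    then have "subtopology X (\<Psi> ` ball 0 s) homeomorphic_space top_of_set (ball (0::'e) s)"
      by (subst homeomorphic_space_sym)
    also have "top_of_set (ball (0::'e) s) homeomorphic_space top_of_set (UNIV :: 'e set)"
    proof -
      obtain f g where "homeomorphism (ball (0::'e) s) (UNIV :: 'e set) f g"
        using homeomorphic_ball_UNIV[OF s(1), of "0::'e"] by (auto simp: homeomorphic_def)
      then have "homeomorphic_maps (top_of_set (ball 0 s)) (top_of_set UNIV) f g"
        by (auto simp: homeomorphism_def homeomorphic_maps_def continuous_map_in_subtopology)
      then show ?thesis
        by (auto simp: homeomorphic_space_def)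
    qed
    also have "top_of_set (UNIV :: 'e set) homeomorphic_space Euclidean_space DIM('e)"
      using euclidean_homeomorphic_Euclidean_space by simp
    finally have "subtopology X (\<Psi> ` ball 0 s) homeomorphic_space Euclidean_space DIM('e)" .
    moreover have "\<Psi> ` ball 0 s \<subseteq> U"
      using s(2) ball_subset_cball[of 0 s] by blast
    ultimately show ?thesis
      by blast
  qed
  with mem show ?thesis
    unfolding local_dimension_def by (intro SUP_upper) auto
qed

section \<open>Realizations of the surface\<close>

text \<open>\<sigma> chooses one of the two facets over every edge; these are the \<open>p\<close>
  facets through a polygon of the surface.\<close>

definition sel_graph :: "('q \<Rightarrow> bool) \<Rightarrow> ('q \<times> bool) set" where
  "sel_graph \<sigma> = range (\<lambda>i. (i, \<sigma> i))"

text \<open>Over the corner of the base polygon where the edges \<open>l\<close> and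
  \<open>s l\<close> meet, both facets over each of these two edges are tight; with the selected
  facets over the other edges this makes \<open>p + 2\<close>.\<close>

definition vertex_labels :: "('q \<Rightarrow> 'q) \<Rightarrow> 'q \<Rightarrow> ('q \<Rightarrow> bool) \<Rightarrow> ('q \<times> bool) set" where
  "vertex_labels s l \<sigma> = {(i, t). t = \<sigma> i \<or> i = l \<or> i = s l}"

lemma sel_graph_iff [simp]: "(i, t) \<in> sel_graph \<sigma> \<longleftrightarrow> t = \<sigma> i"
  by (auto simp: sel_graph_def)

lemma vertex_labels_iff [simp]: "(i, t) \<in> vertex_labels s l \<sigma> \<longleftrightarrow> t = \<sigma> i \<or> i = l \<or> i = s l"
  by (simp add: vertex_labels_def)

lemma sel_graph_subset_vertex_labels [simp]: "sel_graph \<sigma> \<subseteq> vertex_labels s l \<sigma>"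
  by (auto simp: sel_graph_def)

text \<open>\<open>s\<close> is the cyclic successor of an edge. Of the cyclic order the arguments
  only use that \<open>l\<close>, \<open>s l\<close>, \<open>s (s l)\<close> are distinct and that
  every edge has a predecessor.\<close>

locale wedge_incidence =
  fixes X :: "'v set" and J :: "'v \<Rightarrow> ('q::finite \<times> bool) set" and s :: "'q \<Rightarrow> 'q"
  assumes finite_X: "finite X"
    and s_neq: "s l \<noteq> l" and ss_neq: "s (s l) \<noteq> l" and surj_s: "surj s"
    and J_vertex: "x \<in> X \<Longrightarrow> \<exists>l \<sigma>. J x = vertex_labels s l \<sigma>"
    and inj_J: "inj_on J X"
    and ex_vertex: "\<exists>x\<in>X. J x = vertex_labels s l \<sigma>"
begin

definition face_verts :: "('q \<times> bool) set \<Rightarrow> 'v set" where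
  "face_verts I = {x \<in> X. I \<subseteq> J x}"

definition cells :: "('q \<times> bool) set set" where
  "cells = {I. (\<exists>\<sigma>. sel_graph \<sigma> \<subseteq> I) \<and> face_verts I \<noteq> {}}"

lemma face_verts_Un: "face_verts (I \<union> I') = face_verts I \<inter> face_verts I'"
  by (auto simp: face_verts_def)

lemma finite_face_verts: "finite (face_verts I)"
  using finite_X by (auto simp: face_verts_def)

lemma card_vertex_labels: "card (vertex_labels s l \<sigma>) = CARD('q) + 2"
proof -
  have "vertex_labels s l \<sigma> = insert (l, \<not> \<sigma> l) (insert (s l, \<not> \<sigma> (s l)) (sel_graph \<sigma>))"
    by (auto simp: vertex_labels_def sel_graph_def)
  moreover have "card (sel_graph \<sigma>) = CARD('q)"
    unfolding sel_graph_def by (intro card_image) (auto simp: inj_on_def)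
  ultimately show ?thesis
    using s_neq[of l] by (simp add: card_insert_if)
qed

text \<open>These are the two neighbours, on the polygon \<sigma>, of the corner at \<open>l\<close>
  and \<open>s l\<close>. Each lies on exactly one of the two edges meeting there, so evaluation at
  it isolates the coefficient of one edge slack.\<close>

lemma polygon_neighbours:
  obtains y y' where
    "y \<in> face_verts (sel_graph \<sigma>)" "(l, \<not> \<sigma> l) \<notin> J y" "(s l, \<not> \<sigma> (s l)) \<in> J y"
    "y' \<in> face_verts (sel_graph \<sigma>)" "(l, \<not> \<sigma> l) \<in> J y'" "(s l, \<not> \<sigma> (s l)) \<notin> J y'"
proof -
  obtain l' where l': "s l' = l"
    using surj_s by (metis surjD)
  obtain y where y: "y \<in> X" "J y = vertex_labels s (s l) \<sigma>"
    using ex_vertex by blast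
  obtain y' where y': "y' \<in> X" "J y' = vertex_labels s l' \<sigma>"
    using ex_vertex by blast
  show thesis
    by (rule that[of y y']) (use y y' l' s_neq[of l] ss_neq[of l] ss_neq[of l'] in \<open>auto simp: face_verts_def\<close>)
qed

text \<open>Both labels over \<open>l\<close> and over \<open>s l\<close> occur, so
  \<open>J x\<close> determines the selector only elsewhere, and the given \<sigma> can replace the
  original one.\<close>

lemma J_vertex_selector:
  assumes "x \<in> X" "sel_graph \<sigma> \<subseteq> J x"
  obtains l where "J x = vertex_labels s l \<sigma>"
proof -
  obtain l \<tau> where J: "J x = vertex_labels s l \<tau>"
    using J_vertex[OF assms(1)] by blast
  have "\<sigma> i = \<tau> i" if "i \<noteq> l" "i \<noteq> s l" for i
  proof -
    have "(i, \<sigma> i) \<in> J x"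
      using assms(2) by auto
    with that show ?thesis
      by (simp add: J)
  qed
  then have "vertex_labels s l \<tau> = vertex_labels s l \<sigma>"
    by (auto simp: vertex_labels_def)
  with J that show thesis
    by simp
qed

end

text \<open>The index set \<open>X\<close> stays fixed while \<open>v\<close> moves, so one locale
  covers the given polytope, with \<open>v\<close> the identity, and all its deformations.
  \<open>\<pi>\<close> gives the three visible coordinates and \<open>\<eta>\<close> the height;
  \<open>\<pi>_inj_polygon\<close> says that the projection kills no direction of the plane of a
  polygon.\<close>

locale wedge_configuration = wedge_incidence X J s
  for X :: "'v set" and J :: "'v \<Rightarrow> ('q::finite \<times> bool) set" and s :: "'q \<Rightarrow> 'q" +
  fixes \<pi> :: "'a::euclidean_space \<Rightarrow> real^3" and \<eta> :: 'a
    and n :: "'q \<times> bool \<Rightarrow> 'a" and \<gamma> :: "'q \<times> bool \<Rightarrow> real" and v :: "'v \<Rightarrow> 'a"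
  assumes linear_\<pi>: "linear \<pi>"
    and DIM: "DIM('a) = CARD('q) + 2"
    and slack_le: "x \<in> X \<Longrightarrow> n j \<bullet> v x \<le> \<gamma> j"
    and slack_eq_iff: "x \<in> X \<Longrightarrow> n j \<bullet> v x = \<gamma> j \<longleftrightarrow> j \<in> J x"
    and spanning_J: "x \<in> X \<Longrightarrow> spanning n (J x)"
    and \<pi>_inj_polygon: "(\<And>i. n (i, \<sigma> i) \<bullet> z = 0) \<Longrightarrow> \<pi> z = 0 \<Longrightarrow> z = 0"
    and lower_face_polygon:
      "lower_face (\<lambda>x. \<pi> (v x)) (\<lambda>x. \<eta> \<bullet> v x) X (face_verts (sel_graph \<sigma>))"
begin

abbreviation slack :: "'q \<times> bool \<Rightarrow> 'v \<Rightarrow> real" where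
  "slack j x \<equiv> n j \<bullet> v x - \<gamma> j"

definition cell :: "('q \<times> bool) set \<Rightarrow> (real^3) set" where
  "cell I = convex hull ((\<lambda>x. \<pi> (v x)) ` face_verts I)"

text \<open>Smaller faces are intersections of polygons: adding a label \<open>(i, t)\<close>
  amounts to intersecting with the polygon whose selector is changed to \<open>t\<close> at
  \<open>i\<close>.\<close>

lemma lower_face_cell:
  assumes "sel_graph \<sigma> \<subseteq> I"
  shows "lower_face (\<lambda>x. \<pi> (v x)) (\<lambda>x. \<eta> \<bullet> v x) X (face_verts I)"
proof -
  have "lower_face (\<lambda>x. \<pi> (v x)) (\<lambda>x. \<eta> \<bullet> v x) X (face_verts (sel_graph \<sigma> \<union> F))" for F
  proof (induction F rule: finite_induct[OF finite])
    case 1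
    show ?case
      using lower_face_polygon by simp
  next
    case (2 j F)
    obtain i t where j: "j = (i, t)"
      by fastforce
    have "sel_graph \<sigma> \<union> insert j F = (sel_graph \<sigma> \<union> F) \<union> sel_graph (\<sigma>(i := t))"
      by (auto simp: sel_graph_def j split: if_splits)
    then show ?case
      using lower_face_Int[OF 2(3) lower_face_polygon[of "\<sigma>(i := t)"]]
      by (simp only: face_verts_Un)
  qed
  from this[of I] assms show ?thesis
    by (simp add: Un_absorb1)
qed

lemma lower_face_cells:
  "I \<in> cells \<Longrightarrow> lower_face (\<lambda>x. \<pi> (v x)) (\<lambda>x. \<eta> \<bullet> v x) X (face_verts I)"
  using lower_face_cell by (auto simp: cells_def)

lemma cell_Int:
  assumes "I \<in> cells" "I' \<in> cells"
  shows "cell I \<inter> cell I' = cell (I \<union> I')"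
  using lower_face_hull_Int[OF lower_face_cells[OF assms(1)] lower_face_cells[OF assms(2)]]
  by (simp add: cell_def face_verts_Un)

lemma cell_subset_iff:
  assumes "I \<in> cells" "I' \<in> cells"
  shows "cell I \<subseteq> cell I' \<longleftrightarrow> face_verts I \<subseteq> face_verts I'"
  using lower_face_hull_subset_iff[OF lower_face_cells[OF assms(1)] lower_face_cells[OF assms(2)]]
  by (simp add: cell_def)

lemma cell_eq_iff:
  assumes "I \<in> cells" "I' \<in> cells"
  shows "cell I = cell I' \<longleftrightarrow> face_verts I = face_verts I'"
  using cell_subset_iff[OF assms] cell_subset_iff[OF assms(2,1)] by blast

lemma cell_face_of:
  assumes "I \<in> cells" "I \<subseteq> I'"
  shows "cell I' face_of cell I"
proof -
  obtain \<sigma> where "sel_graph \<sigma> \<subseteq> I"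
    using assms by (auto simp: cells_def)
  then show ?thesis
    unfolding cell_def
    by (intro lower_face_hull_face_of[where V = X and h = "\<lambda>x. \<eta> \<bullet> v x"] lower_face_cell[of \<sigma>])
      (use assms in \<open>auto simp: face_verts_def\<close>)
qed

text \<open>On a polygon of the surface all slacks vanish but those of its edges, so an affine function
  on its plane is a combination of the slacks of the two edges at any one of its vertices.\<close>

lemma polygon_representation:
  assumes x0: "x0 \<in> X" "J x0 = vertex_labels s l \<sigma>"
  obtains \<alpha> \<beta> \<mu> where
    "w = \<alpha> *\<^sub>R n (l, \<not> \<sigma> l) + \<beta> *\<^sub>R n (s l, \<not> \<sigma> (s l)) + (\<Sum>i\<in>UNIV. \<mu> i *\<^sub>R n (i, \<sigma> i))"
proof -
  let ?e1 = "(l, \<not> \<sigma> l)" and ?e2 = "(s l, \<not> \<sigma> (s l))"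
  obtain \<alpha> where \<alpha>: "w = (\<Sum>j\<in>J x0. \<alpha> j *\<^sub>R n j)"
    using spanning_representation[OF _ spanning_J[OF x0(1)], of w] card_vertex_labels DIM x0(2)
    by auto
  have "J x0 = insert ?e1 (insert ?e2 (sel_graph \<sigma>))"
    unfolding x0(2) by (auto simp: vertex_labels_def sel_graph_def)
  moreover have "?e1 \<notin> insert ?e2 (sel_graph \<sigma>)" "?e2 \<notin> sel_graph \<sigma>"
    using s_neq[of l] by auto
  ultimately have "w = \<alpha> ?e1 *\<^sub>R n ?e1 + (\<alpha> ?e2 *\<^sub>R n ?e2 + (\<Sum>j\<in>sel_graph \<sigma>. \<alpha> j *\<^sub>R n j))"
    by (simp add: \<alpha>)
  also have "(\<Sum>j\<in>sel_graph \<sigma>. \<alpha> j *\<^sub>R n j) = (\<Sum>i\<in>UNIV. \<alpha> (i, \<sigma> i) *\<^sub>R n (i, \<sigma> i))"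
    unfolding sel_graph_def by (subst sum.reindex) (auto simp: inj_on_def)
  finally show thesis
    by (intro that[of "\<alpha> ?e1" "\<alpha> ?e2" "\<lambda>i. \<alpha> (i, \<sigma> i)"]) (simp add: add.assoc)
qed

lemma polygon_affine_function:
  assumes x0: "x0 \<in> X" "J x0 = vertex_labels s l \<sigma>"
  obtains \<alpha> \<beta> where "\<And>x. x \<in> face_verts (sel_graph \<sigma>) \<Longrightarrow>
    w \<bullet> (v x - v x0) = \<alpha> * slack (l, \<not> \<sigma> l) x + \<beta> * slack (s l, \<not> \<sigma> (s l)) x"
proof -
  let ?e1 = "(l, \<not> \<sigma> l)" and ?e2 = "(s l, \<not> \<sigma> (s l))"
  obtain \<alpha> \<beta> \<mu> where w: "w = \<alpha> *\<^sub>R n ?e1 + \<beta> *\<^sub>R n ?e2 + (\<Sum>i\<in>UNIV. \<mu> i *\<^sub>R n (i, \<sigma> i))"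
    using polygon_representation[OF x0] by blast
  show thesis
  proof (rule that)
    fix x assume "x \<in> face_verts (sel_graph \<sigma>)"
    then have x: "x \<in> X" "sel_graph \<sigma> \<subseteq> J x"
      by (auto simp: face_verts_def)
    have x0_slack: "n j \<bullet> v x0 = \<gamma> j" if "j \<in> J x0" for j
      using slack_eq_iff[OF x0(1)] that by blast
    have "n (i, \<sigma> i) \<bullet> (v x - v x0) = 0" for i
    proof -
      have "(i, \<sigma> i) \<in> J x" "(i, \<sigma> i) \<in> J x0"
        using x(2) by (auto simp: x0(2))
      then show ?thesis
        using slack_eq_iff[OF x(1)] x0_slack by (simp add: inner_diff_right)
    qed
    moreover have "?e1 \<in> J x0" "?e2 \<in> J x0"
      by (simp_all add: x0(2))
    ultimately show "w \<bullet> (v x - v x0) = \<alpha> * slack ?e1 x + \<beta> * slack ?e2 x"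
      using x0_slack by (simp add: w inner_add_left inner_sum_left inner_diff_right algebra_simps)
  qed
qed

text \<open>The functional that cuts out the face, expanded at one of its vertices, leaves two edge
  slacks with nonnegative coefficients. The face is where the slacks with positive coefficient
  vanish, so it is named by at most two labels besides those of the polygon.\<close>

lemma face_of_polygon:
  assumes "E face_of cell (sel_graph \<sigma>)" "E \<noteq> {}"
  obtains I where "I \<in> cells" "sel_graph \<sigma> \<subseteq> I" "E = cell I"
proof -
  let ?B = "face_verts (sel_graph \<sigma>)" and ?P = "\<lambda>x. \<pi> (v x)"
  have fin: "finite (?P ` ?B)"
    using finite_face_verts by simp
  then have "polyhedron (cell (sel_graph \<sigma>))"
    unfolding cell_def by (intro polytope_imp_polyhedron polytope_convex_hull)
  with assms(1) obtain a b where ab: "cell (sel_graph \<sigma>) \<subseteq> {q. a \<bullet> q \<le> b}"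
    and E: "E = cell (sel_graph \<sigma>) \<inter> {q. a \<bullet> q = b}"
    using exposed_face_of_polyhedron exposed_face_of_def by metis
  have le: "a \<bullet> ?P x \<le> b" if "x \<in> ?B" for x
    using ab that unfolding cell_def by (metis (mono_tags) hull_inc image_eqI mem_Collect_eq subsetD)
  define C where "C = {x \<in> ?B. a \<bullet> ?P x = b}"
  have EC: "E = convex hull (?P ` C)"
  proof -
    have "E = convex hull (?P ` ?B \<inter> {q. a \<bullet> q = b})"
      unfolding E cell_def using le by (intro convex_hull_Int_supporting_hyperplane[OF fin]) auto
    moreover have "?P ` ?B \<inter> {q. a \<bullet> q = b} = ?P ` C"
      by (auto simp: C_def)
    ultimately show ?thesis
      by simp
  qed
  with assms(2) obtain x0 where x0: "x0 \<in> C"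
    by auto
  then have "x0 \<in> X" "sel_graph \<sigma> \<subseteq> J x0"
    by (auto simp: C_def face_verts_def)
  then obtain l where l: "J x0 = vertex_labels s l \<sigma>"
    using J_vertex_selector by blast
  let ?e1 = "(l, \<not> \<sigma> l)" and ?e2 = "(s l, \<not> \<sigma> (s l))"
  obtain \<alpha> \<beta> where "\<And>x. x \<in> ?B \<Longrightarrow>
      adjoint \<pi> a \<bullet> (v x - v x0) = \<alpha> * slack ?e1 x + \<beta> * slack ?e2 x"
    using polygon_affine_function[OF \<open>x0 \<in> X\<close> l] by blast
  then have ab: "a \<bullet> ?P x - b = \<alpha> * slack ?e1 x + \<beta> * slack ?e2 x" if "x \<in> ?B" for x
    using that x0 adjoint_works[OF linear_\<pi>, of "v x - v x0" a]
    by (simp add: C_def inner_commute linear_diff[OF linear_\<pi>] inner_diff_right)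
  \<comment> \<open>At a neighbour only one of the two slacks is nonzero, so the inequality for
    \<open>a\<close> there gives the sign of its coefficient.\<close>
  obtain y y' where y: "y \<in> ?B" "?e1 \<notin> J y" "?e2 \<in> J y" and y': "y' \<in> ?B" "?e1 \<in> J y'" "?e2 \<notin> J y'"
    by (rule polygon_neighbours)
  have sign: "slack j x \<le> 0" "slack j x = 0 \<longleftrightarrow> j \<in> J x" if "x \<in> ?B" for j x
    using that slack_le[of x j] slack_eq_iff[of x j] by (auto simp: face_verts_def)
  have "slack ?e1 y < 0" "slack ?e2 y = 0" "slack ?e2 y' < 0" "slack ?e1 y' = 0"
    using y(2,3) y'(2,3) sign[OF y(1)] sign[OF y'(1)] by (metis less_le)+
  then have "slack ?e1 y < 0" "\<alpha> * slack ?e1 y \<le> 0" "slack ?e2 y' < 0" "\<beta> * slack ?e2 y' \<le> 0"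
    using ab[OF y(1)] le[OF y(1)] ab[OF y'(1)] le[OF y'(1)] by simp_all
  then have nonneg: "\<alpha> \<ge> 0" and nonneg': "\<beta> \<ge> 0"
    by (meson linorder_not_le mult_neg_neg)+
  define I where "I = sel_graph \<sigma> \<union> (if \<alpha> = 0 then {} else {?e1}) \<union> (if \<beta> = 0 then {} else {?e2})"
  have "face_verts I = C"
  proof -
    have "x \<in> C \<longleftrightarrow> x \<in> face_verts I" if x: "x \<in> ?B" for x
    proof -
      have "x \<in> X" "sel_graph \<sigma> \<subseteq> J x"
        using x by (auto simp: face_verts_def)
      have "\<alpha> * slack ?e1 x \<le> 0" "\<beta> * slack ?e2 x \<le> 0"
        using nonneg nonneg' slack_le[OF \<open>x \<in> X\<close>] by (auto simp: mult_le_0_iff)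
      then have "\<alpha> * slack ?e1 x + \<beta> * slack ?e2 x = 0
          \<longleftrightarrow> \<alpha> * slack ?e1 x = 0 \<and> \<beta> * slack ?e2 x = 0"
        by (smt (verit))
      moreover have "x \<in> C \<longleftrightarrow> \<alpha> * slack ?e1 x + \<beta> * slack ?e2 x = 0"
        using ab[OF x] x by (auto simp: C_def)
      ultimately have "x \<in> C \<longleftrightarrow> \<alpha> * slack ?e1 x = 0 \<and> \<beta> * slack ?e2 x = 0"
        by simp
      also have "\<dots> \<longleftrightarrow> x \<in> face_verts I"
        using \<open>x \<in> X\<close> \<open>sel_graph \<sigma> \<subseteq> J x\<close> slack_eq_iff[OF \<open>x \<in> X\<close>]
        by (auto simp: face_verts_def I_def)
      finally show ?thesis .
    qed
    moreover have "C \<subseteq> ?B" "face_verts I \<subseteq> ?B"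
      by (auto simp: C_def face_verts_def I_def)
    ultimately show ?thesis
      by blast
  qed
  with x0 EC show thesis
    by (intro that[of I]) (auto simp: cells_def I_def cell_def)
qed

lemma face_of_cell:
  assumes "I \<in> cells" "E face_of cell I" "E \<noteq> {}"
  obtains I' where "I' \<in> cells" "E = cell I'"
proof -
  obtain \<sigma> where \<sigma>: "sel_graph \<sigma> \<subseteq> I"
    using assms(1) by (auto simp: cells_def)
  with assms(1) have "sel_graph \<sigma> \<in> cells"
    by (auto simp: cells_def face_verts_def)
  with \<sigma> have "cell I face_of cell (sel_graph \<sigma>)"
    by (rule cell_face_of[rotated])
  with assms(2) have "E face_of cell (sel_graph \<sigma>)"
    by (rule face_of_trans)
  with assms(3) that show thesis
    using face_of_polygon by blast
qed

lemma polytopal_complex_cells: "polytopal_complex (cell ` cells)"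
  unfolding polytopal_complex_def
proof (intro conjI ballI allI impI)
  show "finite (cell ` cells)"
    by simp
next
  fix F assume "F \<in> cell ` cells"
  then show "polytope F" "F \<noteq> {}"
    by (auto simp: cell_def cells_def finite_face_verts polytope_convex_hull)
next
  fix F G assume "F \<in> cell ` cells" "G face_of F \<and> G \<noteq> {}"
  then show "G \<in> cell ` cells"
    using face_of_cell by blast
next
  fix F G assume "F \<in> cell ` cells" "G \<in> cell ` cells"
  then show "(F \<inter> G) face_of F" "(F \<inter> G) face_of G"
    using cell_Int cell_face_of by auto
qed

lemma J_in_cells: "x \<in> X \<Longrightarrow> J x \<in> cells"
  using J_vertex[of x] by (auto simp: cells_def face_verts_def)

text \<open>All vertices carry the same number \<open>p + 2\<close> of labels, so an inclusion
  \<open>J x \<subseteq> J y\<close> is an equality, and \<open>J\<close> is injective.\<close>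

lemma face_verts_J:
  assumes x: "x \<in> X"
  shows "face_verts (J x) = {x}"
proof -
  have "y = x" if y: "y \<in> X" "J x \<subseteq> J y" for y
  proof -
    have "card (J x) = card (J y)"
      using J_vertex[OF x] J_vertex[OF y(1)] card_vertex_labels by metis
    with y(2) have "J x = J y"
      by (simp add: card_subset_eq)
    with x y(1) show ?thesis
      using inj_J by (auto dest: inj_onD)
  qed
  with x show ?thesis
    by (auto simp: face_verts_def)
qed

lemma cell_J: "x \<in> X \<Longrightarrow> cell (J x) = {\<pi> (v x)}"
  by (simp add: cell_def face_verts_J)

lemma \<pi>_v_inj: "inj_on (\<lambda>x. \<pi> (v x)) X"
proof (rule inj_onI)
  fix x y assume "x \<in> X" "y \<in> X" "\<pi> (v x) = \<pi> (v y)"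
  then show "x = y"
    using cell_eq_iff[OF J_in_cells J_in_cells] by (simp add: cell_J face_verts_J)
qed

lemma \<pi>_v_in_cell_iff:
  assumes "I \<in> cells" "x \<in> X"
  shows "\<pi> (v x) \<in> cell I \<longleftrightarrow> x \<in> face_verts I"
  using cell_subset_iff[OF J_in_cells[OF assms(2)] assms(1)] assms(2)
  by (simp add: cell_J face_verts_J)

lemma complex_vertices_cells: "complex_vertices (cell ` cells) = (\<lambda>x. \<pi> (v x)) ` X"
proof
  show "(\<lambda>x. \<pi> (v x)) ` X \<subseteq> complex_vertices (cell ` cells)"
    using J_in_cells by (force simp: complex_vertices_def cell_J[symmetric])
  show "complex_vertices (cell ` cells) \<subseteq> (\<lambda>x. \<pi> (v x)) ` X"
  proof
    fix q assume "q \<in> complex_vertices (cell ` cells)"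
    then obtain I where I: "I \<in> cells" "{q} = cell I"
      by (auto simp: complex_vertices_def)
    then obtain x where x: "x \<in> face_verts I"
      by (auto simp: cells_def)
    then have "x \<in> X"
      by (simp add: face_verts_def)
    with x I have "\<pi> (v x) \<in> {q}"
      using \<pi>_v_in_cell_iff by metis
    with \<open>x \<in> X\<close> show "q \<in> (\<lambda>x. \<pi> (v x)) ` X"
      by auto
  qed
qed

text \<open>The projection is injective on the plane of a polygon, so functionals on its directions
  factor through \<open>\<pi>\<close>. Dually, the normals and the range of
  \<open>adjoint \<pi>\<close> span everything, since a vector orthogonal to both would contradict
  \<open>\<pi>_inj_polygon\<close>; the part in the span of the normals vanishes on these
  directions.\<close>

lemma functional_on_polygon:
  obtains a where "\<And>z. (\<And>i. n (i, \<sigma> i) \<bullet> z = 0) \<Longrightarrow> w \<bullet> z = a \<bullet> \<pi> z"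
proof -
  let ?N = "n ` sel_graph \<sigma>" and ?R = "range (adjoint \<pi>)"
  have "span (?N \<union> ?R) = UNIV"
  proof (rule ccontr)
    assume "span (?N \<union> ?R) \<noteq> UNIV"
    then obtain z where "z \<noteq> 0" and z: "\<And>y. y \<in> span (?N \<union> ?R) \<Longrightarrow> z \<bullet> y = 0"
      using span_not_UNIV_orthogonal by blast
    have "n (i, \<sigma> i) \<bullet> z = 0" for i
      using z[of "n (i, \<sigma> i)"] by (simp add: span_base inner_commute)
    moreover have "\<pi> z \<bullet> \<pi> z = 0"
      using z[of "adjoint \<pi> (\<pi> z)"] adjoint_works[OF linear_\<pi>, of z] by (simp add: span_base)
    ultimately show False
      using \<pi>_inj_polygon \<open>z \<noteq> 0\<close> by (metis inner_eq_zero_iff)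
  qed
  then have "w \<in> span (?N \<union> ?R)"
    by simp
  then obtain w1 w2 where w: "w = w1 + w2" "w1 \<in> span ?N" "w2 \<in> span ?R"
    unfolding span_Un by auto
  have "subspace ?R"
    using linear_subspace_image[OF adjoint_linear[OF linear_\<pi>] subspace_UNIV] .
  with w(3) obtain a where a: "w2 = adjoint \<pi> a"
    by (metis imageE span_eq_iff)
  show thesis
  proof (rule that)
    fix z assume z: "\<And>i. n (i, \<sigma> i) \<bullet> z = 0"
    have "w1 \<in> {y. orthogonal z y}"
    proof (rule span_induct[OF w(2)])
      show "subspace (Collect (\<lambda>y. y \<in> {y. orthogonal z y}))"
        by (simp add: subspace_orthogonal_to_vector)
    qed (use z in \<open>auto simp: orthogonal_def inner_commute sel_graph_def\<close>)
    then show "w \<bullet> z = a \<bullet> \<pi> z"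
      using adjoint_works[OF linear_\<pi>, of z a]
      by (simp add: w(1) a inner_add_left inner_add_right orthogonal_def inner_commute)
  qed
qed

end

text \<open>Hence the surface determines the lifted polytope up to an affine map that commutes with the
  projection.\<close>

lemma slack_proportional:
  fixes J :: "'v \<Rightarrow> ('q::finite \<times> bool) set"
  assumes C: "wedge_configuration X J s \<pi> \<eta> n \<gamma> v"
    and C': "wedge_configuration X J s \<pi> \<eta>' n' \<gamma>' v'"
    and same: "\<And>x. x \<in> X \<Longrightarrow> \<pi> (v x) = \<pi> (v' x)"
  obtains r where "\<And>x. x \<in> X \<Longrightarrow> n' j \<bullet> v' x - \<gamma>' j = r * (n j \<bullet> v x - \<gamma> j)"
proof -
  interpret C: wedge_configuration X J s \<pi> \<eta> n \<gamma> v by fact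
  interpret C': wedge_configuration X J s \<pi> \<eta>' n' \<gamma>' v' by fact
  let ?f = "C.slack j" and ?f' = "C'.slack j"
  let ?A = "\<lambda>\<sigma>. C.face_verts (sel_graph \<sigma>)"
  obtain i t where j: "j = (i, t)"
    by fastforce
  have zero: "?f x = 0 \<longleftrightarrow> j \<in> J x" "?f' x = 0 \<longleftrightarrow> j \<in> J x" if "x \<in> X" for x
    using C.slack_eq_iff[OF that, of j] C'.slack_eq_iff[OF that, of j] by auto
  \<comment> \<open>Here \<open>j\<close> is the label of an edge of the polygon \<sigma>. Its slack
    in the second configuration is an affine function of the common projection, hence a combination
    of two edge slacks of the first.\<close>
  have polygon: "\<exists>r. \<forall>x\<in>?A \<sigma>. ?f' x = r * ?f x" if \<sigma>: "\<sigma> i = (\<not> t)" for \<sigma>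
  proof -
    obtain x0 where x0: "x0 \<in> X" "J x0 = vertex_labels s i \<sigma>"
      using C.ex_vertex by blast
    obtain a where a: "\<And>z. (\<And>i. n' (i, \<sigma> i) \<bullet> z = 0) \<Longrightarrow> n' j \<bullet> z = a \<bullet> \<pi> z"
      using C'.functional_on_polygon by blast
    obtain \<alpha> \<beta> where \<alpha>: "\<And>x. x \<in> ?A \<sigma> \<Longrightarrow> adjoint \<pi> a \<bullet> (v x - v x0) =
        \<alpha> * C.slack (i, \<not> \<sigma> i) x + \<beta> * C.slack (s i, \<not> \<sigma> (s i)) x"
      using C.polygon_affine_function[OF x0] by blast
    have eq: "?f' x = \<alpha> * ?f x + \<beta> * C.slack (s i, \<not> \<sigma> (s i)) x" if x: "x \<in> ?A \<sigma>" for x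
    proof -
      have xX: "x \<in> X" "sel_graph \<sigma> \<subseteq> J x"
        using x by (auto simp: C.face_verts_def)
      have "n' (k, \<sigma> k) \<bullet> (v' x - v' x0) = 0" for k
        using C'.slack_eq_iff[OF xX(1), of "(k, \<sigma> k)"] C'.slack_eq_iff[OF x0(1), of "(k, \<sigma> k)"] xX(2) x0(2)
        by (auto simp: inner_diff_right)
      then have "n' j \<bullet> (v' x - v' x0) = a \<bullet> \<pi> (v' x - v' x0)"
        by (rule a)
      also have "\<dots> = a \<bullet> \<pi> (v x - v x0)"
        using same[OF xX(1)] same[OF x0(1)] by (simp add: linear_diff[OF C.linear_\<pi>])
      also have "\<dots> = adjoint \<pi> a \<bullet> (v x - v x0)"
        using adjoint_works[OF C.linear_\<pi>, of "v x - v x0" a] by (metis inner_commute)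
      also have "\<dots> = \<alpha> * ?f x + \<beta> * C.slack (s i, \<not> \<sigma> (s i)) x"
        using \<alpha>[OF x] \<sigma> by (simp add: j)
      finally show ?thesis
        using zero(2)[OF x0(1)] x0(2) by (simp add: j inner_diff_right)
    qed
    obtain y where yA: "y \<in> ?A \<sigma>" "(i, \<not> \<sigma> i) \<in> J y" "(s i, \<not> \<sigma> (s i)) \<notin> J y"
      by (rule C.polygon_neighbours) (rule that)
    then have y: "y \<in> X" "j \<in> J y" "(s i, \<not> \<sigma> (s i)) \<notin> J y"
      using \<sigma> by (simp_all add: C.face_verts_def j)
    \<comment> \<open>At \<open>y\<close> both slacks of \<open>j\<close> vanish while the slack of
      the other edge does not.\<close>
    then have "\<beta> = 0"
      using eq[OF yA(1)] zero[OF y(1)] C.slack_eq_iff[OF y(1), of "(s i, \<not> \<sigma> (s i))"] by simp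
    with eq show ?thesis
      by auto
  qed
  define \<sigma>0 where "\<sigma>0 = (\<lambda>_::'q. \<not> t)"
  obtain r where r: "\<And>x. x \<in> ?A \<sigma>0 \<Longrightarrow> ?f' x = r * ?f x"
    using polygon[of \<sigma>0] by (auto simp: \<sigma>0_def)
  \<comment> \<open>The constant selector that avoids \<open>j\<close> is turned into any other
    selector with value \<open>\<not> t\<close> at \<open>i\<close> by switching one edge at a time;
    \<open>D\<close> collects the switched edges.\<close>
  have all: "\<forall>x\<in>?A (\<lambda>k. if k \<in> D then t else \<not> t). ?f' x = r * ?f x" if "i \<notin> D" for D
    using finite[of D] that
  proof (induction D rule: finite_induct)
    case empty
    with r show ?case
      by (simp add: \<sigma>0_def)
  next
    case (insert m D)
    let ?\<sigma> = "\<lambda>k. if k \<in> D then t else \<not> t" and ?\<tau> = "\<lambda>k. if k \<in> insert m D then t else \<not> t"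
    have IH: "\<And>x. x \<in> ?A ?\<sigma> \<Longrightarrow> ?f' x = r * ?f x"
      using insert by simp
    obtain r' where r': "\<And>x. x \<in> ?A ?\<tau> \<Longrightarrow> ?f' x = r' * ?f x"
      using polygon[of ?\<tau>] insert.prems by auto
    \<comment> \<open>The old and the new polygon share the corners on edge \<open>m\<close>. One of
      these corners avoids the edge \<open>i\<close>; the slack of \<open>j\<close> is nonzero
      there, so the two factors agree. If \<open>i\<close> follows \<open>m\<close>, it is the
      corner before \<open>m\<close>.\<close>
    obtain l where l: "m = l \<or> m = s l" "l \<noteq> i" "s l \<noteq> i"
    proof (cases "s m = i")
      case True
      obtain l where "s l = m"
        using C.surj_s by (metis surjD)
      with True that[of l] insert.prems C.ss_neq[of l] C.s_neq[of l] show thesis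
        using C.ss_neq[of m] by auto
    next
      case False
      with that[of m] insert.prems show thesis
        by auto
    qed
    obtain x where x: "x \<in> X" "J x = vertex_labels s l ?\<sigma>"
      using C.ex_vertex by blast
    have "x \<in> ?A ?\<sigma>"
      using x by (auto simp: C.face_verts_def)
    have "sel_graph ?\<tau> \<subseteq> J x"
      using l(1) unfolding x(2) by (auto simp: sel_graph_def split: if_splits)
    then have "x \<in> ?A ?\<tau>"
      using x(1) by (simp add: C.face_verts_def)
    have "j \<notin> J x"
      using l insert.prems by (auto simp: x(2) j)
    then have "?f x \<noteq> 0"
      using zero[OF x(1)] by simp
    moreover have "r' * ?f x = r * ?f x"
      using IH[OF \<open>x \<in> ?A ?\<sigma>\<close>] r'[OF \<open>x \<in> ?A ?\<tau>\<close>] by simp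
    ultimately have "r' = r"
      by simp
    with r' show ?case
      by blast
  qed
  show thesis
  proof (rule that[of r])
    fix x assume x: "x \<in> X"
    show "?f' x = r * ?f x"
    proof (cases "j \<in> J x")
      case True
      then show ?thesis
        using zero[OF x] by simp
    next
      case False
      obtain l \<tau> where \<tau>: "J x = vertex_labels s l \<tau>"
        using C.J_vertex[OF x] by blast
      define D where "D = {k. \<tau> k = t}"
      have "\<tau> = (\<lambda>k. if k \<in> D then t else \<not> t)"
        by (auto simp: D_def)
      moreover have "x \<in> ?A \<tau>"
        using x \<tau> by (auto simp: C.face_verts_def)
      ultimately have "x \<in> ?A (\<lambda>k. if k \<in> D then t else \<not> t)"
        by (rule subst[where P = "\<lambda>\<sigma>. x \<in> ?A \<sigma>"])
      moreover have "i \<notin> D"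
        using False by (auto simp: D_def \<tau> j)
      ultimately show ?thesis
        using all[of D] by blast
    qed
  qed
qed

section \<open>Moving the facets\<close>

text \<open>\<open>affinely_spanning\<close> expresses full dimension through the vertices,
  \<open>no_recession\<close> expresses boundedness through the normals. The latter will supply a
  free normal with a nonzero coefficient.\<close>

locale wedge_polytope = wedge_configuration X J s \<pi> \<eta> n \<beta> "\<lambda>x. x"
  for X :: "'a::euclidean_space set" and J :: "'a \<Rightarrow> ('q::finite \<times> bool) set" and s :: "'q \<Rightarrow> 'q"
    and \<pi> :: "'a \<Rightarrow> real^3" and \<eta> :: 'a and n :: "'q \<times> bool \<Rightarrow> 'a" and \<beta> :: "'q \<times> bool \<Rightarrow> real" +
  assumes surj_\<pi>: "surj \<pi>"
    and affinely_spanning: "(\<And>x. x \<in> X \<Longrightarrow> u \<bullet> x = b) \<Longrightarrow> u = 0"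
    and no_recession: "(\<And>j. n j \<bullet> z \<le> 0) \<Longrightarrow> z = 0"
begin

lemma adjoint_\<pi>: "adjoint \<pi> u \<bullet> z = u \<bullet> \<pi> z" "z \<bullet> adjoint \<pi> u = \<pi> z \<bullet> u"
  using adjoint_works[OF linear_\<pi>, of z u] by (simp_all add: inner_commute)

lemma linear_adjoint_\<pi>: "linear (adjoint \<pi>)"
  by (rule adjoint_linear[OF linear_\<pi>])

lemma card_q: "3 \<le> CARD('q)"
proof -
  fix l :: 'q
  have "card {l, s l, s (s l)} = 3"
    using s_neq[of l] s_neq[of "s l"] ss_neq[of l] by (auto simp: card_insert_if)
  moreover have "card {l, s l, s (s l)} \<le> CARD('q)"
    by (rule card_mono) auto
  ultimately show ?thesis
    by simp
qed

text \<open>The \<open>p\<close> normals of a polygon and the three visible coordinates are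
  \<open>p + 3\<close> vectors in dimension \<open>p + 2\<close>, one too many for a basis;
  \<open>frame_index i\<close> drops the normal at \<open>i\<close>.\<close>

definition polygon_frame :: "('q \<times> bool \<Rightarrow> 'a) \<Rightarrow> ('q \<Rightarrow> bool) \<Rightarrow> 'q + 3 \<Rightarrow> 'a" where
  "polygon_frame m \<sigma> = case_sum (\<lambda>i. m (i, \<sigma> i)) (\<lambda>a. adjoint \<pi> (axis a 1))"

definition frame_index :: "'q \<Rightarrow> ('q + 3) set" where
  "frame_index i = Inl ` (- {i}) \<union> range Inr"

lemma polygon_frame_simps [simp]:
  "polygon_frame m \<sigma> (Inl i) = m (i, \<sigma> i)" "polygon_frame m \<sigma> (Inr a) = adjoint \<pi> (axis a 1)"
  by (simp_all add: polygon_frame_def)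

lemma frame_index_iff [simp]: "Inl i' \<in> frame_index i \<longleftrightarrow> i' \<noteq> i" "Inr a \<in> frame_index i"
  by (auto simp: frame_index_def)

lemma card_frame_index: "card (frame_index i) = DIM('a)"
proof -
  have "card (frame_index i) = card (Inl ` (- {i}) :: ('q + 3) set) + card (range Inr :: ('q + 3) set)"
    unfolding frame_index_def by (intro card_Un_disjoint) auto
  also have "\<dots> = card (- {i}) + 3"
    by (simp add: card_image)
  also have "\<dots> = CARD('q) + 2"
    using card_q by (simp add: Compl_eq_Diff_UNIV card_Diff_subset)
  finally show ?thesis
    by (simp add: DIM)
qed

lemma sum_frame_index:
  "(\<Sum>j\<in>frame_index i. f j) = (\<Sum>i'\<in>-{i}. f (Inl i')) + (\<Sum>a\<in>UNIV. f (Inr a))"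
proof -
  have "(\<Sum>j\<in>frame_index i. f j) = (\<Sum>j\<in>Inl ` (- {i}). f j) + (\<Sum>j\<in>range Inr. f j)"
    unfolding frame_index_def by (intro sum.union_disjoint) auto
  then show ?thesis
    by (simp add: sum.reindex)
qed

lemma spanning_polygon_frame:
  obtains i where "spanning (polygon_frame n \<sigma>) (frame_index i)"
proof -
  let ?L = "\<lambda>(c, u). (\<Sum>i\<in>UNIV. (c $ i) *\<^sub>R n (i, \<sigma> i)) + adjoint \<pi> u"
  have lin: "linear ?L"
    by (rule linearI)
      (auto simp: sum.distrib scaleR_add_left scaleR_add_right scaleR_sum_right linear_add[OF linear_adjoint_\<pi>]
        linear_scale[OF linear_adjoint_\<pi>])
  have "\<not> inj ?L"
  proof
    assume "inj ?L"
    then have "dim (range ?L) = dim (UNIV :: ((real^'q) \<times> (real^3)) set)"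
      using lin by (intro dim_image_eq) auto
    moreover have "dim (range ?L) \<le> DIM('a)"
      by (rule dim_subset_UNIV)
    ultimately show False
      by (simp add: DIM)
  qed
  then obtain z where "?L z = 0" "z \<noteq> 0"
    using linear_injective_0[OF lin] by blast
  then obtain c u where L: "(\<Sum>i\<in>UNIV. (c $ i) *\<^sub>R n (i, \<sigma> i)) + adjoint \<pi> u = 0" and nz: "c \<noteq> 0 \<or> u \<noteq> 0"
    by (cases z) (auto simp: zero_prod_def)
  have "c \<noteq> 0"
  proof
    assume c: "c = 0"
    obtain z where "\<pi> z = u"
      using surj_\<pi> by (metis surjD)
    then have "u \<bullet> u = 0"
      using L adjoint_\<pi>(1)[of u z] by (simp add: c)
    with nz c show False
      by simp
  qed
  then obtain i where i: "c $ i \<noteq> 0"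
    by (auto simp: vec_eq_iff)
  show thesis
  proof (rule that)
    show "spanning (polygon_frame n \<sigma>) (frame_index i)"
      unfolding spanning_def
    proof (intro allI impI)
      fix z assume z: "\<forall>j\<in>frame_index i. polygon_frame n \<sigma> j \<bullet> z = 0"
      have ne: "n (i', \<sigma> i') \<bullet> z = 0" if "i' \<noteq> i" for i'
        using z[rule_format, of "Inl i'"] that by simp
      have "\<pi> z $ a = 0" for a
        using z[rule_format, of "Inr a"] by (simp add: adjoint_\<pi> inner_axis' )
      then have \<pi>z: "\<pi> z = 0"
        by (simp add: vec_eq_iff)
      have "0 = ((\<Sum>i\<in>UNIV. (c $ i) *\<^sub>R n (i, \<sigma> i)) + adjoint \<pi> u) \<bullet> z"
        by (simp add: L)
      also have "\<dots> = (\<Sum>i'\<in>UNIV. (c $ i') * (n (i', \<sigma> i') \<bullet> z))"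
        by (simp add: inner_add_left inner_sum_left adjoint_\<pi> \<pi>z)
      also have "\<dots> = (\<Sum>i'\<in>{i}. (c $ i') * (n (i', \<sigma> i') \<bullet> z))"
        by (rule sum.mono_neutral_right) (use ne in auto)
      finally have "n (i, \<sigma> i) \<bullet> z = 0"
        using i by simp
      with ne have "n (i', \<sigma> i') \<bullet> z = 0" for i'
        by (cases "i' = i") auto
      with \<pi>z show "z = 0"
        by (rule \<pi>_inj_polygon[rotated])
    qed
  qed
qed

text \<open>\<open>p - 1\<close> facets through one polygon stay fixed; a dual basis of their normals and of the
  three visible coordinates is used to read off the perturbation.\<close>

definition fixed_labels :: "'q \<Rightarrow> ('q \<times> bool) set" where
  "fixed_labels i0 = {(i, t). i \<noteq> i0 \<and> \<not> t}"

lemma fixed_labels_iff [simp]: "(i, t) \<in> fixed_labels i0 \<longleftrightarrow> i \<noteq> i0 \<and> \<not> t"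
  by (simp add: fixed_labels_def)

lemma card_free_labels: "card (- fixed_labels i0) = CARD('q) + 1"
proof -
  have "fixed_labels i0 = (- {i0}) \<times> {False}"
    by (auto simp: fixed_labels_def)
  then have "card (fixed_labels i0) = CARD('q) - 1"
    by (simp add: card_cartesian_product Compl_eq_Diff_UNIV card_Diff_subset)
  then show ?thesis
    using card_q by (simp add: Compl_eq_Diff_UNIV card_Diff_subset)
qed

text \<open>The average of the vertices on all fixed facets works: every free facet misses one of
  these vertices, so its inequality is strict at the average.\<close>

lemma ex_center:
  obtains z0 where "\<And>j. j \<in> fixed_labels i0 \<Longrightarrow> n j \<bullet> z0 = \<beta> j"
    "\<And>j. j \<notin> fixed_labels i0 \<Longrightarrow> n j \<bullet> z0 < \<beta> j"
proof -
  let ?A = "face_verts (fixed_labels i0)"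
  have ex: "\<exists>x\<in>?A. j \<notin> J x" if j: "j \<notin> fixed_labels i0" for j
  proof -
    obtain i t where it: "j = (i, t)"
      by fastforce
    \<comment> \<open>The selector takes the other facet over \<open>i\<close>, and the corner at
      \<open>s i\<close> avoids the edge \<open>i\<close>; so \<open>j\<close> is not tight, while
      the fixed labels still are.\<close>
    obtain x where x: "x \<in> X" "J x = vertex_labels s (s i) ((\<lambda>_. False)(i := \<not> t))"
      using ex_vertex by blast
    have "fixed_labels i0 \<subseteq> J x"
    proof
      fix k assume "k \<in> fixed_labels i0"
      then show "k \<in> J x"
        using j by (cases k) (auto simp: x(2) it)
    qed
    moreover have "j \<notin> J x"
      using s_neq[of i, symmetric] ss_neq[of i, symmetric] by (simp add: x(2) it)
    ultimately show ?thesis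
      using x(1) by (auto simp: face_verts_def)
  qed
  have "(i0, True) \<notin> fixed_labels i0"
    by simp
  then have "?A \<noteq> {}"
    using ex by blast
  then have card: "card ?A > 0"
    using finite_face_verts by (simp add: card_gt_0_iff)
  let ?z = "(\<Sum>x\<in>?A. x) /\<^sub>R card ?A"
  have z: "n j \<bullet> ?z = (\<Sum>x\<in>?A. n j \<bullet> x) / card ?A" for j
    by (simp add: inner_sum_right divide_inverse mult.commute)
  show thesis
  proof (rule that)
    fix j assume j: "j \<in> fixed_labels i0"
    have "(\<Sum>x\<in>?A. n j \<bullet> x) = (\<Sum>x\<in>?A. \<beta> j)"
      using j slack_eq_iff by (intro sum.cong) (auto simp: face_verts_def)
    with card show "n j \<bullet> ?z = \<beta> j"
      unfolding z by simp
  next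
    fix j assume j: "j \<notin> fixed_labels i0"
    have "(\<Sum>x\<in>?A. n j \<bullet> x) < (\<Sum>x\<in>?A. \<beta> j)"
    proof (rule sum_strict_mono_ex1)
      show "finite ?A"
        by (rule finite_face_verts)
      show "\<forall>x\<in>?A. n j \<bullet> x \<le> \<beta> j"
        using slack_le by (auto simp: face_verts_def)
      obtain x where x: "x \<in> ?A" "j \<notin> J x"
        using ex[OF j] by blast
      then have "x \<in> X"
        by (simp add: face_verts_def)
      with x show "\<exists>x\<in>?A. n j \<bullet> x < \<beta> j"
        using slack_le[of x j] slack_eq_iff[of x j] by force
    qed
    with card show "n j \<bullet> ?z < \<beta> j"
      unfolding z by (simp add: field_simps)
  qed
qed

end

section \<open>The deformation family and its parameters\<close>

text \<open>\<open>w\<close> and \<open>m\<close> form the basis dual to the fixed normals and the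
  visible coordinates. \<open>g i\<close> names the three free normals that receive multiples of
  \<open>n (i, False)\<close>, and \<open>g0 i\<close> the one whose nonzero pairing with
  \<open>w i\<close> is kept.\<close>

locale wedge_deformation = wedge_polytope X J s \<pi> \<eta> n \<beta>
  for X :: "'a::euclidean_space set" and J :: "'a \<Rightarrow> ('q::finite \<times> bool) set" and s :: "'q \<Rightarrow> 'q"
    and \<pi> :: "'a \<Rightarrow> real^3" and \<eta> :: 'a and n :: "'q \<times> bool \<Rightarrow> 'a" and \<beta> :: "'q \<times> bool \<Rightarrow> real" +
  fixes i0 :: 'q and z0 :: 'a and w :: "'q \<Rightarrow> 'a" and m :: "3 \<Rightarrow> 'a"
    and g :: "'q \<Rightarrow> 3 \<Rightarrow> 'q \<times> bool" and g0 :: "'q \<Rightarrow> 'q \<times> bool"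
  assumes spanning_fixed: "spanning (polygon_frame n (\<lambda>_. False)) (frame_index i0)"
    and z0_fixed: "j \<in> fixed_labels i0 \<Longrightarrow> n j \<bullet> z0 = \<beta> j"
    and z0_free: "j \<notin> fixed_labels i0 \<Longrightarrow> n j \<bullet> z0 < \<beta> j"
    and w_dual: "i \<noteq> i0 \<Longrightarrow> i' \<noteq> i0 \<Longrightarrow> n (i', False) \<bullet> w i = (if i' = i then 1 else 0)"
    and \<pi>_w: "i \<noteq> i0 \<Longrightarrow> \<pi> (w i) = 0"
    and m_dual: "i' \<noteq> i0 \<Longrightarrow> n (i', False) \<bullet> m a = 0"
    and \<pi>_m: "\<pi> (m a) = axis a 1"
    and g_inj: "i \<noteq> i0 \<Longrightarrow> inj (g i)"
    and g_free: "i \<noteq> i0 \<Longrightarrow> g i a \<notin> fixed_labels i0"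
    and g0_free: "i \<noteq> i0 \<Longrightarrow> g0 i \<notin> fixed_labels i0"
    and g0_g: "i \<noteq> i0 \<Longrightarrow> g i a \<noteq> g0 i"
    and g0_w: "i \<noteq> i0 \<Longrightarrow> n (g0 i) \<bullet> w i \<noteq> 0"
begin

text \<open>There is one 3-vector per label. At a free label it is the visible vector added to the
  normal. A fixed normal does not move, so the three entries at its label are reused as its
  multiples added at the labels \<open>g i a\<close>. This makes the parameter space exactly
  \<open>6 p\<close>-dimensional.\<close>

definition tilted :: "(real^3)^('q \<times> bool) \<Rightarrow> 'q \<times> bool \<Rightarrow> 'a" where
  "tilted \<xi> j = n j + (if j \<in> fixed_labels i0 then 0 else
     adjoint \<pi> (\<xi> $ j) +
     (\<Sum>i\<in>-{i0}. \<Sum>a\<in>UNIV. (if g i a = j then \<xi> $ (i, False) $ a else 0) *\<^sub>R n (i, False)))"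

text \<open>The right-hand side relative to \<open>z0\<close>, held constant while the facets tilt:
  0 for fixed labels, positive for free ones.\<close>

definition offset :: "'q \<times> bool \<Rightarrow> real" where
  "offset j = \<beta> j - n j \<bullet> z0"

definition vertex :: "(real^3)^('q \<times> bool) \<Rightarrow> 'a \<Rightarrow> 'a" where
  "vertex \<xi> x = z0 + (SOME y. \<forall>j\<in>J x. tilted \<xi> j \<bullet> y = offset j)"

lemma tilted_0: "tilted 0 j = n j"
  by (simp add: tilted_def linear_0[OF linear_adjoint_\<pi>] cong: if_cong)

lemma tilted_fixed: "j \<in> fixed_labels i0 \<Longrightarrow> tilted \<xi> j = n j"
  by (simp add: tilted_def)

text \<open>Pairing with the dual basis reads off the parameters: \<open>w i\<close> is orthogonal
  to the visible vectors and to all fixed normals other than \<open>n (i, False)\<close>.\<close>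

lemma tilted_w:
  assumes j: "j \<notin> fixed_labels i0" and i: "i \<noteq> i0"
  shows "tilted \<xi> j \<bullet> w i = n j \<bullet> w i + (\<Sum>a\<in>UNIV. if g i a = j then \<xi> $ (i, False) $ a else 0)"
proof -
  let ?f = "\<lambda>i'. \<Sum>a\<in>UNIV. if g i' a = j then \<xi> $ (i', False) $ a else 0"
  have "tilted \<xi> j \<bullet> w i = n j \<bullet> w i + (\<Sum>i'\<in>-{i0}. ?f i' * (n (i', False) \<bullet> w i))"
    using j \<pi>_w[OF i] by (simp add: tilted_def inner_add_left inner_sum_left adjoint_\<pi> sum_distrib_right)
  also have "(\<Sum>i'\<in>-{i0}. ?f i' * (n (i', False) \<bullet> w i)) = (\<Sum>i'\<in>-{i0}. if i' = i then ?f i' else 0)"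
    using i by (intro sum.cong) (auto simp: w_dual)
  also have "\<dots> = ?f i"
    using i by simp
  finally show ?thesis .
qed

lemma tilted_m:
  assumes j: "j \<notin> fixed_labels i0"
  shows "tilted \<xi> j \<bullet> m a = n j \<bullet> m a + \<xi> $ j $ a"
  using j by (simp add: tilted_def inner_add_left inner_sum_left adjoint_\<pi> \<pi>_m inner_axis m_dual)

lemma tendsto_tilted: "((\<lambda>\<xi>. tilted \<xi> j) \<longlongrightarrow> tilted \<xi>0 j) (nhds \<xi>0)"
proof -
  have *: "((\<lambda>\<xi>. \<xi> $ k) \<longlongrightarrow> \<xi>0 $ k) (nhds \<xi>0)" for k
    using tendsto_vec_nth[OF filterlim_ident] .
  have "((\<lambda>\<xi>. adjoint \<pi> (\<xi> $ j)) \<longlongrightarrow> adjoint \<pi> (\<xi>0 $ j)) (nhds \<xi>0)"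
    by (intro bounded_linear.tendsto[OF linear_conv_bounded_linear[THEN iffD1, OF linear_adjoint_\<pi>]] *)
  moreover have "((\<lambda>\<xi>. if g i a = j then \<xi> $ (i, False) $ a else 0) \<longlongrightarrow>
      (if g i a = j then \<xi>0 $ (i, False) $ a else 0)) (nhds \<xi>0)" for i a
    by (cases "g i a = j") (auto intro!: tendsto_vec_nth *)
  ultimately show ?thesis
    unfolding tilted_def by (cases "j \<in> fixed_labels i0") (auto intro!: tendsto_intros)
qed

lemma vertex_eq:
  assumes x: "x \<in> X" and sp: "spanning (tilted \<xi>) (J x)" and j: "j \<in> J x"
  shows "tilted \<xi> j \<bullet> (vertex \<xi> x - z0) = offset j"
proof -
  have "card (J x) = DIM('a)"
    using J_vertex[OF x] card_vertex_labels DIM by auto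
  then have "\<exists>y. \<forall>j\<in>J x. tilted \<xi> j \<bullet> y = offset j"
    by (intro spanning_solve sp) auto
  then have "\<forall>j\<in>J x. tilted \<xi> j \<bullet> (SOME y. \<forall>j\<in>J x. tilted \<xi> j \<bullet> y = offset j) = offset j"
    by (rule someI_ex)
  with j show ?thesis
    by (simp add: vertex_def)
qed

lemma vertex_0:
  assumes x: "x \<in> X"
  shows "vertex 0 x = x"
proof -
  have sp: "spanning (tilted 0) (J x)"
    using spanning_J[OF x] by (simp add: tilted_0 spanning_def)
  have "vertex 0 x - z0 = x - z0"
  proof (rule spanning_solution_unique[OF sp])
    fix j assume j: "j \<in> J x"
    then show "tilted 0 j \<bullet> (vertex 0 x - z0) = tilted 0 j \<bullet> (x - z0)"
      using vertex_eq[OF x sp j] slack_eq_iff[OF x, of j]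
      by (simp add: tilted_0 offset_def inner_diff_right)
  qed
  then show ?thesis
    by simp
qed

lemma eventually_spanning_J:
  assumes "spanning (tilted \<xi>0) (J x)"
  shows "\<forall>\<^sub>F \<xi> in nhds \<xi>0. spanning (tilted \<xi>) (J x)"
  by (rule eventually_spanning[OF finite assms]) (simp add: tendsto_tilted)

text \<open>Stated at every parameter where the vertex is determined, not only at 0, because the
  parametrization has to be continuous on a whole ball.\<close>

lemma tendsto_vertex:
  assumes x: "x \<in> X" and sp: "spanning (tilted \<xi>0) (J x)"
  shows "((\<lambda>\<xi>. vertex \<xi> x) \<longlongrightarrow> vertex \<xi>0 x) (nhds \<xi>0)"
proof -
  have "((\<lambda>\<xi>. vertex \<xi> x - z0) \<longlongrightarrow> vertex \<xi>0 x - z0) (nhds \<xi>0)"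
  proof (rule tendsto_solution[OF finite sp])
    show "\<forall>j\<in>J x. ((\<lambda>\<xi>. tilted \<xi> j) \<longlongrightarrow> tilted \<xi>0 j) (nhds \<xi>0)"
      by (simp add: tendsto_tilted)
    show "\<forall>j\<in>J x. ((\<lambda>\<xi>. tilted \<xi> j \<bullet> (vertex \<xi> x - z0))
        \<longlongrightarrow> tilted \<xi>0 j \<bullet> (vertex \<xi>0 x - z0)) (nhds \<xi>0)"
    proof
      fix j assume j: "j \<in> J x"
      have "\<forall>\<^sub>F \<xi> in nhds \<xi>0. tilted \<xi> j \<bullet> (vertex \<xi> x - z0) = offset j"
        using eventually_spanning_J[OF sp] by (rule eventually_mono) (rule vertex_eq[OF x _ j])
      then show "((\<lambda>\<xi>. tilted \<xi> j \<bullet> (vertex \<xi> x - z0))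
        \<longlongrightarrow> tilted \<xi>0 j \<bullet> (vertex \<xi>0 x - z0)) (nhds \<xi>0)"
        unfolding vertex_eq[OF x sp j] by (rule tendsto_eventually)
    qed
  qed
  then have "((\<lambda>\<xi>. vertex \<xi> x - z0 + z0) \<longlongrightarrow> vertex \<xi>0 x - z0 + z0) (nhds \<xi>0)"
    by (intro tendsto_add tendsto_const)
  then show ?thesis
    by simp
qed

lemma spanning_tilted_0: "x \<in> X \<Longrightarrow> spanning (tilted 0) (J x)"
  using spanning_J by (simp add: tilted_0 spanning_def)

lemma tendsto_vertex_0: "x \<in> X \<Longrightarrow> ((\<lambda>\<xi>. vertex \<xi> x) \<longlongrightarrow> x) (nhds 0)"
  using tendsto_vertex[OF _ spanning_tilted_0] by (metis vertex_0)

section \<open>Conditions stable under small tilts\<close>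

text \<open>The first four clauses make the deformed vertices a configuration with the same
  incidences; the last one is for the injectivity of the parametrization.\<close>

definition good :: "(real^3)^('q \<times> bool) \<Rightarrow> bool" where
  "good \<xi> \<longleftrightarrow>
     (\<forall>x\<in>X. spanning (tilted \<xi>) (J x)) \<and>
     (\<forall>x\<in>X. \<forall>j. j \<notin> J x \<longrightarrow> tilted \<xi> j \<bullet> (vertex \<xi> x - z0) < offset j) \<and>
     (\<forall>\<sigma> z. (\<forall>i. tilted \<xi> (i, \<sigma> i) \<bullet> z = 0) \<longrightarrow> \<pi> z = 0 \<longrightarrow> z = 0) \<and>
     (\<forall>\<sigma>. lower_face (\<lambda>x. \<pi> (vertex \<xi> x)) (\<lambda>x. \<eta> \<bullet> vertex \<xi> x) X (face_verts (sel_graph \<sigma>))) \<and>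
     (\<forall>u b. (\<forall>x\<in>X. u \<bullet> vertex \<xi> x = b) \<longrightarrow> u = 0)"

lemma eventually_slack:
  assumes x: "x \<in> X" and j: "j \<notin> J x"
  shows "\<forall>\<^sub>F \<xi> in nhds 0. tilted \<xi> j \<bullet> (vertex \<xi> x - z0) < offset j"
proof (rule order_tendstoD(2))
  show "((\<lambda>\<xi>. tilted \<xi> j \<bullet> (vertex \<xi> x - z0)) \<longlongrightarrow> tilted 0 j \<bullet> (x - z0)) (nhds 0)"
    by (intro tendsto_intros tendsto_tilted tendsto_vertex_0 x)
  show "tilted 0 j \<bullet> (x - z0) < offset j"
    using slack_le[OF x, of j] slack_eq_iff[OF x, of j] j
    by (simp add: tilted_0 offset_def inner_diff_right)
qed

lemma spanning_frame_inj:
  assumes "spanning (polygon_frame (tilted \<xi>) \<sigma>) (frame_index i)"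
    and "\<forall>i. tilted \<xi> (i, \<sigma> i) \<bullet> z = 0" "\<pi> z = 0"
  shows "z = 0"
proof (rule spanningD[OF assms(1)])
  fix j assume "j \<in> frame_index i"
  then show "polygon_frame (tilted \<xi>) \<sigma> j \<bullet> z = 0"
    using assms(2,3) by (cases j) (auto simp: adjoint_\<pi>)
qed

lemma tendsto_polygon_frame:
  "((\<lambda>\<xi>. polygon_frame (tilted \<xi>) \<sigma> j) \<longlongrightarrow> polygon_frame n \<sigma> j) (nhds 0)"
  using tendsto_tilted[of _ 0] by (cases j) (auto simp: tilted_0)

text \<open>A basis taken from the normals of the polygon and the visible coordinates turns
  injectivity into a spanning property, which persists nearby.\<close>

lemma eventually_\<pi>_inj_polygon:
  "\<forall>\<^sub>F \<xi> in nhds 0. \<forall>z. (\<forall>i. tilted \<xi> (i, \<sigma> i) \<bullet> z = 0) \<longrightarrow> \<pi> z = 0 \<longrightarrow> z = 0"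
proof -
  obtain i where "spanning (polygon_frame n \<sigma>) (frame_index i)"
    using spanning_polygon_frame by blast
  then have "\<forall>\<^sub>F \<xi> in nhds 0. spanning (polygon_frame (tilted \<xi>) \<sigma>) (frame_index i)"
    by (rule eventually_spanning[OF finite]) (intro ballI tendsto_polygon_frame)
  then show ?thesis
    by (rule eventually_mono) (use spanning_frame_inj in blast)
qed

lemma eventually_affinely_spanning:
  "\<forall>\<^sub>F \<xi> in nhds 0. \<forall>u b. (\<forall>x\<in>X. u \<bullet> vertex \<xi> x = b) \<longrightarrow> u = 0"
proof -
  \<comment> \<open>Affine spanning of the vertices becomes linear spanning of their differences,
    which persists nearby.\<close>
  have "spanning (\<lambda>(x, y). x - y) (X \<times> X)"
    unfolding spanning_def
  proof (intro allI impI)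
    fix z assume z: "\<forall>j\<in>X \<times> X. (case j of (x, y) \<Rightarrow> x - y) \<bullet> z = 0"
    have "z \<bullet> x = z \<bullet> (SOME y. y \<in> X)" if "x \<in> X" for x
    proof -
      have "(SOME y. y \<in> X) \<in> X"
        using that by (rule someI)
      with z that have "(x - (SOME y. y \<in> X)) \<bullet> z = 0"
        by auto
      then show ?thesis
        by (simp add: inner_diff_left inner_diff_right inner_commute)
    qed
    then show "z = 0"
      by (rule affinely_spanning)
  qed
  then have "\<forall>\<^sub>F \<xi> in nhds 0. spanning (\<lambda>(x, y). vertex \<xi> x - vertex \<xi> y) (X \<times> X)"
    by (rule eventually_spanning[rotated])
      (auto intro!: tendsto_intros tendsto_vertex_0 simp: finite_X)
  then show ?thesis
  proof (rule eventually_mono, intro allI impI)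
    fix \<xi> u b
    assume sp: "spanning (\<lambda>(x, y). vertex \<xi> x - vertex \<xi> y) (X \<times> X)"
      and u: "\<forall>x\<in>X. u \<bullet> vertex \<xi> x = b"
    show "u = 0"
      by (rule spanningD[OF sp]) (use u in \<open>auto simp: inner_diff_left inner_diff_right inner_commute\<close>)
  qed
qed

text \<open>At the start the supporting functional of a polygon is a combination of the normals of the
  facets through it.  Expanding it in the moving frame and moving the three visible coordinates to
  the other side gives a supporting functional nearby.\<close>

lemma eventually_lower_face:
  "\<forall>\<^sub>F \<xi> in nhds 0.
     lower_face (\<lambda>x. \<pi> (vertex \<xi> x)) (\<lambda>x. \<eta> \<bullet> vertex \<xi> x) X (face_verts (sel_graph \<sigma>))"
proof -
  let ?B = "face_verts (sel_graph \<sigma>)"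
  obtain c b where cb: "\<And>x. x \<in> X \<Longrightarrow> c \<bullet> \<pi> x + b \<le> \<eta> \<bullet> x"
    "\<And>x. x \<in> X \<Longrightarrow> c \<bullet> \<pi> x + b = \<eta> \<bullet> x \<longleftrightarrow> x \<in> ?B"
    using lower_faceE[OF lower_face_polygon[of \<sigma>]] by blast
  \<comment> \<open>As a functional, \<open>C\<close> attains its minimum over the vertices exactly
    on the polygon.\<close>
  define C where "C = \<eta> - adjoint \<pi> c"
  have C_diff: "C \<bullet> (x - y) = (\<eta> \<bullet> x - c \<bullet> \<pi> x) - (\<eta> \<bullet> y - c \<bullet> \<pi> y)" for x y
    by (simp add: C_def inner_diff_left inner_diff_right adjoint_\<pi> linear_diff[OF linear_\<pi>])
  have C_B: "C \<bullet> (x - y) = 0" if "x \<in> ?B" "y \<in> ?B" for x y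
  proof -
    have "x \<in> X" "y \<in> X"
      using that by (auto simp: face_verts_def)
    with cb(2) that show ?thesis
      by (simp add: C_diff) (metis add_diff_cancel_left')
  qed
  have C_pos: "C \<bullet> (x - y) > 0" if "x \<in> X" "x \<notin> ?B" "y \<in> ?B" for x y
  proof -
    have "y \<in> X"
      using that by (auto simp: face_verts_def)
    then show ?thesis
      using cb(1)[of x] cb(2)[of x] cb(2)[of y] that by (simp add: C_diff)
  qed
  obtain l :: 'q where True
    by blast
  obtain x0 where x0: "x0 \<in> X" "J x0 = vertex_labels s l \<sigma>"
    using ex_vertex by blast
  then have x0B: "x0 \<in> ?B"
    by (simp add: face_verts_def)
  \<comment> \<open>At the corner \<open>x0\<close> all \<open>p + 2\<close> normals may occur in
    \<open>C\<close>. The two edge normals drop out because \<open>C\<close> is constant on the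
    polygon and the neighbours of \<open>x0\<close> separate them.\<close>
  obtain \<mu> where \<mu>: "C = (\<Sum>i\<in>UNIV. \<mu> i *\<^sub>R n (i, \<sigma> i))"
  proof -
    let ?e1 = "(l, \<not> \<sigma> l)" and ?e2 = "(s l, \<not> \<sigma> (s l))"
    obtain \<alpha>1 \<alpha>2 \<mu> where
      C: "C = \<alpha>1 *\<^sub>R n ?e1 + \<alpha>2 *\<^sub>R n ?e2 + (\<Sum>i\<in>UNIV. \<mu> i *\<^sub>R n (i, \<sigma> i))"
      using polygon_representation[OF x0] by blast
    have eq: "\<alpha>1 * (n ?e1 \<bullet> (x - x0)) + \<alpha>2 * (n ?e2 \<bullet> (x - x0)) = 0" if x: "x \<in> ?B" for x
    proof -
      have "n (i, \<sigma> i) \<bullet> (x - x0) = 0" for i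
      proof -
        have "(i, \<sigma> i) \<in> J x" "(i, \<sigma> i) \<in> J x0" "x \<in> X"
          using x by (auto simp: x0(2) face_verts_def)
        then show ?thesis
          using slack_eq_iff[of x "(i, \<sigma> i)"] slack_eq_iff[of x0 "(i, \<sigma> i)"] x0(1)
          by (simp add: inner_diff_right)
      qed
      with C_B[OF x x0B] show ?thesis
        by (subst (asm) C) (simp add: inner_add_left inner_sum_left)
    qed
    have slack_diff: "n j \<bullet> (x - x0) = 0 \<longleftrightarrow> j \<in> J x" if "x \<in> X" "j \<in> J x0" for x j
    proof -
      have "n j \<bullet> x0 = \<beta> j"
        using slack_eq_iff[OF x0(1), of j] that(2) by simp
      then show ?thesis
        using slack_eq_iff[OF that(1), of j] by (simp add: inner_diff_right)
    qed
    have e: "?e1 \<in> J x0" "?e2 \<in> J x0"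
      by (simp_all add: x0(2))
    obtain y y' where y: "y \<in> ?B" "?e1 \<notin> J y" "?e2 \<in> J y" and y': "y' \<in> ?B" "?e2 \<notin> J y'"
      by (rule polygon_neighbours) (rule that)
    have "y \<in> X" "y' \<in> X"
      using y(1) y'(1) by (simp_all add: face_verts_def)
    then have \<alpha>1: "\<alpha>1 = 0"
      using eq[OF y(1)] slack_diff[of y, OF _ e(1)] slack_diff[of y, OF _ e(2)] y(2,3) by simp
    then have "\<alpha>2 = 0"
      using eq[OF y'(1)] slack_diff[of y', OF _ e(2)] y'(2) \<open>y' \<in> X\<close> by simp
    with \<alpha>1 C that show thesis
      by simp
  qed
  obtain i1 where i1: "spanning (polygon_frame n \<sigma>) (frame_index i1)"
    using spanning_polygon_frame by blast
  \<comment> \<open>The coefficient of the normal left out of the basis keeps its initial value;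
    only the remainder is expanded in the moving basis.\<close>
  let ?r = "\<lambda>\<xi>. C - \<mu> i1 *\<^sub>R tilted \<xi> (i1, \<sigma> i1)"
  let ?\<alpha>0 = "case_sum \<mu> (\<lambda>_. 0)"
  have r0: "C - \<mu> i1 *\<^sub>R n (i1, \<sigma> i1) = (\<Sum>j\<in>frame_index i1. ?\<alpha>0 j *\<^sub>R polygon_frame n \<sigma> j)"
  proof -
    have "C = (\<Sum>i\<in>insert i1 (-{i1}). \<mu> i *\<^sub>R n (i, \<sigma> i))"
      unfolding \<mu> by (rule sum.cong) auto
    then show ?thesis
      by (simp add: sum_frame_index)
  qed
  have "(?r \<longlongrightarrow> C - \<mu> i1 *\<^sub>R tilted 0 (i1, \<sigma> i1)) (nhds 0)"
    by (intro tendsto_intros tendsto_tilted)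
  then have r: "(?r \<longlongrightarrow> (\<Sum>j\<in>frame_index i1. ?\<alpha>0 j *\<^sub>R polygon_frame n \<sigma> j)) (nhds 0)"
    by (simp add: tilted_0 r0)
  obtain \<alpha> where rep: "\<forall>\<^sub>F \<xi> in nhds 0.
      ?r \<xi> = (\<Sum>j\<in>frame_index i1. \<alpha> \<xi> j *\<^sub>R polygon_frame (tilted \<xi>) \<sigma> j)"
    and \<alpha>: "\<And>j. j \<in> frame_index i1 \<Longrightarrow> ((\<lambda>\<xi>. \<alpha> \<xi> j) \<longlongrightarrow> ?\<alpha>0 j) (nhds 0)"
    using tendsto_representation[OF finite i1 card_frame_index _ r,
        where u = "\<lambda>\<xi>. polygon_frame (tilted \<xi>) \<sigma>"] tendsto_polygon_frame
    by blast
  \<comment> \<open>The visible part of the expansion. It tends to 0 and is absorbed by the slope,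
    which becomes \<open>c + d \<xi>\<close>, so that only moved normals of the polygon
    remain.\<close>
  define d where "d \<xi> = (\<Sum>a\<in>UNIV. \<alpha> \<xi> (Inr a) *\<^sub>R axis a 1 :: real^3)" for \<xi>
  have "(d \<longlongrightarrow> (\<Sum>a\<in>UNIV. 0 *\<^sub>R axis a 1)) (nhds 0)"
    unfolding d_def using \<alpha>[of "Inr _"] by (intro tendsto_intros) auto
  then have d: "(d \<longlongrightarrow> 0) (nhds 0)"
    by simp
  have ad: "((\<lambda>\<xi>. adjoint \<pi> (d \<xi>)) \<longlongrightarrow> adjoint \<pi> 0) (nhds 0)"
    by (intro bounded_linear.tendsto[OF linear_conv_bounded_linear[THEN iffD1, OF linear_adjoint_\<pi>]] d)
  have "\<forall>\<^sub>F \<xi> in nhds 0. (C - adjoint \<pi> (d \<xi>)) \<bullet> (vertex \<xi> x - vertex \<xi> x0) > 0"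
    if x: "x \<in> X" "x \<notin> ?B" for x
  proof (rule order_tendstoD(1))
    show "((\<lambda>\<xi>. (C - adjoint \<pi> (d \<xi>)) \<bullet> (vertex \<xi> x - vertex \<xi> x0))
        \<longlongrightarrow> (C - adjoint \<pi> 0) \<bullet> (x - x0)) (nhds 0)"
      by (intro tendsto_intros ad tendsto_vertex_0 x x0)
    show "0 < (C - adjoint \<pi> 0) \<bullet> (x - x0)"
      using C_pos[OF x x0B] by (simp add: linear_0[OF linear_adjoint_\<pi>])
  qed
  then have "\<forall>\<^sub>F \<xi> in nhds 0. \<forall>x\<in>X - ?B. (C - adjoint \<pi> (d \<xi>)) \<bullet> (vertex \<xi> x - vertex \<xi> x0) > 0"
    using finite_X by (intro eventually_ball_finite) auto
  moreover have "\<forall>\<^sub>F \<xi> in nhds 0. \<forall>x\<in>X. spanning (tilted \<xi>) (J x)"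
    using finite_X by (intro eventually_ball_finite ballI eventually_spanning_J spanning_tilted_0) auto
  ultimately show ?thesis
    using rep
  proof eventually_elim
    case (elim \<xi>)
    have "C - adjoint \<pi> (d \<xi>) =
        \<mu> i1 *\<^sub>R tilted \<xi> (i1, \<sigma> i1) + (\<Sum>i\<in>-{i1}. \<alpha> \<xi> (Inl i) *\<^sub>R tilted \<xi> (i, \<sigma> i))"
    proof -
      have "adjoint \<pi> (d \<xi>) = (\<Sum>a\<in>UNIV. \<alpha> \<xi> (Inr a) *\<^sub>R adjoint \<pi> (axis a 1))"
        by (simp add: d_def linear_sum[OF linear_adjoint_\<pi>] linear_scale[OF linear_adjoint_\<pi>])
      with elim(3) show ?thesis
        by (simp add: sum_frame_index algebra_simps)
    qed
    moreover have "tilted \<xi> (i, \<sigma> i) \<bullet> (vertex \<xi> x - vertex \<xi> x0) = 0" if "x \<in> ?B" for x i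
    proof -
      have "x \<in> X" "(i, \<sigma> i) \<in> J x" "(i, \<sigma> i) \<in> J x0"
        using that by (auto simp: face_verts_def x0(2))
      then show ?thesis
        using vertex_eq[of x \<xi> "(i, \<sigma> i)"] vertex_eq[of x0 \<xi> "(i, \<sigma> i)"] elim(2) x0(1)
        by (simp add: inner_diff_right)
    qed
    ultimately have on: "(C - adjoint \<pi> (d \<xi>)) \<bullet> (vertex \<xi> x - vertex \<xi> x0) = 0" if "x \<in> ?B" for x
      using that by (simp add: inner_add_left inner_sum_left)
    let ?c = "c + d \<xi>" and ?b = "(C - adjoint \<pi> (d \<xi>)) \<bullet> vertex \<xi> x0"
    have eq: "\<eta> \<bullet> vertex \<xi> x - (?c \<bullet> \<pi> (vertex \<xi> x) + ?b)
        = (C - adjoint \<pi> (d \<xi>)) \<bullet> (vertex \<xi> x - vertex \<xi> x0)" for x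
      by (simp add: C_def inner_diff_left inner_diff_right inner_add_left adjoint_\<pi>)
    have "?c \<bullet> \<pi> (vertex \<xi> x) + ?b \<le> \<eta> \<bullet> vertex \<xi> x \<and>
        (?c \<bullet> \<pi> (vertex \<xi> x) + ?b = \<eta> \<bullet> vertex \<xi> x \<longleftrightarrow> x \<in> ?B)" if "x \<in> X" for x
      using eq[of x] on[of x] elim(1) that by (cases "x \<in> ?B") force+
    then show ?case
      unfolding lower_face_def using finite_X by (auto simp: face_verts_def)
  qed
qed

lemma eventually_good: "\<forall>\<^sub>F \<xi> in nhds 0. good \<xi>"
proof -
  have "\<forall>\<^sub>F \<xi> in nhds 0. \<forall>x\<in>X. spanning (tilted \<xi>) (J x)"
    using finite_X by (intro eventually_ball_finite ballI eventually_spanning_J spanning_tilted_0) auto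
  moreover have "\<forall>\<^sub>F \<xi> in nhds 0. \<forall>x\<in>X. \<forall>j\<in>-J x. tilted \<xi> j \<bullet> (vertex \<xi> x - z0) < offset j"
    using finite_X by (intro eventually_ball_finite ballI eventually_slack) auto
  moreover have "\<forall>\<^sub>F \<xi> in nhds 0. \<forall>\<sigma>. \<forall>z. (\<forall>i. tilted \<xi> (i, \<sigma> i) \<bullet> z = 0) \<longrightarrow> \<pi> z = 0 \<longrightarrow> z = 0"
    by (intro eventually_all_finite eventually_\<pi>_inj_polygon)
  moreover have "\<forall>\<^sub>F \<xi> in nhds 0. \<forall>\<sigma>.
      lower_face (\<lambda>x. \<pi> (vertex \<xi> x)) (\<lambda>x. \<eta> \<bullet> vertex \<xi> x) X (face_verts (sel_graph \<sigma>))"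
    by (intro eventually_all_finite eventually_lower_face)
  ultimately show ?thesis
    using eventually_affinely_spanning
    by eventually_elim (auto simp: good_def)
qed

lemma good_configuration:
  assumes "good \<xi>"
  shows "wedge_configuration X J s \<pi> \<eta> (tilted \<xi>) (\<lambda>j. offset j + tilted \<xi> j \<bullet> z0) (vertex \<xi>)"
proof (unfold_locales)
  fix x j assume x: "x \<in> X"
  have "tilted \<xi> j \<bullet> (vertex \<xi> x - z0) = offset j" if "j \<in> J x"
    using vertex_eq[OF x _ that] assms x by (auto simp: good_def)
  moreover have "tilted \<xi> j \<bullet> (vertex \<xi> x - z0) < offset j" if "j \<notin> J x"
    using assms x that unfolding good_def by blast
  ultimately show "tilted \<xi> j \<bullet> vertex \<xi> x \<le> offset j + tilted \<xi> j \<bullet> z0"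
    "tilted \<xi> j \<bullet> vertex \<xi> x = offset j + tilted \<xi> j \<bullet> z0 \<longleftrightarrow> j \<in> J x"
    by (cases "j \<in> J x"; force simp: inner_diff_right)+
next
  show "\<And>x. x \<in> X \<Longrightarrow> spanning (tilted \<xi>) (J x)"
    "\<And>\<sigma> z. (\<And>i. tilted \<xi> (i, \<sigma> i) \<bullet> z = 0) \<Longrightarrow> \<pi> z = 0 \<Longrightarrow> z = 0"
    "\<And>\<sigma>. lower_face (\<lambda>x. \<pi> (vertex \<xi> x)) (\<lambda>x. \<eta> \<bullet> vertex \<xi> x) X (face_verts (sel_graph \<sigma>))"
    using assms unfolding good_def by blast+
qed (simp_all add: linear_add[OF linear_\<pi>] linear_scale[OF linear_\<pi>] DIM)

end

section \<open>Injectivity of the parametrization and the bound on the moduli\<close>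

context wedge_deformation
begin

lemma frame_decomposition:
  "y = (\<Sum>i\<in>-{i0}. (n (i, False) \<bullet> y) *\<^sub>R w i) + (\<Sum>a\<in>UNIV. (\<pi> y $ a) *\<^sub>R m a)" (is "y = ?y")
proof (rule spanning_solution_unique[OF spanning_fixed])
  fix j :: "'q + 3"
  assume j: "j \<in> frame_index i0"
  show "polygon_frame n (\<lambda>_. False) j \<bullet> y = polygon_frame n (\<lambda>_. False) j \<bullet> ?y"
  proof (cases j)
    case (Inl i)
    with j have i: "i \<noteq> i0"
      by simp
    have "(\<Sum>i'\<in>-{i0}. (n (i', False) \<bullet> y) * (n (i, False) \<bullet> w i'))
        = (\<Sum>i'\<in>-{i0}. if i' = i then n (i', False) \<bullet> y else 0)"
      using i by (intro sum.cong) (auto simp: w_dual)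
    also have "\<dots> = n (i, False) \<bullet> y"
      using i by simp
    finally show ?thesis
      using i by (simp add: Inl inner_add_right inner_sum_right m_dual)
  next
    case (Inr a)
    have "\<pi> ?y = (\<Sum>a\<in>UNIV. (\<pi> y $ a) *\<^sub>R axis a 1)"
      by (simp add: linear_add[OF linear_\<pi>] linear_sum[OF linear_\<pi>] linear_scale[OF linear_\<pi>] \<pi>_w \<pi>_m)
    also have "\<dots> = \<pi> y"
      by (simp add: vec_eq_iff axis_def if_distrib cong: if_cong)
    finally show ?thesis
      by (simp add: Inr adjoint_\<pi>)
  qed
qed

text \<open>Equal projections make all slacks proportional. The fixed slacks are linear in
  \<open>y\<close>, so the two deformations differ by a linear map that scales the fixed coordinates
  and keeps the visible ones. Comparing free slacks gives \<open>r j = 1\<close> because their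
  offsets are nonzero; then the normals agree up to the fixed scales, which \<open>g0\<close> shows
  to be 1.\<close>

lemma good_inj:
  assumes good: "good \<xi>" "good \<xi>'"
    and same: "\<And>x. x \<in> X \<Longrightarrow> \<pi> (vertex \<xi> x) = \<pi> (vertex \<xi>' x)"
  shows "\<xi> = \<xi>'"
proof -
  define y where "y x = vertex \<xi> x - z0" for x
  define y' where "y' x = vertex \<xi>' x - z0" for x
  have \<pi>y: "\<pi> (y x) = \<pi> (y' x)" if "x \<in> X" for x
    using same[OF that] by (simp add: y_def y'_def linear_diff[OF linear_\<pi>])
  have "\<exists>r. \<forall>x\<in>X. tilted \<xi>' j \<bullet> y' x - offset j = r * (tilted \<xi> j \<bullet> y x - offset j)" for j
  proof -
    obtain r where r: "\<And>x. x \<in> X \<Longrightarrow>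
        tilted \<xi>' j \<bullet> vertex \<xi>' x - (offset j + tilted \<xi>' j \<bullet> z0)
        = r * (tilted \<xi> j \<bullet> vertex \<xi> x - (offset j + tilted \<xi> j \<bullet> z0))"
      using slack_proportional[OF good_configuration[OF good(1)] good_configuration[OF good(2)] same, of j]
      by blast
    then show ?thesis
      by (intro exI[of _ r]) (simp add: y_def y'_def inner_diff_right algebra_simps)
  qed
  then obtain r where r: "\<And>j x. x \<in> X \<Longrightarrow>
      tilted \<xi>' j \<bullet> y' x - offset j = r j * (tilted \<xi> j \<bullet> y x - offset j)"
    by metis
  have fixed: "n (i, False) \<bullet> y' x = r (i, False) * (n (i, False) \<bullet> y x)" if "i \<noteq> i0" "x \<in> X" for i x
    using r[OF that(2), of "(i, False)"] that(1) z0_fixed[of "(i, False)"]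
    by (simp add: tilted_fixed offset_def)
  have key: "r (i, False) * (tilted \<xi>' j \<bullet> w i) = tilted \<xi> j \<bullet> w i"
    "tilted \<xi>' j \<bullet> m a = tilted \<xi> j \<bullet> m a"
    if j: "j \<notin> fixed_labels i0" and i: "i \<noteq> i0" for j i a
  proof -
    \<comment> \<open>The pullback of \<open>tilted \<xi>' j\<close> along the linear map from
      \<open>y\<close> to \<open>y'\<close>.\<close>
    define q where "q = (\<Sum>i\<in>-{i0}. (r (i, False) * (tilted \<xi>' j \<bullet> w i)) *\<^sub>R n (i, False))
      + adjoint \<pi> (\<chi> a. tilted \<xi>' j \<bullet> m a)"
    have q: "q \<bullet> y x = tilted \<xi>' j \<bullet> y' x" if x: "x \<in> X" for x
    proof -
      have "tilted \<xi>' j \<bullet> y' x = (\<Sum>i\<in>-{i0}. (n (i, False) \<bullet> y' x) * (tilted \<xi>' j \<bullet> w i))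
          + (\<Sum>a\<in>UNIV. (\<pi> (y' x) $ a) * (tilted \<xi>' j \<bullet> m a))"
        by (subst frame_decomposition[of "y' x"]) (simp add: inner_add_right inner_sum_right)
      also have "\<dots> = (\<Sum>i\<in>-{i0}. r (i, False) * (tilted \<xi>' j \<bullet> w i) * (n (i, False) \<bullet> y x))
          + (\<Sum>a\<in>UNIV. (tilted \<xi>' j \<bullet> m a) * (\<pi> (y x) $ a))"
        using fixed[OF _ x] \<pi>y[OF x]
        by (intro arg_cong2[of _ _ _ _ "(+)"] sum.cong) (auto simp: mult_ac)
      also have "\<dots> = q \<bullet> y x"
        by (simp add: q_def inner_add_left inner_sum_left adjoint_\<pi> inner_vec_def)
      finally show ?thesis ..
    qed
    let ?u = "q - r j *\<^sub>R tilted \<xi> j"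
    have u: "?u \<bullet> y x = offset j * (1 - r j)" if "x \<in> X" for x
      using q[OF that] r[OF that, of j] by (simp add: inner_diff_left algebra_simps)
    then have "\<forall>x\<in>X. ?u \<bullet> vertex \<xi> x = offset j * (1 - r j) + ?u \<bullet> z0"
      by (simp add: y_def inner_diff_right algebra_simps)
    \<comment> \<open>A functional that is constant on the vertices is zero; so its constant
      \<open>offset j * (1 - r j)\<close> will vanish too.\<close>
    then have u0: "?u = 0"
      using good(1) unfolding good_def by blast
    obtain x where "x \<in> X"
      using ex_vertex by blast
    with u[of x] u0 have "offset j * (1 - r j) = 0"
      by simp
    moreover have "offset j > 0"
      using z0_free[OF j] by (simp add: offset_def)
    ultimately have "r j = 1"
      by simp
    with u0 have qN: "q = tilted \<xi> j"
      by simp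
    have "q \<bullet> w i = (\<Sum>i'\<in>-{i0}. if i' = i then r (i', False) * (tilted \<xi>' j \<bullet> w i') else 0)"
      unfolding q_def inner_add_left inner_sum_left adjoint_\<pi> \<pi>_w[OF i]
      unfolding inner_scaleR_left inner_zero_right add_0_right
      using i by (intro sum.cong) (auto simp: w_dual)
    also have "\<dots> = r (i, False) * (tilted \<xi>' j \<bullet> w i)"
      using i by simp
    finally show "r (i, False) * (tilted \<xi>' j \<bullet> w i) = tilted \<xi> j \<bullet> w i"
      using qN by simp
    have "q \<bullet> m a = tilted \<xi>' j \<bullet> m a"
      by (simp add: q_def inner_add_left inner_sum_left adjoint_\<pi> \<pi>_m m_dual inner_axis)
    then show "tilted \<xi>' j \<bullet> m a = tilted \<xi> j \<bullet> m a"
      using qN by simp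
  qed
  obtain i1 where i1: "i1 \<noteq> i0"
    using s_neq by blast
  have free: "\<xi> $ j $ a = \<xi>' $ j $ a" if "j \<notin> fixed_labels i0" for j a
    using key(2)[OF that i1, of a] by (simp add: tilted_m[OF that])
  have visible: "\<xi> $ (i, False) $ a = \<xi>' $ (i, False) $ a" if i: "i \<noteq> i0" for i a
  proof -
    \<comment> \<open>At \<open>g0 i\<close> no multiple of \<open>n (i, False)\<close> is added, so
      the pairing with \<open>w i\<close> is the same nonzero number for both parameters.\<close>
    have "r (i, False) * (n (g0 i) \<bullet> w i) = n (g0 i) \<bullet> w i"
      using key(1)[OF g0_free[OF i] i] g0_g[OF i] by (simp add: tilted_w[OF g0_free[OF i] i])
    with g0_w[OF i] have "r (i, False) = 1"
      by simp
    moreover have "tilted \<xi>'' (g i a) \<bullet> w i = n (g i a) \<bullet> w i + \<xi>'' $ (i, False) $ a" for \<xi>''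
    proof -
      have "g i a' = g i a \<longleftrightarrow> a' = a" for a'
        using g_inj[OF i] by (auto dest: injD)
      then show ?thesis
        by (simp add: tilted_w[OF g_free[OF i] i])
    qed
    ultimately show ?thesis
      using key(1)[OF g_free[OF i] i, of a] by simp
  qed
  have "\<xi> $ j $ a = \<xi>' $ j $ a" for j a
    using free[of j a] visible[of "fst j" a] by (cases j, cases "j \<in> fixed_labels i0") auto
  then show ?thesis
    by (simp add: vec_eq_iff)
qed

lemma moduli_cells: "enat (6 * CARD('q)) \<le> moduli (cell ` cells)"
proof -
  let ?S = "cell ` cells" and ?V = "complex_vertices (cell ` cells)"
  have V: "?V = \<pi> ` X"
    using complex_vertices_cells by simp
  have inj: "inj_on \<pi> X"
    using \<pi>_v_inj by simp
  \<comment> \<open>A point of the realization space is a function on the projected vertices of the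
    original surface, hence the passage through \<open>inv_into\<close>.\<close>
  define \<Psi> where "\<Psi> \<xi> = restrict (\<lambda>q. \<pi> (vertex \<xi> (inv_into X \<pi> q))) ?V" for \<xi>
  have \<Psi>_\<pi>: "\<Psi> \<xi> (\<pi> x) = \<pi> (vertex \<xi> x)" if "x \<in> X" for \<xi> x
    using that inj by (simp add: \<Psi>_def V)
  let ?X = "subtopology (product_topology (\<lambda>_. euclidean) ?V) (realization_space ?S)"
  have \<Psi>_0: "\<Psi> 0 = restrict id ?V"
    by (rule ext) (auto simp: \<Psi>_def V vertex_0 inv_into_f_f[OF inj])
  obtain \<rho> where \<rho>: "\<rho> > 0" "\<And>\<xi>. \<xi> \<in> ball 0 \<rho> \<Longrightarrow> good \<xi>"
    using eventually_good unfolding eventually_nhds_metric by (auto simp: dist_commute)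
  have realization: "\<Psi> \<xi> \<in> realization_space ?S" if "good \<xi>" for \<xi>
  proof -
    interpret G: wedge_configuration X J s \<pi> \<eta> "tilted \<xi>" "\<lambda>j. offset j + tilted \<xi> j \<bullet> z0" "vertex \<xi>"
      by (rule good_configuration[OF that])
    have face: "face_with_coordinates ?S (\<Psi> \<xi>) (cell I) = G.cell I" if "I \<in> cells" for I
    proof -
      have "cell I \<inter> ?V = \<pi> ` face_verts I"
        using \<pi>_v_in_cell_iff[OF that] by (auto simp: V face_verts_def)
      moreover have "\<Psi> \<xi> ` \<pi> ` face_verts I = (\<lambda>x. \<pi> (vertex \<xi> x)) ` face_verts I"
        unfolding image_image by (intro image_cong) (auto simp: \<Psi>_\<pi> face_verts_def)
      ultimately show ?thesis
        by (simp add: face_with_coordinates_def G.cell_def)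
    qed
    then have img: "face_with_coordinates ?S (\<Psi> \<xi>) ` ?S = G.cell ` cells"
      unfolding image_image by (intro image_cong) auto
    have "inclusion_iso (face_with_coordinates ?S (\<Psi> \<xi>)) ?S (G.cell ` cells)"
      unfolding inclusion_iso_def
    proof (intro conjI ballI)
      show "bij_betw (face_with_coordinates ?S (\<Psi> \<xi>)) ?S (G.cell ` cells)"
        unfolding bij_betw_def
      proof (intro conjI img inj_onI)
        fix F F'
        assume "F \<in> ?S" "F' \<in> ?S"
          and eq: "face_with_coordinates ?S (\<Psi> \<xi>) F = face_with_coordinates ?S (\<Psi> \<xi>) F'"
        then obtain I I' where I: "I \<in> cells" "F = cell I" and I': "I' \<in> cells" "F' = cell I'"
          by blast
        show "F = F'"
          using eq cell_eq_iff[OF I(1) I'(1)] G.cell_eq_iff[OF I(1) I'(1)]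
          by (simp only: I(2) I'(2) face[OF I(1)] face[OF I'(1)])
      qed
      fix F F' assume "F \<in> ?S" "F' \<in> ?S"
      then obtain I I' where I: "I \<in> cells" "F = cell I" and I': "I' \<in> cells" "F' = cell I'"
        by blast
      show "F \<subseteq> F' \<longleftrightarrow>
          face_with_coordinates ?S (\<Psi> \<xi>) F \<subseteq> face_with_coordinates ?S (\<Psi> \<xi>) F'"
        using cell_subset_iff[OF I(1) I'(1)] G.cell_subset_iff[OF I(1) I'(1)]
        by (simp only: I(2) I'(2) face[OF I(1)] face[OF I'(1)])
    qed
    moreover have "\<Psi> \<xi> \<in> ?V \<rightarrow>\<^sub>E UNIV"
      by (simp add: \<Psi>_def)
    ultimately show ?thesis
      unfolding realization_space_def using G.polytopal_complex_cells img by simp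
  qed
  have cont: "continuous_map (top_of_set (ball 0 \<rho>)) ?X \<Psi>"
    unfolding continuous_map_in_subtopology
  proof
    show "continuous_map (top_of_set (ball 0 \<rho>)) (product_topology (\<lambda>_. euclidean) ?V) \<Psi>"
      unfolding continuous_map_componentwise
    proof (intro conjI ballI)
      show "\<Psi> ` topspace (top_of_set (ball 0 \<rho>)) \<subseteq> extensional ?V"
        by (auto simp: \<Psi>_def)
      fix q assume "q \<in> ?V"
      then obtain x where x: "x \<in> X" "q = \<pi> x"
        by (auto simp: V)
      have "continuous_on (ball 0 \<rho>) (\<lambda>\<xi>. vertex \<xi> x)"
        unfolding continuous_on_def
      proof
        fix \<xi>0 :: "(real^3)^('q \<times> bool)"
        assume "\<xi>0 \<in> ball 0 \<rho>"
        then have "spanning (tilted \<xi>0) (J x)"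
          using \<rho>(2) x(1) by (auto simp: good_def)
        then have "((\<lambda>\<xi>. vertex \<xi> x) \<longlongrightarrow> vertex \<xi>0 x) (nhds \<xi>0)"
          by (rule tendsto_vertex[OF x(1)])
        then show "((\<lambda>\<xi>. vertex \<xi> x) \<longlongrightarrow> vertex \<xi>0 x) (at \<xi>0 within ball 0 \<rho>)"
          by (rule tendsto_mono[rotated]) (simp add: at_within_def)
      qed
      then have "continuous_on (ball 0 \<rho>) (\<lambda>\<xi>. \<pi> (vertex \<xi> x))"
        by (rule bounded_linear.continuous_on[OF linear_conv_bounded_linear[THEN iffD1, OF linear_\<pi>]])
      then show "continuous_map (top_of_set (ball 0 \<rho>)) euclidean (\<lambda>\<xi>. \<Psi> \<xi> q)"
        by (simp add: x(2) \<Psi>_\<pi>[OF x(1)])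
    qed
    show "\<Psi> \<in> topspace (top_of_set (ball 0 \<rho>)) \<rightarrow> realization_space ?S"
      using realization \<rho>(2) by auto
  qed
  have "inj_on \<Psi> (ball 0 \<rho>)"
  proof (rule inj_onI)
    fix \<xi> \<xi>' assume "\<xi> \<in> ball 0 \<rho>" "\<xi>' \<in> ball 0 \<rho>" and eq: "\<Psi> \<xi> = \<Psi> \<xi>'"
    then have "good \<xi>" "good \<xi>'"
      using \<rho>(2) by blast+
    then show "\<xi> = \<xi>'"
    proof (rule good_inj)
      fix x assume "x \<in> X"
      then show "\<pi> (vertex \<xi> x) = \<pi> (vertex \<xi>' x)"
        using \<Psi>_\<pi>[of x \<xi>] \<Psi>_\<pi>[of x \<xi>'] eq by simp
    qed
  qed
  moreover have "Hausdorff_space ?X"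
    by (intro Hausdorff_space_subtopology) (simp add: Hausdorff_space_product_topology)
  ultimately have "enat DIM((real^3)^('q \<times> bool)) \<le> local_dimension ?X (\<Psi> 0)"
    using \<rho>(1) cont by (intro local_dimension_ge)
  moreover have "DIM((real^3)^('q \<times> bool)) = 6 * CARD('q)"
    by simp
  ultimately show ?thesis
    by (simp add: moduli_def \<Psi>_0)
qed

end

section \<open>Choice of the deformation data\<close>

context wedge_polytope
begin

theorem moduli_ge: "enat (6 * CARD('q)) \<le> moduli (cell ` cells)"
proof -
  obtain i0 where sp: "spanning (polygon_frame n (\<lambda>_. False)) (frame_index i0)"
    using spanning_polygon_frame by blast
  obtain z0 where z0: "\<And>j. j \<in> fixed_labels i0 \<Longrightarrow> n j \<bullet> z0 = \<beta> j"
    "\<And>j. j \<notin> fixed_labels i0 \<Longrightarrow> n j \<bullet> z0 < \<beta> j"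
    using ex_center by blast
  have solve: "\<exists>v. \<forall>j\<in>frame_index i0. polygon_frame n (\<lambda>_. False) j \<bullet> v = (if j = k then 1 else 0)" for k
    by (rule spanning_solve[OF finite sp card_frame_index])
  define d where "d k = (SOME v. \<forall>j\<in>frame_index i0. polygon_frame n (\<lambda>_. False) j \<bullet> v = (if j = k then 1 else 0))" for k
  have d: "polygon_frame n (\<lambda>_. False) j \<bullet> d k = (if j = k then 1 else 0)" if "j \<in> frame_index i0" for j k
    using someI_ex[OF solve[of k]] that unfolding d_def by blast
  define w where "w i = d (Inl i)" for i
  define m where "m a = d (Inr a)" for a
  have dn: "n (i, False) \<bullet> d k = (if Inl i = k then 1 else 0)" if "i \<noteq> i0" for i k
    using d[of "Inl i" k] that by simp
  have d\<pi>: "\<pi> (d k) $ a = (if Inr a = k then 1 else 0)" for a k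
    using d[of "Inr a" k] by (simp add: adjoint_\<pi> inner_axis')
  \<comment> \<open>Otherwise \<open>- w i\<close> would be a recession direction: the pairings with
    the free normals vanish, those with the fixed ones are at most 0.\<close>
  have "\<exists>j. j \<notin> fixed_labels i0 \<and> n j \<bullet> w i \<noteq> 0" if i: "i \<noteq> i0" for i
  proof (rule ccontr)
    assume none: "\<not> ?thesis"
    have "- w i = 0"
    proof (rule no_recession)
      fix j
      show "n j \<bullet> - w i \<le> 0"
      proof (cases "j \<in> fixed_labels i0")
        case True
        then obtain i' where "j = (i', False)" "i' \<noteq> i0"
          by (cases j) auto
        then show ?thesis
          by (simp add: w_def dn)
      next
        case False
        with none have "n j \<bullet> w i = 0"
          by blast
        then show ?thesis
          by simp
      qed
    qed
    then show False
      using dn[OF i, of "Inl i"] by (simp add: w_def)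
  qed
  then obtain g0 where g0: "\<And>i. i \<noteq> i0 \<Longrightarrow> g0 i \<notin> fixed_labels i0 \<and> n (g0 i) \<bullet> w i \<noteq> 0"
    by metis
  \<comment> \<open>Besides \<open>g0 i\<close> there are \<open>p\<close> free labels, and
    \<open>p \<ge> 3\<close>.\<close>
  have "\<exists>f :: 3 \<Rightarrow> 'q \<times> bool. inj f \<and> range f \<subseteq> - fixed_labels i0 - {g0 i}" if i: "i \<noteq> i0" for i
  proof -
    have "card (- fixed_labels i0 - {g0 i}) = CARD('q)"
      using g0[OF i] card_free_labels[of i0] by (simp add: card_Diff_subset)
    then have "CARD(3) \<le> card (- fixed_labels i0 - {g0 i})"
      using card_q by simp
    then show ?thesis
      using card_le_inj[of "UNIV :: 3 set" "- fixed_labels i0 - {g0 i}"] by auto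
  qed
  then obtain g :: "'q \<Rightarrow> 3 \<Rightarrow> 'q \<times> bool" where
    g: "\<And>i. i \<noteq> i0 \<Longrightarrow> inj (g i) \<and> range (g i) \<subseteq> - fixed_labels i0 - {g0 i}"
    by metis
  interpret wedge_deformation X J s \<pi> \<eta> n \<beta> i0 z0 w m g g0
  proof
    show "\<And>i. i \<noteq> i0 \<Longrightarrow> \<pi> (w i) = 0" "\<And>a. \<pi> (m a) = axis a 1"
      by (simp_all add: vec_eq_iff w_def m_def d\<pi> axis_def)
    show "\<And>i a. i \<noteq> i0 \<Longrightarrow> g i a \<notin> fixed_labels i0" "\<And>i a. i \<noteq> i0 \<Longrightarrow> g i a \<noteq> g0 i"
      using g by blast+
  qed (use sp z0 g0 g in \<open>auto simp: w_def m_def dn\<close>)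
  show ?thesis
    by (rule moduli_cells)
qed

end

section \<open>Faces of polyhedra\<close>

text \<open>Constraints tight at \<open>z\<close> are kept by the choice of \<open>d\<close>, the
  finitely many others by their slack when \<epsilon> is small.\<close>

lemma eventually_inequalities_near:
  fixes h :: "'k::finite \<Rightarrow> 'a::euclidean_space"
  assumes z: "\<And>k. h k \<bullet> z \<le> \<beta> k" and d: "\<And>k. h k \<bullet> z = \<beta> k \<Longrightarrow> h k \<bullet> d \<le> 0"
  obtains \<epsilon> where "\<epsilon> > 0" "\<And>k. h k \<bullet> (z + \<epsilon> *\<^sub>R d) \<le> \<beta> k"
proof -
  have "\<forall>\<^sub>F \<epsilon> in at_right 0. h k \<bullet> (z + \<epsilon> *\<^sub>R d) \<le> \<beta> k" for k
  proof (cases "h k \<bullet> z = \<beta> k")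
    case True
    show ?thesis
      using eventually_at_right_less[of "0::real"]
      by (rule eventually_mono) (use True d[of k] in \<open>auto simp: inner_add_right mult_nonneg_nonpos\<close>)
  next
    case False
    then have "h k \<bullet> z < \<beta> k"
      using z[of k] by simp
    moreover have "((\<lambda>\<epsilon>. h k \<bullet> (z + \<epsilon> *\<^sub>R d)) \<longlongrightarrow> h k \<bullet> (z + 0 *\<^sub>R d)) (at_right 0)"
      by (intro tendsto_intros)
    ultimately have "\<forall>\<^sub>F \<epsilon> in at_right 0. h k \<bullet> (z + \<epsilon> *\<^sub>R d) < \<beta> k"
      by (intro order_tendstoD(2)) auto
    then show ?thesis
      by (rule eventually_mono) simp
  qed
  then have "\<forall>\<^sub>F \<epsilon> in at_right 0. \<forall>k. h k \<bullet> (z + \<epsilon> *\<^sub>R d) \<le> \<beta> k"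
    by (rule eventually_all_finite)
  then have "\<forall>\<^sub>F \<epsilon> in at_right 0. \<epsilon> > 0 \<and> (\<forall>k. h k \<bullet> (z + \<epsilon> *\<^sub>R d) \<le> \<beta> k)"
    using eventually_at_right_less by (rule eventually_conj[rotated])
  then obtain \<epsilon> :: real where "\<epsilon> > 0 \<and> (\<forall>k. h k \<bullet> (z + \<epsilon> *\<^sub>R d) \<le> \<beta> k)"
    using eventually_happens' trivial_limit_at_right_real by blast
  then show thesis
    using that by blast
qed

definition tight_face :: "('k \<Rightarrow> 'a::euclidean_space) \<Rightarrow> ('k \<Rightarrow> real) \<Rightarrow> 'k set \<Rightarrow> 'a set" where
  "tight_face h \<beta> I = {z. (\<forall>k. h k \<bullet> z \<le> \<beta> k) \<and> (\<forall>k\<in>I. h k \<bullet> z = \<beta> k)}"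

lemma tight_face_le: "z \<in> tight_face h \<beta> I \<Longrightarrow> h k \<bullet> z \<le> \<beta> k"
  by (simp add: tight_face_def)

lemma tight_face_mono: "I \<subseteq> I' \<Longrightarrow> tight_face h \<beta> I' \<subseteq> tight_face h \<beta> I"
  by (auto simp: tight_face_def)

lemma convex_tight_face: "convex (tight_face h \<beta> I)"
proof -
  have "tight_face h \<beta> I = (\<Inter>k. {z. h k \<bullet> z \<le> \<beta> k}) \<inter> (\<Inter>k\<in>I. {z. h k \<bullet> z = \<beta> k})"
    by (auto simp: tight_face_def)
  also have "convex \<dots>"
    by (intro convex_Int convex_INT convex_halfspace_le convex_hyperplane)
  finally show ?thesis .
qed

lemma polyhedron_tight_face:
  fixes h :: "'k::finite \<Rightarrow> 'a::euclidean_space"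
  shows "polyhedron (tight_face h \<beta> {})"
proof -
  have "tight_face h \<beta> {} = \<Inter> (range (\<lambda>k. {z. h k \<bullet> z \<le> \<beta> k}))"
    by (auto simp: tight_face_def)
  then show ?thesis
    by (auto intro: polyhedron_halfspace_le)
qed

lemma tight_face_face_of: "tight_face h \<beta> I face_of tight_face h \<beta> {}"
proof (cases "I = {}")
  case True
  then show ?thesis
    by (simp add: face_of_refl convex_tight_face)
next
  case False
  have "tight_face h \<beta> I = (\<Inter>k\<in>I. tight_face h \<beta> {} \<inter> {z. h k \<bullet> z = \<beta> k})"
    using False by (auto simp: tight_face_def)
  also have "\<dots> face_of tight_face h \<beta> {}"
  proof (rule face_of_Inter)
    fix T assume "T \<in> (\<lambda>k. tight_face h \<beta> {} \<inter> {z. h k \<bullet> z = \<beta> k}) ` I"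
    then obtain k where k: "T = tight_face h \<beta> {} \<inter> {z. h k \<bullet> z = \<beta> k}"
      by blast
    show "T face_of tight_face h \<beta> {}"
      unfolding k by (intro face_of_Int_supporting_hyperplane_le convex_tight_face) (simp add: tight_face_def)
  qed (use False in simp)
  finally show ?thesis .
qed

lemma tight_face_face_of_tight_face:
  assumes "I \<subseteq> I'"
  shows "tight_face h \<beta> I' face_of tight_face h \<beta> I"
  using tight_face_face_of tight_face_mono[OF assms]
  by (rule face_of_subset) (auto simp: tight_face_def)

text \<open>Take \<open>z\<close> in the relative interior and let \<open>I\<close> be the
  constraints tight there. A segment from any other point of \<open>tight_face h \<beta> I\<close>
  to \<open>z\<close> can be prolonged a little beyond \<open>z\<close> inside the polyhedron, so
  the face property puts that point into \<open>F\<close>.\<close>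

lemma face_eq_tight_face:
  fixes h :: "'k::finite \<Rightarrow> 'a::euclidean_space"
  assumes "F face_of tight_face h \<beta> {}" "F \<noteq> {}"
  obtains I z where "F = tight_face h \<beta> I" "z \<in> F" "\<And>k. h k \<bullet> z = \<beta> k \<longleftrightarrow> k \<in> I"
proof -
  let ?Q = "tight_face h \<beta> {}"
  have "convex F"
    using assms(1) by (rule face_of_imp_convex)
  then obtain z where z: "z \<in> rel_interior F"
    using assms(2) rel_interior_eq_empty by blast
  then have zF: "z \<in> F"
    using rel_interior_subset by blast
  then have zQ: "z \<in> ?Q"
    using face_of_imp_subset[OF assms(1)] by blast
  define I where "I = {k. h k \<bullet> z = \<beta> k}"
  have "F \<subseteq> tight_face h \<beta> I"
  proof (rule subset_of_face_of[OF tight_face_face_of])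
    show "F \<subseteq> ?Q"
      by (rule face_of_imp_subset[OF assms(1)])
    have "z \<in> tight_face h \<beta> I"
      using zQ by (auto simp: tight_face_def I_def)
    with z show "tight_face h \<beta> I \<inter> rel_interior F \<noteq> {}"
      by blast
  qed
  moreover have "tight_face h \<beta> I \<subseteq> F"
  proof
    fix z' assume z': "z' \<in> tight_face h \<beta> I"
    show "z' \<in> F"
    proof (cases "z' = z")
      case False
      obtain \<epsilon> where \<epsilon>: "\<epsilon> > 0" "\<And>k. h k \<bullet> (z + \<epsilon> *\<^sub>R (z - z')) \<le> \<beta> k"
      proof (rule eventually_inequalities_near[of h z \<beta> "z - z'"])
        show "\<And>k. h k \<bullet> z \<le> \<beta> k"
          using zQ by (auto simp: tight_face_def)
        show "h k \<bullet> z = \<beta> k \<Longrightarrow> h k \<bullet> (z - z') \<le> 0" for k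
          using z' by (auto simp: tight_face_def I_def inner_diff_right)
      qed (use that in blast)
      let ?z'' = "z + \<epsilon> *\<^sub>R (z - z')"
      have "z = (1 - 1 / (1 + \<epsilon>)) *\<^sub>R z' + (1 / (1 + \<epsilon>)) *\<^sub>R ?z''"
      proof -
        have "(1 + \<epsilon>) *\<^sub>R ((1 - 1 / (1 + \<epsilon>)) *\<^sub>R z' + (1 / (1 + \<epsilon>)) *\<^sub>R ?z'') = \<epsilon> *\<^sub>R z' + ?z''"
          using \<epsilon>(1) by (simp add: scaleR_add_right) (simp add: field_simps)
        also have "\<dots> = (1 + \<epsilon>) *\<^sub>R z"
          by (simp add: algebra_simps)
        finally show ?thesis
          using \<epsilon>(1) by (metis add_pos_pos less_irrefl scaleR_cancel_left zero_less_one)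
      qed
      moreover have "z' \<noteq> ?z''"
      proof
        assume "z' = ?z''"
        then have "(1 + \<epsilon>) *\<^sub>R (z - z') = 0"
          by (simp add: algebra_simps)
        with False \<epsilon>(1) show False
          by auto
      qed
      moreover have "0 < 1 / (1 + \<epsilon>)" "1 / (1 + \<epsilon>) < 1"
        using \<epsilon>(1) by (auto simp: field_simps)
      ultimately have "z \<in> open_segment z' ?z''"
        unfolding in_segment by blast
      moreover have "z' \<in> ?Q" "?z'' \<in> ?Q"
        using z' \<epsilon>(2) by (auto simp: tight_face_def)
      ultimately show ?thesis
        using face_ofD[OF assms(1)] zF by blast
    qed (use zF in simp)
  qed
  ultimately have "F = tight_face h \<beta> I"
    by blast
  with zF that show thesis
    by (simp add: I_def)
qed

text \<open>A direction annihilated by all tight constraints could be followed a little within the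
  face, which is a single point.\<close>

lemma vertex_spanning:
  fixes h :: "'k::finite \<Rightarrow> 'a::euclidean_space"
  assumes "{x} face_of tight_face h \<beta> {}"
  shows "spanning h {k. h k \<bullet> x = \<beta> k}"
  unfolding spanning_def
proof (intro allI impI)
  fix d assume d: "\<forall>k\<in>{k. h k \<bullet> x = \<beta> k}. h k \<bullet> d = 0"
  obtain I x' where I: "{x} = tight_face h \<beta> I" and x': "x' \<in> {x}"
    and "\<And>k. h k \<bullet> x' = \<beta> k \<longleftrightarrow> k \<in> I"
    by (rule face_eq_tight_face[OF assms insert_not_empty]) (rule that)
  moreover have "x' = x"
    using x' by simp
  ultimately have I: "{x} = tight_face h \<beta> I" "\<And>k. h k \<bullet> x = \<beta> k \<longleftrightarrow> k \<in> I"
    by blast+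
  obtain \<epsilon> where \<epsilon>: "\<epsilon> > 0" "\<And>k. h k \<bullet> (x + \<epsilon> *\<^sub>R d) \<le> \<beta> k"
  proof (rule eventually_inequalities_near[of h x \<beta> d])
    show "\<And>k. h k \<bullet> x \<le> \<beta> k"
      using I(1) by (auto simp: tight_face_def)
  qed (use d in auto)
  have "x + \<epsilon> *\<^sub>R d \<in> tight_face h \<beta> I"
    using \<epsilon>(2) d I(2) by (auto simp: tight_face_def inner_add_right)
  then have "x + \<epsilon> *\<^sub>R d \<in> {x}"
    by (simp only: I(1))
  with \<epsilon>(1) show "d = 0"
    by simp
qed

lemma spanning_vertex:
  assumes "x \<in> tight_face h \<beta> {}" "spanning h {k. h k \<bullet> x = \<beta> k}"
  shows "{x} face_of tight_face h \<beta> {}"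
proof -
  have "tight_face h \<beta> {k. h k \<bullet> x = \<beta> k} = {x}"
    using assms(1) spanning_solution_unique[OF assms(2), of _ x] by (auto simp: tight_face_def)
  then show ?thesis
    using tight_face_face_of by metis
qed

section \<open>Isomorphisms of face lattices and dimension\<close>

lemma face_lattice_iso_mono:
  assumes "face_lattice_iso \<phi> P Q" "F face_of P" "G face_of P"
  shows "F \<subseteq> G \<longleftrightarrow> \<phi> F \<subseteq> \<phi> G"
  using assms unfolding face_lattice_iso_def inclusion_iso_def by blast

lemma face_lattice_iso_face:
  assumes "face_lattice_iso \<phi> P Q" "F face_of P"
  shows "\<phi> F face_of Q"
  using assms unfolding face_lattice_iso_def inclusion_iso_def bij_betw_def by blast

lemma face_lattice_iso_surj:
  assumes "face_lattice_iso \<phi> P Q" "G face_of Q"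
  obtains F where "F face_of P" "\<phi> F = G"
proof -
  have "G \<in> \<phi> ` {F. F face_of P}"
    using assms by (simp add: face_lattice_iso_def inclusion_iso_def bij_betw_def)
  then show thesis
    using that by (elim imageE) simp
qed

lemma face_lattice_iso_eq_iff:
  assumes "face_lattice_iso \<phi> P Q" "F face_of P" "G face_of P"
  shows "\<phi> F = \<phi> G \<longleftrightarrow> F = G"
  using face_lattice_iso_mono[OF assms] face_lattice_iso_mono[OF assms(1,3,2)] by blast

lemma face_lattice_iso_empty:
  assumes "face_lattice_iso \<phi> P Q"
  shows "\<phi> {} = {}"
proof -
  obtain F where "F face_of P" "\<phi> F = {}"
    by (rule face_lattice_iso_surj[OF assms empty_face_of])
  then show ?thesis
    using face_lattice_iso_mono[OF assms empty_face_of, of F] by auto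
qed

text \<open>Maximal chains of faces show that the dimension cannot drop under a strictly monotone map of
  face lattices.\<close>

lemma aff_dim_face_lattice_iso:
  assumes iso: "face_lattice_iso \<phi> P Q" and "polytope P" "F face_of P"
  shows "aff_dim F \<le> aff_dim (\<phi> F)"
  using assms(3)
proof (induction "nat (aff_dim F)" arbitrary: F rule: less_induct)
  case less
  show ?case
  proof (cases "aff_dim F > 0")
    case True
    have "polytope F"
      using less.prems assms(2) face_of_polytope_polytope by blast
    then obtain H where H: "H facet_of F"
      using polytope_facet_exists True by blast
    then have HF: "H face_of F" and dim: "aff_dim H = aff_dim F - 1"
      by (auto simp: facet_of_def)
    have HP: "H face_of P"
      using HF less.prems by (rule face_of_trans)
    have IH: "aff_dim H \<le> aff_dim (\<phi> H)"
      using less.hyps[OF _ HP] dim True by simp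
    have "\<phi> H \<subseteq> \<phi> F"
      using face_lattice_iso_mono[OF iso HP less.prems] face_of_imp_subset[OF HF] by blast
    moreover have "\<phi> H \<noteq> \<phi> F"
      using face_lattice_iso_eq_iff[OF iso HP less.prems] H by auto
    moreover have "\<phi> H face_of Q" "\<phi> F face_of Q"
      using face_lattice_iso_face[OF iso] HP less.prems by auto
    ultimately have "aff_dim (\<phi> H) < aff_dim (\<phi> F)"
      by (meson face_of_aff_dim_lt face_of_imp_convex face_of_imp_subset face_of_subset)
    with IH dim show ?thesis
      by simp
  next
    case False
    show ?thesis
    proof (cases "F = {}")
      case True
      then show ?thesis
        by (simp add: aff_dim_geq)
    next
      case nonempty: False
      then have "\<phi> F \<noteq> {}"
        using face_lattice_iso_eq_iff[OF iso less.prems empty_face_of] face_lattice_iso_empty[OF iso] by auto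
      then have "aff_dim (\<phi> F) \<ge> 0"
        using aff_dim_empty[of "\<phi> F"] aff_dim_geq[of "\<phi> F"] by linarith
      with False show ?thesis
        by simp
    qed
  qed
qed

text \<open>Extend the killed vector \<open>y' - y\<close> to a basis of the direction space of
  \<open>F\<close>; the images of the remaining basis vectors already span the image.\<close>

lemma aff_dim_linear_image_less:
  fixes f :: "'a::euclidean_space \<Rightarrow> 'b::euclidean_space"
  assumes f: "linear f" and y: "y \<in> F" "y' \<in> F" "y \<noteq> y'" "f y = f y'"
  shows "aff_dim (f ` F) < aff_dim F"
proof -
  let ?F = "(\<lambda>x. - y + x) ` F"
  have "y' - y \<noteq> 0" "y' - y \<in> ?F"
    using y by auto
  then obtain B where B: "{y' - y} \<subseteq> B" "B \<subseteq> ?F" "independent B" "?F \<subseteq> span B"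
    using maximal_independent_subset_extend[of "{y' - y}" ?F] by (metis empty_subsetI independent_insert insert_subset empty_iff independent_empty span_empty singletonD)
  have fin: "finite B"
    by (rule independent_imp_finite[OF B(3)])
  have "f (y' - y) = 0"
    using y(4) by (simp add: linear_diff[OF f])
  moreover have "f ` B = insert (f (y' - y)) (f ` (B - {y' - y}))"
    using B(1) by blast
  ultimately have "span (f ` B) = span (f ` (B - {y' - y}))"
    by (simp add: span_insert_0)
  then have "f ` ?F \<subseteq> span (f ` (B - {y' - y}))"
    using B(4) by (metis f image_mono linear_span_image)
  then have "dim (f ` ?F) \<le> card (f ` (B - {y' - y}))"
    using fin by (intro dim_le_card) auto
  also have "\<dots> \<le> card (B - {y' - y})"
    by (rule card_image_le) (use fin in auto)
  also have "\<dots> < card B"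
    using B(1) fin by (intro psubset_card_mono) auto
  also have "card B = dim ?F"
    using B basis_card_eq_dim by blast
  finally have "dim (f ` ?F) < dim ?F" .
  moreover have "aff_dim F = int (dim ?F)"
    using y(1) by (intro aff_dim_eq_dim) (simp add: hull_inc)
  moreover have "aff_dim (f ` F) = int (dim ((\<lambda>x. - f y + x) ` f ` F))"
    using y(1) by (intro aff_dim_eq_dim) (simp add: hull_inc)
  moreover have "(\<lambda>x. - f y + x) ` f ` F = f ` ?F"
    unfolding image_image by (intro image_cong) (auto simp: linear_add[OF f] linear_diff[OF f])
  ultimately show ?thesis
    by simp
qed

section \<open>Polygons and their wedges\<close>

locale cyclic_polygon =
  fixes A :: "'q::finite \<Rightarrow> real^2" and s :: "'q \<Rightarrow> 'q"
  assumes s_neq: "s l \<noteq> l" and ss_neq: "s (s l) \<noteq> l" and surj_s: "surj s"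
    and bounded_polygon: "bounded {x. \<forall>i. A i \<bullet> x \<le> 1}"
    and edge_facet: "({x. \<forall>i. A i \<bullet> x \<le> 1} \<inter> {x. A i \<bullet> x = 1}) facet_of {x. \<forall>i. A i \<bullet> x \<le> 1}"
    and edge_inj: "inj (\<lambda>i. {x. \<forall>i. A i \<bullet> x \<le> 1} \<inter> {x. A i \<bullet> x = 1})"
    and adjacent: "\<exists>x. (\<forall>i. A i \<bullet> x \<le> 1) \<and> A i \<bullet> x = 1 \<and> A (s i) \<bullet> x = 1"
begin

abbreviation polygon :: "(real^2) set" where
  "polygon \<equiv> {x. \<forall>i. A i \<bullet> x \<le> 1}"

lemma A_inj: "A i = A l \<Longrightarrow> i = l"
  by (rule injD[OF edge_inj]) simp

lemma aff_dim_polygon: "aff_dim polygon = 2"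
proof -
  have "open (\<Inter>i. {x. A i \<bullet> x < 1})"
    by (intro open_INT ballI open_halfspace_lt) auto
  moreover have "(\<Inter>i. {x. A i \<bullet> x < 1}) = {x. \<forall>i. A i \<bullet> x < 1}"
    by auto
  ultimately have "open {x. \<forall>i. A i \<bullet> x < 1}"
    by simp
  moreover have "{x. \<forall>i. A i \<bullet> x < 1} \<subseteq> polygon"
    by (auto intro: less_imp_le)
  ultimately have "{x. \<forall>i. A i \<bullet> x < 1} \<subseteq> interior polygon"
    by (intro interior_maximal)
  moreover have "0 \<in> {x. \<forall>i. A i \<bullet> x < 1}"
    by simp
  ultimately have "interior polygon \<noteq> {}"
    by blast
  then show ?thesis
    by (simp add: aff_dim_nonempty_interior)
qed

lemma edge_point:
  obtains z where "z \<in> polygon" "A i \<bullet> z = 1" "z \<noteq> x"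
proof -
  have "aff_dim (polygon \<inter> {x. A i \<bullet> x = 1}) = 1"
    using edge_facet[of i] aff_dim_polygon by (simp add: facet_of_def)
  then have "\<not> polygon \<inter> {x. A i \<bullet> x = 1} \<subseteq> {x}"
    by (metis aff_dim_subset aff_dim_sing not_one_le_zero)
  then show thesis
    using that by blast
qed

lemma plane_vector_eq_0:
  fixes u v d x :: "real^2"
  assumes "u \<bullet> d = 0" "d \<noteq> 0" "u \<bullet> x = 1" "v \<bullet> d = 0" "v \<bullet> x = 0"
  shows "v = 0"
proof -
  have "u $ 1 * d $ 1 + u $ 2 * d $ 2 = 0" "u $ 1 * x $ 1 + u $ 2 * x $ 2 = 1"
    "v $ 1 * d $ 1 + v $ 2 * d $ 2 = 0" "v $ 1 * x $ 1 + v $ 2 * x $ 2 = 0"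
    using assms by (simp_all add: inner_vec_def sum_2)
  note eqs = this
  \<comment> \<open>The determinant of \<open>x\<close> and \<open>d\<close>; it is nonzero because
    \<open>u\<close> vanishes on \<open>d\<close> but not on \<open>x\<close>.\<close>
  let ?D = "x $ 1 * d $ 2 - x $ 2 * d $ 1"
  have "?D \<noteq> 0"
  proof
    assume D: "?D = 0"
    have "d $ 1 = 0" "d $ 2 = 0"
      using eqs(1,2) D by algebra+
    with assms(2) show False
      by (simp add: vec_eq_iff forall_2)
  qed
  moreover have "v $ 1 * ?D = 0" "v $ 2 * ?D = 0"
    using eqs(3,4) by algebra+
  ultimately show ?thesis
    by (simp add: vec_eq_iff forall_2)
qed

text \<open>Otherwise \<open>A l - A i\<close> would vanish on the independent vectors
  \<open>x\<close> and \<open>z\<close>, and two edges would have the same normal.\<close>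

lemma edges_independent:
  assumes "i \<noteq> l" "A i \<bullet> x = 1" "A l \<bullet> x = 1" "A i \<bullet> z = 0" "A l \<bullet> z = 0"
  shows "z = 0"
proof (rule ccontr)
  assume "z \<noteq> 0"
  have "A l - A i = 0"
    by (rule plane_vector_eq_0[of "A i" z x]) (use assms \<open>z \<noteq> 0\<close> in \<open>auto simp: inner_diff_left\<close>)
  with assms(1) A_inj show False
    by auto
qed

lemma edge_direction:
  assumes x: "x \<in> polygon" "A i \<bullet> x = 1"
  obtains d where "A i \<bullet> d = 0" "\<And>l. l \<noteq> i \<Longrightarrow> A l \<bullet> x = 1 \<Longrightarrow> A l \<bullet> d < 0"
proof -
  obtain z where z: "z \<in> polygon" "A i \<bullet> z = 1" "z \<noteq> x"
    by (rule edge_point)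
  show thesis
  proof (rule that[of "z - x"])
    show "A i \<bullet> (z - x) = 0"
      using x z by (simp add: inner_diff_right)
    fix l assume l: "l \<noteq> i" "A l \<bullet> x = 1"
    have "A l \<bullet> (z - x) \<noteq> 0"
      using edges_independent[of i l x "z - x"] l x z by (auto simp: inner_diff_right)
    then show "A l \<bullet> (z - x) < 0"
      using z(1) l(2) by (auto simp: inner_diff_right less_le)
  qed
qed

text \<open>Running from \<open>x\<close> along any of the three edges strictly enters the other two
  half-planes. Two of these directions make \<open>A m\<close> a positive combination of
  \<open>A i\<close> and \<open>A l\<close>, which contradicts the third.\<close>

lemma no_three_edges:
  assumes x: "x \<in> polygon" "A i \<bullet> x = 1" "A l \<bullet> x = 1" "A m \<bullet> x = 1"
    and neq: "i \<noteq> l" "i \<noteq> m" "l \<noteq> m"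
  shows False
proof -
  have "spanning A {i, l}"
    using edges_independent[OF neq(1) x(2,3)] by (auto simp: spanning_def)
  then obtain \<alpha> where "A m = (\<Sum>j\<in>{i, l}. \<alpha> j *\<^sub>R A j)"
    using spanning_representation[of "{i, l}" A "A m"] neq(1) by auto
  then have m: "A m = \<alpha> i *\<^sub>R A i + \<alpha> l *\<^sub>R A l"
    using neq(1) by simp
  obtain d where d: "A i \<bullet> d = 0" "A l \<bullet> d < 0" "A m \<bullet> d < 0"
    using edge_direction[OF x(1,2)] neq x(3,4) by metis
  obtain d' where d': "A l \<bullet> d' = 0" "A i \<bullet> d' < 0" "A m \<bullet> d' < 0"
    using edge_direction[OF x(1,3)] neq x(2,4) by metis
  obtain d'' where d'': "A m \<bullet> d'' = 0" "A i \<bullet> d'' < 0" "A l \<bullet> d'' < 0"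
    using edge_direction[OF x(1,4)] neq x(2,3) by metis
  have "\<alpha> l > 0"
    using d by (simp add: m inner_add_left mult_less_0_iff)
  moreover have "\<alpha> i > 0"
    using d' by (simp add: m inner_add_left mult_less_0_iff)
  ultimately have "A m \<bullet> d'' < 0"
    using d''(2,3) by (simp add: m inner_add_left add_neg_neg mult_pos_neg)
  with d''(1) show False
    by simp
qed

text \<open>If \<open>l\<close> were not a neighbour of \<open>i\<close>, the line of edge
  \<open>i\<close> would carry \<open>x\<close> and the corners shared with the two neighbours. One
  of these three points lies between the others; a constraint tight there is tight at both ends, or
  the point is an end. Either way three edges meet in a point.\<close>

lemma edges_adjacent:
  assumes x: "x \<in> polygon" "A i \<bullet> x = 1" "A l \<bullet> x = 1" and neq: "i \<noteq> l"
  shows "l = s i \<or> i = s l"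
proof (rule ccontr)
  assume not: "\<not> ?thesis"
  obtain k where k: "s k = i"
    using surj_s by (metis surjD)
  have neqs: "s i \<noteq> i" "s i \<noteq> l" "k \<noteq> i" "k \<noteq> l" "k \<noteq> s i"
    using not k s_neq ss_neq by blast+
  obtain q where q: "q \<in> polygon" "A i \<bullet> q = 1" "A (s i) \<bullet> q = 1"
    using adjacent[of i] by blast
  obtain q' where q': "q' \<in> polygon" "A k \<bullet> q' = 1" "A i \<bullet> q' = 1"
    using adjacent[of k] k by blast
  have tight: "m \<bullet> u = 1 \<and> m \<bullet> v = 1 \<or> y = u \<or> y = v"
    if "between (u, v) y" "m \<bullet> y = 1" "m \<bullet> u \<le> 1" "m \<bullet> v \<le> 1" for m u v y :: "real^2"
  proof -
    have "y \<in> closed_segment u v"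
      using that(1) by (simp add: between_mem_segment)
    then have "\<exists>t. 0 \<le> t \<and> t \<le> 1 \<and> y = (1 - t) *\<^sub>R u + t *\<^sub>R v"
      unfolding in_segment by blast
    then obtain t where t: "0 \<le> t" "t \<le> 1" "y = (1 - t) *\<^sub>R u + t *\<^sub>R v"
      by (elim exE conjE)
    have sum: "(1 - t) * (1 - m \<bullet> u) + t * (1 - m \<bullet> v) = 0"
      using that(2) by (simp add: t(3) inner_add_right algebra_simps)
    moreover have "(1 - t) * (1 - m \<bullet> u) \<ge> 0" "t * (1 - m \<bullet> v) \<ge> 0"
      using that t by auto
    ultimately have "(1 - t) * (1 - m \<bullet> u) = 0" "t * (1 - m \<bullet> v) = 0"
      by linarith+
    then show ?thesis
      by (auto simp: t(3))
  qed
  have "A i \<noteq> 0"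
    using x(2) by auto
  then have "aff_dim {x. A i \<bullet> x = 1} = 1"
    by (simp add: aff_dim_hyperplane)
  then have "aff_dim {q, q', x} \<le> 1"
    using aff_dim_subset[of "{q, q', x}" "{x. A i \<bullet> x = 1}"] q q' x by simp
  then have "collinear {q, q', x}"
    by (simp add: collinear_aff_dim)
  then consider "between (q', x) q" | "between (x, q) q'" | "between (q, q') x"
    using collinear_between_cases by blast
  then have "A l \<bullet> q = 1 \<or> A (s i) \<bullet> x = 1 \<or> A k \<bullet> x = 1 \<or> A k \<bullet> q = 1 \<or> A (s i) \<bullet> q' = 1"
  proof cases
    case 1
    then show ?thesis
      using tight[of q' x q "A (s i)"] q q' x by auto
  next
    case 2
    then show ?thesis
      using tight[of x q q' "A k"] q q' x by auto
  next
    case 3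
    then show ?thesis
      using tight[of q q' x "A l"] q q' x by auto
  qed
  then show False
    using no_three_edges[OF q(1,2,3), of l] no_three_edges[OF x(1,2,3), of "s i"]
      no_three_edges[OF x(1,2,3), of k] no_three_edges[OF q(1,2,3), of k]
      no_three_edges[OF q'(1,3,2), of "s i"] neqs neq
    by metis
qed

end

section \<open>The wedge over a polygon\<close>

locale polygon_wedge = cyclic_polygon A s for A :: "'q::finite \<Rightarrow> real^2" and s +
  fixes B :: "bool \<Rightarrow> real"
  assumes B_neg: "B t * B (\<not> t) < 0"
begin

definition wedge_normal :: "'q \<times> bool \<Rightarrow> (real^2) \<times> (real^'q)" where
  "wedge_normal = (\<lambda>(i, t). (A i, B t *\<^sub>R axis i 1))"

abbreviation wedge_face :: "('q \<times> bool) set \<Rightarrow> ((real^2) \<times> (real^'q)) set" where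
  "wedge_face \<equiv> tight_face wedge_normal (\<lambda>_. 1)"

definition active :: "(real^2) \<times> (real^'q) \<Rightarrow> ('q \<times> bool) set" where
  "active z = {k. wedge_normal k \<bullet> z = 1}"

lemma wedge_normal_inner [simp]: "wedge_normal (i, t) \<bullet> (x, y) = A i \<bullet> x + B t * y $ i"
  by (simp add: wedge_normal_def inner_prod_def inner_axis')

lemma B_nonzero: "B t \<noteq> 0"
  using B_neg[of t] by auto

lemma B_nonneg: "\<exists>t. 0 \<le> B t * y"
proof (rule ccontr)
  assume "\<not> ?thesis"
  then have "0 < (B True * y) * (B (\<not> True) * y)"
    by (intro mult_neg_neg) (simp_all add: not_le)
  also have "\<dots> = (B True * B (\<not> True)) * (y * y)"
    by (simp add: mult_ac)
  also have "\<dots> \<le> 0"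
    by (intro mult_nonpos_nonneg less_imp_le[OF B_neg]) simp
  finally show False
    by simp
qed

text \<open>Used with \<open>c = 1 - A i \<bullet> x\<close>: when one facet over edge
  \<open>i\<close> is tight, the other is tight only if \<open>x\<close> lies on that edge, because
  the interval coefficients have opposite signs.\<close>

lemma B_mult_le:
  assumes "B t * y = c" "c \<ge> 0"
  shows "B (\<not> t) * y \<le> 0" "B (\<not> t) * y = 0 \<longleftrightarrow> c = 0"
proof -
  have "(B t * B t) * (B (\<not> t) * y) = (B t * B (\<not> t)) * c"
    by (simp add: assms(1)[symmetric])
  also have "\<dots> \<le> 0"
    using B_neg[of t] assms(2) by (simp add: mult_nonpos_nonneg)
  finally have "(B t * B t) * (B (\<not> t) * y) \<le> 0" .
  moreover have "0 < B t * B t"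
    using B_nonzero[of t] by (auto simp: zero_less_mult_iff linorder_neq_iff)
  ultimately show "B (\<not> t) * y \<le> 0"
    using mult_le_cancel_left_pos[of "B t * B t" "B (\<not> t) * y" 0] by simp
  show "B (\<not> t) * y = 0 \<longleftrightarrow> c = 0"
    using assms(1) B_nonzero by auto
qed

text \<open>One of the two products \<open>B t * y $ i\<close> is nonnegative, and its inequality
  bounds \<open>A i \<bullet> x\<close>.\<close>

lemma wedge_base_slack:
  assumes "(x, y) \<in> wedge_face {}"
  shows "x \<in> polygon"
proof -
  have "A i \<bullet> x \<le> 1" for i
  proof (rule ccontr)
    assume not_le: "\<not> ?thesis"
    have le: "A i \<bullet> x + B t * y $ i \<le> 1" for t
      using assms unfolding tight_face_def by (auto dest: spec[of _ "(i, t)"])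
    have "B t * y $ i < 0" for t
      using le[of t] not_le by linarith
    then show False
      using B_nonneg[of "y $ i"] by (meson linorder_not_le)
  qed
  then show ?thesis
    by simp
qed

lemma bounded_wedge: "bounded (wedge_face {})"
proof -
  obtain R where R: "\<And>x. x \<in> polygon \<Longrightarrow> norm x \<le> R"
    using bounded_polygon by (auto simp: bounded_iff)
  \<comment> \<open>One of the two constraints bounds \<open>\<bar>y $ i\<bar>\<close> by a multiple
    of \<open>1 / \<bar>B t\<bar>\<close>; the sum of both reciprocals covers either sign.\<close>
  define M where "M i = (1 + norm (A i) * R) * (1 / \<bar>B True\<bar> + 1 / \<bar>B False\<bar>)" for i
  have "wedge_face {} \<subseteq> cball 0 R \<times> cball 0 (\<Sum>i\<in>UNIV. M i)"
  proof (rule subsetI, clarify, intro conjI)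
    fix x :: "real^2" and y :: "real^'q" assume xy: "(x, y) \<in> wedge_face {}"
    then have x: "x \<in> polygon"
      by (rule wedge_base_slack)
    with R show "x \<in> cball 0 R"
      by simp
    have "\<bar>y $ i\<bar> \<le> M i" for i
    proof -
      have le: "A i \<bullet> x + B t * y $ i \<le> 1" for t
        using xy unfolding tight_face_def by (auto dest: spec[of _ "(i, t)"])
      have "\<bar>A i \<bullet> x\<bar> \<le> norm (A i) * norm x"
        by (rule Cauchy_Schwarz_ineq2)
      also have "\<dots> \<le> norm (A i) * R"
        using R[OF x] by (simp add: mult_left_mono)
      finally have c: "B t * y $ i \<le> 1 + norm (A i) * R" for t
        using le[of t] by linarith
      have "\<exists>t. B t * y $ i = \<bar>B t\<bar> * \<bar>y $ i\<bar>"
        using B_nonneg[of "y $ i"] by (metis abs_mult abs_of_nonneg)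
      then obtain t where "\<bar>B t\<bar> * \<bar>y $ i\<bar> \<le> 1 + norm (A i) * R"
        using c by metis
      then have "\<bar>y $ i\<bar> \<le> (1 + norm (A i) * R) * (1 / \<bar>B t\<bar>)"
        using B_nonzero[of t] by (simp add: field_simps)
      also have "\<dots> \<le> M i"
      proof -
        have "0 \<le> R"
          using R[of 0] by simp
        then show ?thesis
          unfolding M_def by (intro mult_left_mono) (cases t, auto)
      qed
      finally show ?thesis .
    qed
    then have "norm y \<le> (\<Sum>i\<in>UNIV. M i)"
      using norm_le_l1_cart[of y] by (meson order_trans sum_mono)
    then show "y \<in> cball 0 (\<Sum>i\<in>UNIV. M i)"
      by simp
  qed
  then show ?thesis
    by (rule bounded_subset[rotated]) (intro bounded_Times bounded_cball)
qed

lemma polytope_wedge: "polytope (wedge_face {})"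
  using bounded_wedge polyhedron_tight_face by (simp add: polytope_eq_bounded_polyhedron)

lemma aff_dim_wedge: "aff_dim (wedge_face {}) = int CARD('q) + 2"
proof -
  have "open (\<Inter>k. {z. wedge_normal k \<bullet> z < 1})"
    by (intro open_INT ballI open_halfspace_lt) auto
  moreover have "(\<Inter>k. {z. wedge_normal k \<bullet> z < 1}) \<subseteq> wedge_face {}"
    by (auto simp: tight_face_def intro: less_imp_le simp del: wedge_normal_inner)
  ultimately have "(\<Inter>k. {z. wedge_normal k \<bullet> z < 1}) \<subseteq> interior (wedge_face {})"
    by (intro interior_maximal)
  moreover have "0 \<in> (\<Inter>k. {z. wedge_normal k \<bullet> z < 1})"
    by simp
  ultimately have "interior (wedge_face {}) \<noteq> {}"
    by blast
  then show ?thesis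
    by (simp add: aff_dim_nonempty_interior)
qed

lemma tight_edges:
  assumes "x \<in> polygon" "A l \<bullet> x = 1" "A (s l) \<bullet> x = 1"
  shows "A i \<bullet> x = 1 \<longleftrightarrow> i = l \<or> i = s l"
  using no_three_edges[OF assms, of i] assms(2,3) s_neq by metis

lemma ex_wedge_vertex:
  obtains z where "{z} face_of wedge_face {}" "active z = vertex_labels s l \<sigma>"
proof -
  obtain x where x: "x \<in> polygon" "A l \<bullet> x = 1" "A (s l) \<bullet> x = 1"
    using adjacent by blast
  note tight = tight_edges[OF x]
  \<comment> \<open>Over the corner \<open>x\<close> the fibre coordinate makes the selected facet
    tight; on the edges \<open>l\<close> and \<open>s l\<close> it is 0, which makes both facets
    tight.\<close>
  define y where "y = (\<chi> i. (1 - A i \<bullet> x) / B (\<sigma> i))"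
  have y: "B (\<sigma> i) * y $ i = 1 - A i \<bullet> x" for i
    using B_nonzero by (simp add: y_def)
  have val: "A i \<bullet> x + B t * y $ i \<le> 1" "A i \<bullet> x + B t * y $ i = 1 \<longleftrightarrow> t = \<sigma> i \<or> i = l \<or> i = s l" for i t
  proof -
    have "A i \<bullet> x \<le> 1"
      using x(1) by blast
    then have "0 \<le> 1 - A i \<bullet> x"
      by simp
    note opp = B_mult_le[OF y this]
    show "A i \<bullet> x + B t * y $ i \<le> 1"
      using y[of i] opp(1) \<open>A i \<bullet> x \<le> 1\<close> by (cases "t = \<sigma> i") auto
    show "A i \<bullet> x + B t * y $ i = 1 \<longleftrightarrow> t = \<sigma> i \<or> i = l \<or> i = s l"
    proof (cases "t = \<sigma> i")
      case True
      then show ?thesis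
        using y[of i] by simp
    next
      case False
      then have t: "t = (\<not> \<sigma> i)"
        by auto
      have "A i \<bullet> x + B t * y $ i = 1 \<longleftrightarrow> A i \<bullet> x = 1"
      proof (cases "A i \<bullet> x = 1")
        case True
        then show ?thesis
          using opp(2) by (simp add: t)
      next
        case False
        then show ?thesis
          using opp(1) \<open>A i \<bullet> x \<le> 1\<close> by (auto simp: t)
      qed
      with False tight show ?thesis
        by blast
    qed
  qed
  have act: "active (x, y) = vertex_labels s l \<sigma>"
  proof (rule set_eqI)
    fix k
    show "k \<in> active (x, y) \<longleftrightarrow> k \<in> vertex_labels s l \<sigma>"
      by (cases k) (simp add: active_def val(2))
  qed
  have "{(x, y)} face_of wedge_face {}"
  proof (rule spanning_vertex)
    show "(x, y) \<in> wedge_face {}"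
      using val(1) by (auto simp: tight_face_def)
    have "spanning wedge_normal (active (x, y))"
      unfolding spanning_def act
    proof (intro allI impI)
      fix d assume d: "\<forall>k\<in>vertex_labels s l \<sigma>. wedge_normal k \<bullet> d = 0"
      obtain u v where uv: "d = (u, v)"
        by fastforce
      have eq: "A i \<bullet> u + B t * v $ i = 0" if "t = \<sigma> i \<or> i = l \<or> i = s l" for i t
        using bspec[OF d, of "(i, t)"] that by (simp add: uv)
      have both: "A i \<bullet> u = 0" if "i = l \<or> i = s l" for i
      proof -
        have "A i \<bullet> u = - (B True * v $ i)" "A i \<bullet> u = - (B False * v $ i)"
          using eq[of True i] eq[of False i] that by auto
        then have "(A i \<bullet> u) * (A i \<bullet> u) = (B True * B (\<not> True)) * (v $ i * v $ i)"
          by simp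
        also have "\<dots> \<le> 0"
          by (intro mult_nonpos_nonneg less_imp_le[OF B_neg]) simp
        finally show ?thesis
          by (metis mult_eq_0_iff not_square_less_zero order_le_less)
      qed
      have u: "u = 0"
        by (rule edges_independent[of l "s l" x]) (use s_neq[of l] x both in auto)
      have "v $ i = 0" for i
        using eq[of "\<sigma> i" i] B_nonzero[of "\<sigma> i"] by (simp add: u)
      then show "d = 0"
        by (simp add: uv u vec_eq_iff zero_prod_def)
    qed
    then show "spanning wedge_normal {k. wedge_normal k \<bullet> (x, y) = 1}"
      by (simp add: active_def)
  qed
  with act that show thesis
    by blast
qed

text \<open>Were no facet over edge \<open>i\<close> tight, the fibre coordinate \<open>i\<close>
  could move freely; were at most one edge tight at \<open>x\<close>, the base point could move.
  Both contradict the spanning of the tight normals at a vertex.\<close>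

lemma wedge_vertex_active:
  assumes "{z} face_of wedge_face {}"
  obtains l \<sigma> where "active z = vertex_labels s l \<sigma>"
proof -
  obtain x y where z: "z = (x, y)"
    by fastforce
  have sp: "spanning wedge_normal (active z)"
    using vertex_spanning[OF assms] by (simp add: active_def)
  have xy: "(x, y) \<in> wedge_face {}"
    using face_of_imp_subset[OF assms] by (simp add: z)
  then have x: "x \<in> polygon"
    by (rule wedge_base_slack)
  have act: "(i, t) \<in> active z \<longleftrightarrow> A i \<bullet> x + B t * y $ i = 1" for i t
    by (simp add: active_def z)
  have "\<exists>t. (i, t) \<in> active z" for i
  proof (rule ccontr)
    assume none: "\<not> ?thesis"
    have "(0, axis i 1 :: real^'q) = (0 :: (real^2) \<times> (real^'q))"
    proof (rule spanningD[OF sp])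
      fix k assume "k \<in> active z"
      with none show "wedge_normal k \<bullet> (0, axis i 1) = 0"
        by (cases k) (auto simp: axis_def)
    qed
    then show False
      by (simp add: zero_prod_def axis_eq_0_iff)
  qed
  then obtain \<sigma> where \<sigma>: "\<And>i. (i, \<sigma> i) \<in> active z"
    by metis
  have both: "(i, \<not> \<sigma> i) \<in> active z \<longleftrightarrow> A i \<bullet> x = 1" for i
  proof -
    have "B (\<sigma> i) * y $ i = 1 - A i \<bullet> x"
      using \<sigma>[of i] by (simp add: act)
    moreover have "A i \<bullet> x \<le> 1"
      using x by blast
    then have "0 \<le> 1 - A i \<bullet> x"
      by simp
    ultimately have "B (\<not> \<sigma> i) * y $ i \<le> 0" "B (\<not> \<sigma> i) * y $ i = 0 \<longleftrightarrow> 1 - A i \<bullet> x = 0"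
      by (rule B_mult_le)+
    with \<open>A i \<bullet> x \<le> 1\<close> show ?thesis
      by (auto simp: act)
  qed
  have "\<exists>i l. i \<noteq> l \<and> A i \<bullet> x = 1 \<and> A l \<bullet> x = 1"
  proof (rule ccontr)
    assume none: "\<not> ?thesis"
    obtain u where u: "\<And>i. A i \<bullet> x = 1 \<Longrightarrow> A i = u"
      using none by metis
    obtain d where d: "d \<noteq> 0" "orthogonal u d"
      using orthogonal_to_vector_exists[of u] by auto
    \<comment> \<open>The fibre coordinates compensate the motion \<open>d\<close> of the base point
      so that the selected facets stay tight.\<close>
    define v where "v = (\<chi> i. - (A i \<bullet> d) / B (\<sigma> i))"
    have "(d, v) = 0"
    proof (rule spanningD[OF sp])
      fix k assume k: "k \<in> active z"
      obtain i t where it: "k = (i, t)"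
        by fastforce
      show "wedge_normal k \<bullet> (d, v) = 0"
      proof (cases "t = \<sigma> i")
        case True
        then show ?thesis
          using B_nonzero by (simp add: it v_def)
      next
        case False
        then have "t = (\<not> \<sigma> i)"
          by auto
        with k both have "A i \<bullet> x = 1"
          by (simp add: it)
        then have "A i \<bullet> d = 0"
          using u d(2) by (simp add: orthogonal_def)
        then show ?thesis
          by (simp add: it v_def)
      qed
    qed
    with d(1) show False
      by (simp add: zero_prod_def)
  qed
  then obtain i l where il: "i \<noteq> l" "A i \<bullet> x = 1" "A l \<bullet> x = 1"
    by blast
  then obtain m where m: "A m \<bullet> x = 1" "A (s m) \<bullet> x = 1"
    using edges_adjacent[OF x, of i l] by blast
  have "active z = vertex_labels s m \<sigma>"
  proof -
    have "(i, t) \<in> active z \<longleftrightarrow> t = \<sigma> i \<or> i = m \<or> i = s m" for i t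
      using \<sigma>[of i] both[of i] tight_edges[OF x m, of i] by (cases "t = \<sigma> i") auto
    note iff = this
    show ?thesis
    proof (rule set_eqI)
      fix k
      show "k \<in> active z \<longleftrightarrow> k \<in> vertex_labels s m \<sigma>"
        by (cases k) (simp add: iff)
    qed
  qed
  then show thesis
    by (rule that)
qed

end

section \<open>Polytopes combinatorially equivalent to a wedge\<close>

locale wedge_realization = polygon_wedge A s B
  for A :: "'q::finite \<Rightarrow> real^2" and s :: "'q \<Rightarrow> 'q" and B :: "bool \<Rightarrow> real" +
  fixes W :: "((real^2) \<times> (real^'q)) set"
    and \<phi> :: "((real^2) \<times> (real^'q)) set \<Rightarrow> ((real^2) \<times> (real^'q)) set"
  assumes polytope_W: "polytope W" and iso: "face_lattice_iso \<phi> (wedge_face {}) W"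
begin

text \<open>Only the face lattice of \<open>W\<close> is given, so its inequalities have to be
  recovered, as supporting functionals of the images of the faces
  \<open>wedge_face {k}\<close>.\<close>

definition facet_ineq :: "'q \<times> bool \<Rightarrow> ((real^2) \<times> (real^'q)) \<times> real" where
  "facet_ineq k = (SOME ab. W \<subseteq> {x. fst ab \<bullet> x \<le> snd ab} \<and> \<phi> (wedge_face {k}) = W \<inter> {x. fst ab \<bullet> x = snd ab})"

abbreviation N :: "'q \<times> bool \<Rightarrow> (real^2) \<times> (real^'q)" where
  "N k \<equiv> fst (facet_ineq k)"

abbreviation \<beta> :: "'q \<times> bool \<Rightarrow> real" where
  "\<beta> k \<equiv> snd (facet_ineq k)"

definition X :: "((real^2) \<times> (real^'q)) set" where
  "X = {x. {x} face_of W}"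

definition J :: "(real^2) \<times> (real^'q) \<Rightarrow> ('q \<times> bool) set" where
  "J x = {k. N k \<bullet> x = \<beta> k}"

lemma wedge_face_of: "wedge_face I face_of wedge_face {}"
  by (rule tight_face_face_of)

lemma \<phi>_face_of: "F face_of wedge_face {} \<Longrightarrow> \<phi> F face_of W"
  by (rule face_lattice_iso_face[OF iso])

lemma facet_ineq: "W \<subseteq> {x. N k \<bullet> x \<le> \<beta> k}" "\<phi> (wedge_face {k}) = W \<inter> {x. N k \<bullet> x = \<beta> k}"
proof -
  have "\<phi> (wedge_face {k}) exposed_face_of W"
    using polytope_W \<phi>_face_of[OF wedge_face_of]
    by (simp add: exposed_face_of_polyhedron polytope_imp_polyhedron)
  then obtain a b where "W \<subseteq> {x. a \<bullet> x \<le> b}" "\<phi> (wedge_face {k}) = W \<inter> {x. a \<bullet> x = b}"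
    unfolding exposed_face_of_def by blast
  then have "\<exists>ab. W \<subseteq> {x. fst ab \<bullet> x \<le> snd ab} \<and> \<phi> (wedge_face {k}) = W \<inter> {x. fst ab \<bullet> x = snd ab}"
    by (intro exI[of _ "(a, b)"]) simp
  from someI_ex[OF this] show "W \<subseteq> {x. N k \<bullet> x \<le> \<beta> k}" "\<phi> (wedge_face {k}) = W \<inter> {x. N k \<bullet> x = \<beta> k}"
    unfolding facet_ineq_def by blast+
qed

lemma \<phi>_wedge: "\<phi> (wedge_face {}) = W"
proof -
  obtain F where F: "F face_of wedge_face {}" "\<phi> F = W"
    by (rule face_lattice_iso_surj[OF iso face_of_refl[OF polytope_imp_convex[OF polytope_W]]])
  then have "W \<subseteq> \<phi> (wedge_face {})"
    using face_lattice_iso_mono[OF iso F(1) wedge_face_of] face_of_imp_subset by blast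
  moreover have "\<phi> (wedge_face {}) \<subseteq> W"
    using face_of_imp_subset[OF \<phi>_face_of[OF wedge_face_of]] .
  ultimately show ?thesis
    by blast
qed

text \<open>An isomorphism of face lattices does not lower the dimension, and the wedge already has
  the ambient dimension \<open>p + 2\<close>.\<close>

lemma affine_hull_W: "affine hull W = UNIV"
proof -
  have "int CARD('q) + 2 \<le> aff_dim W"
    using aff_dim_face_lattice_iso[OF iso polytope_wedge wedge_face_of[of "{}"]]
    by (simp add: \<phi>_wedge aff_dim_wedge)
  moreover have "aff_dim W \<le> int DIM((real^2) \<times> (real^'q))"
    by (rule aff_dim_le_DIM)
  ultimately have "aff_dim W = int DIM((real^2) \<times> (real^'q))"
    by simp
  then show ?thesis
    by (simp only: aff_dim_eq_full)
qed

lemma proper_face_subset_facet: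
  assumes "F face_of W" "F \<noteq> W"
  obtains k where "\<And>x. x \<in> F \<Longrightarrow> N k \<bullet> x = \<beta> k"
proof -
  obtain G where G: "G face_of wedge_face {}" "\<phi> G = F"
    by (rule face_lattice_iso_surj[OF iso assms(1)])
  obtain k where k: "G \<subseteq> wedge_face {k}"
  proof (cases "G = {}")
    case False
    obtain I z where I: "G = wedge_face I" "z \<in> G" "\<And>k. wedge_normal k \<bullet> z = 1 \<longleftrightarrow> k \<in> I"
      by (rule face_eq_tight_face[OF G(1) False]) (rule that)
    have "I \<noteq> {}"
      using assms(2) G(2) I(1) \<phi>_wedge by auto
    then obtain k where "k \<in> I"
      by blast
    then have "G \<subseteq> wedge_face {k}"
      unfolding I(1) by (intro tight_face_mono) simp
    then show thesis
      by (rule that)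
  qed (use that in simp)
  then have "F \<subseteq> \<phi> (wedge_face {k})"
    using face_lattice_iso_mono[OF iso G(1) wedge_face_of] G(2) by simp
  then show thesis
    using that facet_ineq(2)[of k] by blast
qed

lemma interior_W_less:
  assumes "x \<in> interior W"
  shows "N k \<bullet> x < \<beta> k"
proof -
  have "wedge_face {k} \<noteq> wedge_face {}"
  proof -
    have "0 \<in> wedge_face {}" "0 \<notin> wedge_face {k}"
      by (auto simp: tight_face_def)
    then show ?thesis
      by blast
  qed
  then have "\<phi> (wedge_face {k}) \<noteq> W"
    using face_lattice_iso_eq_iff[OF iso wedge_face_of wedge_face_of] \<phi>_wedge by metis
  then have "\<phi> (wedge_face {k}) \<inter> interior W = {}"
    by (intro face_of_disjoint_interior \<phi>_face_of wedge_face_of)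
  with assms show ?thesis
    using facet_ineq[of k] interior_subset[of W] by force
qed

lemma interior_W: "interior W = rel_interior W" "interior W \<noteq> {}"
proof -
  show eq: "interior W = rel_interior W"
    using rel_interior_interior[OF affine_hull_W] by simp
  have "W \<noteq> {}"
    using affine_hull_W by auto
  then show "interior W \<noteq> {}"
    unfolding eq using rel_interior_eq_empty[OF polytope_imp_convex[OF polytope_W]] by simp
qed

text \<open>A segment from an interior point to a point outside \<open>W\<close> leaves
  \<open>W\<close> in some facet, where one of the inequalities is an equation. That inequality is
  strict at the inner end and weak at the outer one, hence strict at the exit point, a
  contradiction.\<close>

lemma W_eq: "tight_face N \<beta> {} = W"
proof (rule subset_antisym)
  show "W \<subseteq> tight_face N \<beta> {}"
    using facet_ineq(1) by (auto simp: tight_face_def)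
  show "tight_face N \<beta> {} \<subseteq> W"
  proof (rule subsetI, rule ccontr)
    fix u assume u: "u \<in> tight_face N \<beta> {}" "u \<notin> W"
    obtain z where z: "z \<in> interior W"
      using interior_W(2) by blast
    have "closed_segment z u \<inter> frontier W \<noteq> {}"
      by (rule connected_Int_frontier) (use z u(2) interior_subset in auto)
    then obtain y where y: "y \<in> closed_segment z u" "y \<in> frontier W"
      by blast
    have "closed W"
      using polytope_W by (rule polytope_imp_closed)
    with y(2) have yW: "y \<in> W" "y \<notin> interior W"
      by (auto simp: frontier_def)
    then have "y \<in> W - rel_interior W"
      using interior_W(1) by simp
    then obtain F where F: "F facet_of W" "y \<in> F"
      using rel_boundary_of_polyhedron[OF polytope_imp_polyhedron[OF polytope_W]] by blast
    then have "F face_of W" "F \<noteq> W"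
      by (auto simp: facet_of_imp_face_of)
    then obtain k where k: "\<And>x. x \<in> F \<Longrightarrow> N k \<bullet> x = \<beta> k"
      by (rule proper_face_subset_facet) (rule that)
    obtain t where t: "0 \<le> t" "t \<le> 1" "y = (1 - t) *\<^sub>R z + t *\<^sub>R u"
      using y(1) by (auto simp: in_segment)
    have "t \<noteq> 1"
      using t(3) yW(1) u(2) by auto
    have "N k \<bullet> y = (1 - t) * (N k \<bullet> z) + t * (N k \<bullet> u)"
      by (simp add: t(3) inner_add_right)
    also have "(1 - t) * (N k \<bullet> z) < (1 - t) * \<beta> k"
      using interior_W_less[OF z] t(2) \<open>t \<noteq> 1\<close> by (intro mult_strict_left_mono) auto
    also have "t * (N k \<bullet> u) \<le> t * \<beta> k"
      using tight_face_le[OF u(1)] t(1) by (intro mult_left_mono)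
    finally have "N k \<bullet> y < \<beta> k"
      by (simp add: algebra_simps)
    with k[OF F(2)] show False
      by simp
  qed
qed

lemma mem_W_iff: "x \<in> W \<longleftrightarrow> (\<forall>k. N k \<bullet> x \<le> \<beta> k)"
proof -
  have "x \<in> tight_face N \<beta> {} \<longleftrightarrow> (\<forall>k. N k \<bullet> x \<le> \<beta> k)"
    unfolding tight_face_def by blast
  then show ?thesis
    by (simp only: W_eq)
qed

lemma tight_face_face_of_W: "tight_face N \<beta> I face_of W"
  using tight_face_face_of[of N \<beta> I] by (simp only: W_eq)

text \<open>Each side is the largest face inside all faces named by a single label of
  \<open>I\<close>, and an isomorphism of face lattices respects this description.\<close>

lemma \<phi>_wedge_face: "\<phi> (wedge_face I) = tight_face N \<beta> I"
proof
  have "\<phi> (wedge_face I) \<subseteq> \<phi> (wedge_face {k})" if "k \<in> I" for k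
    using face_lattice_iso_mono[OF iso wedge_face_of wedge_face_of] that
    by (metis empty_subsetI insert_subset tight_face_mono)
  moreover have "\<phi> (wedge_face I) \<subseteq> W"
    using face_of_imp_subset[OF \<phi>_face_of[OF wedge_face_of]] .
  ultimately show "\<phi> (wedge_face I) \<subseteq> tight_face N \<beta> I"
    unfolding facet_ineq(2) using facet_ineq(1) by (fastforce simp: tight_face_def)
  obtain G where G: "G face_of wedge_face {}" "\<phi> G = tight_face N \<beta> I"
    by (rule face_lattice_iso_surj[OF iso tight_face_face_of_W])
  have "G \<subseteq> wedge_face {k}" if "k \<in> I" for k
  proof -
    have "\<phi> G \<subseteq> \<phi> (wedge_face {k})"
      unfolding G(2) facet_ineq(2) using that face_of_imp_subset[OF tight_face_face_of_W, of I]
      by (auto simp: tight_face_def)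
    then show ?thesis
      using face_lattice_iso_mono[OF iso G(1) wedge_face_of] by blast
  qed
  moreover have "G \<subseteq> wedge_face {}"
    using G(1) by (rule face_of_imp_subset)
  ultimately have "G \<subseteq> wedge_face I"
    by (fastforce simp: tight_face_def)
  then show "tight_face N \<beta> I \<subseteq> \<phi> (wedge_face I)"
    using face_lattice_iso_mono[OF iso G(1) wedge_face_of] G(2) by blast
qed

lemma finite_X: "finite X"
proof -
  have "X = {x. x extreme_point_of W}"
    by (simp add: X_def face_of_singleton)
  then show ?thesis
    using finite_polyhedron_extreme_points[OF polytope_imp_polyhedron[OF polytope_W]] by simp
qed

lemma X_subset_W: "X \<subseteq> W"
  by (auto simp: X_def dest: face_of_imp_subset)

lemma face_eq_hull:
  assumes "F face_of W"
  shows "F = convex hull (X \<inter> F)"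
proof -
  have "compact F" "convex F"
    using assms polytope_W face_of_polytope_polytope polytope_imp_compact polytope_imp_convex by blast+
  then have "F = convex hull {x. x extreme_point_of F}"
    by (rule Krein_Milman_Minkowski)
  moreover have "{x. x extreme_point_of F} = X \<inter> F"
    using extreme_point_of_face[OF assms] by (auto simp: X_def face_of_singleton)
  ultimately show ?thesis
    by simp
qed

lemma nonempty_face_vertex:
  fixes P :: "'a::euclidean_space set"
  assumes "polytope P" "F face_of P" "F \<noteq> {}"
  obtains x where "x \<in> F" "{x} face_of P"
proof -
  have "compact F" "convex F"
    using assms face_of_polytope_polytope polytope_imp_compact polytope_imp_convex by blast+
  then have "F = convex hull {x. x extreme_point_of F}"
    by (rule Krein_Milman_Minkowski)
  with assms(3) obtain x where "x extreme_point_of F"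
    by force
  then have "x \<in> F" "{x} face_of P"
    using extreme_point_of_face[OF assms(2)] by (auto simp: face_of_singleton)
  then show thesis
    by (rule that)
qed

lemma J_active:
  assumes "{z} face_of wedge_face {}" "\<phi> {z} = {x}"
  shows "J x = active z"
proof -
  have xW: "x \<in> W"
    using face_of_imp_subset[OF \<phi>_face_of[OF assms(1)]] assms(2) by simp
  have zW: "z \<in> wedge_face {}"
    using face_of_imp_subset[OF assms(1)] by simp
  have "k \<in> J x \<longleftrightarrow> k \<in> active z" for k
  proof -
    have "k \<in> J x \<longleftrightarrow> \<phi> {z} \<subseteq> \<phi> (wedge_face {k})"
      using xW by (simp add: J_def facet_ineq(2) assms(2))
    also have "\<dots> \<longleftrightarrow> {z} \<subseteq> wedge_face {k}"
      using face_lattice_iso_mono[OF iso assms(1) wedge_face_of] by simp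
    also have "\<dots> \<longleftrightarrow> k \<in> active z"
      using zW by (auto simp: active_def tight_face_def)
    finally show ?thesis .
  qed
  then show ?thesis
    by blast
qed

text \<open>Vertices are the minimal nonempty faces, so an isomorphism of face lattices matches
  them.\<close>

lemma X_vertex:
  assumes "x \<in> X"
  obtains z where "{z} face_of wedge_face {}" "\<phi> {z} = {x}"
proof -
  have x: "{x} face_of W"
    using assms by (simp add: X_def)
  obtain G where G: "G face_of wedge_face {}" "\<phi> G = {x}"
    by (rule face_lattice_iso_surj[OF iso x])
  have "G \<noteq> {}"
    using G(2) face_lattice_iso_empty[OF iso] by auto
  then obtain z where z: "z \<in> G" "{z} face_of wedge_face {}"
    by (rule nonempty_face_vertex[OF polytope_wedge G(1)])
  have "\<phi> {z} \<subseteq> {x}"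
    using face_lattice_iso_mono[OF iso z(2) G(1)] z(1) G(2) by simp
  moreover have "\<phi> {z} \<noteq> {}"
    using face_lattice_iso_eq_iff[OF iso z(2) empty_face_of] face_lattice_iso_empty[OF iso] by simp
  ultimately have "\<phi> {z} = {x}"
    by blast
  with z(2) show thesis
    by (rule that)
qed

lemma vertex_X:
  assumes "{z} face_of wedge_face {}"
  obtains x where "x \<in> X" "\<phi> {z} = {x}"
proof -
  have "\<phi> {z} \<noteq> {}"
    using face_lattice_iso_eq_iff[OF iso assms empty_face_of] face_lattice_iso_empty[OF iso] by simp
  then obtain x where x: "x \<in> \<phi> {z}" "{x} face_of W"
    by (rule nonempty_face_vertex[OF polytope_W \<phi>_face_of[OF assms]])
  obtain G where G: "G face_of wedge_face {}" "\<phi> G = {x}"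
    by (rule face_lattice_iso_surj[OF iso x(2)])
  have "G \<subseteq> {z}"
    using face_lattice_iso_mono[OF iso G(1) assms] G(2) x(1) by simp
  moreover have "G \<noteq> {}"
    using G(2) face_lattice_iso_empty[OF iso] by auto
  ultimately have "G = {z}"
    by blast
  with G(2) x(2) show thesis
    by (intro that[of x]) (auto simp: X_def)
qed

lemma spanning_J: "x \<in> X \<Longrightarrow> spanning N (J x)"
  unfolding J_def by (rule vertex_spanning) (simp add: X_def W_eq)

sublocale wedge_incidence X J s
proof
  show "finite X"
    by (rule finite_X)
  show "s l \<noteq> l" "s (s l) \<noteq> l" "surj s" for l
    by (rule s_neq ss_neq surj_s)+
  show "\<exists>l \<sigma>. J x = vertex_labels s l \<sigma>" if x: "x \<in> X" for x
  proof -
    obtain z where z: "{z} face_of wedge_face {}" "\<phi> {z} = {x}"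
      by (rule X_vertex[OF x])
    obtain l \<sigma> where "active z = vertex_labels s l \<sigma>"
      by (rule wedge_vertex_active[OF z(1)])
    with J_active[OF z] show ?thesis
      by auto
  qed
  show "\<exists>x\<in>X. J x = vertex_labels s l \<sigma>" for l \<sigma>
  proof -
    obtain z where z: "{z} face_of wedge_face {}" "active z = vertex_labels s l \<sigma>"
      by (rule ex_wedge_vertex)
    obtain x where "x \<in> X" "\<phi> {z} = {x}"
      by (rule vertex_X[OF z(1)])
    with J_active[OF z(1)] z(2) show ?thesis
      by auto
  qed
  show "inj_on J X"
  proof (rule inj_onI)
    fix x y assume x: "x \<in> X" and y: "y \<in> X" and eq: "J x = J y"
    show "x = y"
      using spanning_J[OF x]
    proof (rule spanning_solution_unique)
      fix k assume k: "k \<in> J x"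
      then have "k \<in> J y"
        by (simp add: eq)
      with k show "N k \<bullet> x = N k \<bullet> y"
        by (simp add: J_def)
    qed
  qed
qed

lemma \<phi>_hull: "\<phi> (wedge_face I) = convex hull (face_verts I)"
proof -
  have "X \<inter> tight_face N \<beta> I = face_verts I"
    using X_subset_W mem_W_iff by (auto simp: face_verts_def tight_face_def J_def)
  then show ?thesis
    using face_eq_hull[OF tight_face_face_of_W, of I] by (simp add: \<phi>_wedge_face)
qed

lemma wedge_face_nonempty_iff: "wedge_face I \<noteq> {} \<longleftrightarrow> face_verts I \<noteq> {}"
  using face_lattice_iso_eq_iff[OF iso wedge_face_of empty_face_of] face_lattice_iso_empty[OF iso]
    \<phi>_hull by (metis convex_hull_eq_empty)

text \<open>The corner at \<open>s i\<close> does not touch the edge \<open>i\<close>, so only the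
  selected facet over \<open>i\<close> is tight there.\<close>

lemma wedge_face_selector_subset_iff:
  "wedge_face (sel_graph \<sigma>) \<subseteq> {z. wedge_normal (i, t) \<bullet> z = 1} \<longleftrightarrow> t = \<sigma> i"
proof
  assume sub: "wedge_face (sel_graph \<sigma>) \<subseteq> {z. wedge_normal (i, t) \<bullet> z = 1}"
  obtain z where z: "{z} face_of wedge_face {}" "active z = vertex_labels s (s i) \<sigma>"
    by (rule ex_wedge_vertex)
  have "sel_graph \<sigma> \<subseteq> active z"
    by (simp add: z(2))
  then have "z \<in> wedge_face (sel_graph \<sigma>)"
    using face_of_imp_subset[OF z(1)] by (auto simp: tight_face_def active_def)
  with sub have "(i, t) \<in> active z"
    by (auto simp: active_def)
  then show "t = \<sigma> i"
    using s_neq[of i, symmetric] ss_neq[of i, symmetric] by (simp add: z(2))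
next
  assume "t = \<sigma> i"
  then show "wedge_face (sel_graph \<sigma>) \<subseteq> {z. wedge_normal (i, t) \<bullet> z = 1}"
    unfolding tight_face_def by (intro Collect_mono) (auto simp del: wedge_normal_inner)
qed

lemma sel_graph_in_cells: "sel_graph \<sigma> \<in> cells"
proof -
  fix l :: 'q
  obtain x where "x \<in> X" "J x = vertex_labels s l \<sigma>"
    using ex_vertex by blast
  then have "x \<in> face_verts (sel_graph \<sigma>)"
    by (simp add: face_verts_def)
  then show ?thesis
    by (auto simp: cells_def)
qed

lemma affinely_spanning:
  assumes "\<And>x. x \<in> X \<Longrightarrow> u \<bullet> x = b"
  shows "u = 0"
proof (rule ccontr)
  assume "u \<noteq> 0"
  have "W = convex hull X"
    using face_eq_hull[OF face_of_refl[OF polytope_imp_convex[OF polytope_W]]] X_subset_W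
    by (simp add: Int_absorb2)
  moreover have "convex hull X \<subseteq> {x. u \<bullet> x = b}"
    by (intro hull_minimal convex_hyperplane subsetI CollectI assms)
  ultimately have "W \<subseteq> {x. u \<bullet> x = b}"
    by simp
  then have "interior W \<subseteq> interior {x. u \<bullet> x = b}"
    by (rule interior_mono)
  with interior_W(2) interior_hyperplane[OF \<open>u \<noteq> 0\<close>] show False
    by simp
qed

lemma no_recession:
  assumes "\<And>k. N k \<bullet> z \<le> 0"
  shows "z = 0"
proof (rule ccontr)
  assume z: "z \<noteq> 0"
  obtain x where x: "x \<in> W"
    using interior_W(2) interior_subset by blast
  have mem: "x + t *\<^sub>R z \<in> W" if "t \<ge> 0" for t
  proof -
    have "N k \<bullet> (x + t *\<^sub>R z) \<le> \<beta> k" for k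
    proof -
      have "t * (N k \<bullet> z) \<le> 0"
        using that assms[of k] by (simp add: mult_nonneg_nonpos)
      moreover have "N k \<bullet> x \<le> \<beta> k"
        using facet_ineq(1)[of k] x by blast
      ultimately show ?thesis
        by (simp add: inner_add_right)
    qed
    then show ?thesis
      by (simp add: mem_W_iff)
  qed
  obtain R where R: "\<And>y. y \<in> W \<Longrightarrow> norm y \<le> R"
    using polytope_imp_bounded[OF polytope_W] by (auto simp: bounded_iff)
  have "0 \<le> R"
    using R[OF x] norm_ge_zero order_trans by blast
  \<comment> \<open>Far enough to leave \<open>W\<close>, whose points are at most
    \<open>2 * R\<close> apart.\<close>
  define t where "t = (2 * R + 1) / norm z"
  have t: "t \<ge> 0"
    using \<open>0 \<le> R\<close> by (simp add: t_def)
  have "2 * R + 1 = norm (t *\<^sub>R z)"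
    using z \<open>0 \<le> R\<close> by (simp add: t_def)
  also have "\<dots> = norm ((x + t *\<^sub>R z) - x)"
    by simp
  also have "\<dots> \<le> norm (x + t *\<^sub>R z) + norm x"
    by (rule norm_triangle_ineq4)
  also have "\<dots> \<le> 2 * R"
    using R[OF mem[OF t]] R[OF x] by simp
  finally show False
    by simp
qed

end

section \<open>Projecting the polytope\<close>

text \<open>\<open>\<pi>\<close>, \<open>\<eta>\<close> and \<open>f\<close> stand for the first
  three coordinates, the fourth one and all four together. \<open>f_inner\<close> splits a
  functional of four coordinates accordingly, and \<open>f_eq_0\<close> says that \<open>f\<close>
  sees nothing else.\<close>

locale projected_wedge = wedge_realization A s B W \<phi>
  for A :: "'q::finite \<Rightarrow> real^2" and s B W \<phi> +
  fixes \<pi> :: "(real^2) \<times> (real^'q) \<Rightarrow> real^3" and \<eta> :: "(real^2) \<times> (real^'q)"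
    and f :: "(real^2) \<times> (real^'q) \<Rightarrow> real^4"
  assumes linear_\<pi>: "linear \<pi>" and surj_\<pi>: "surj \<pi>" and linear_f: "linear f"
    and f_inner: "\<exists>c'. \<forall>z. c \<bullet> f z = c' \<bullet> \<pi> z + c $ 4 * (\<eta> \<bullet> z)"
    and f_eq_0: "\<pi> z = 0 \<Longrightarrow> \<eta> \<bullet> z = 0 \<Longrightarrow> f z = 0"
    and preserved: "I \<in> cells \<Longrightarrow> preserved_by f W (\<phi> (wedge_face I))"
    and lower: "I \<in> cells \<Longrightarrow> f ` \<phi> (wedge_face I) \<in> lower_hull 4 (f ` W)"
begin

text \<open>Dividing the outer normal by the absolute value of its negative last entry yields an
  affine function of the visible coordinates below the height. Since the preimage of the projected
  face is the face itself, equality of the two means membership in the face.\<close>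

lemma supporting_functional:
  assumes "I \<in> cells"
  obtains c b where "\<And>x. x \<in> W \<Longrightarrow> c \<bullet> \<pi> x + b \<le> \<eta> \<bullet> x"
    "\<And>x. x \<in> W \<Longrightarrow> c \<bullet> \<pi> x + b = \<eta> \<bullet> x \<longleftrightarrow> x \<in> \<phi> (wedge_face I)"
proof -
  let ?F = "\<phi> (wedge_face I)"
  obtain c \<gamma> where c: "c $ 4 < 0" "f ` W \<subseteq> {x. c \<bullet> x \<le> \<gamma>}" "f ` ?F = f ` W \<inter> {x. c \<bullet> x = \<gamma>}"
    using lower[OF assms] unfolding lower_hull_def by blast
  obtain c' where c': "\<And>z. c \<bullet> f z = c' \<bullet> \<pi> z + c $ 4 * (\<eta> \<bullet> z)"
    using f_inner by blast
  have on: "c \<bullet> f x = \<gamma> \<longleftrightarrow> x \<in> ?F" if "x \<in> W" for x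
  proof -
    have "f -` (f ` ?F) \<inter> W = ?F"
      using preserved[OF assms] by (simp add: preserved_by_def)
    then have "x \<in> ?F \<longleftrightarrow> f x \<in> f ` ?F"
      using that by blast
    also have "\<dots> \<longleftrightarrow> c \<bullet> f x = \<gamma>"
      using that by (simp add: c(3))
    finally show ?thesis
      by simp
  qed
  let ?c = "c' /\<^sub>R (- (c $ 4))" and ?b = "\<gamma> / c $ 4"
  have eq: "\<eta> \<bullet> x - (?c \<bullet> \<pi> x + ?b) = (c \<bullet> f x - \<gamma>) / c $ 4" for x
    using c(1) by (simp add: c' divide_simps)
  show thesis
  proof (rule that)
    fix x assume x: "x \<in> W"
    have "c \<bullet> f x \<le> \<gamma>"
      using c(2) x by blast
    then have "(c \<bullet> f x - \<gamma>) / c $ 4 \<ge> 0"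
      using c(1) by (simp add: divide_nonpos_neg)
    then show "?c \<bullet> \<pi> x + ?b \<le> \<eta> \<bullet> x"
      using eq[of x] by linarith
    have "(c \<bullet> f x - \<gamma>) / c $ 4 = 0 \<longleftrightarrow> x \<in> ?F"
      using c(1) on[OF x] by simp
    then show "?c \<bullet> \<pi> x + ?b = \<eta> \<bullet> x \<longleftrightarrow> x \<in> ?F"
      using eq[of x] by linarith
  qed
qed

text \<open>A direction in the plane of the polygon that the projection kills would lower the dimension
  of the image of the polygon, so the image could not be combinatorially equivalent to it.\<close>

lemma \<pi>_inj_polygon:
  assumes z: "\<And>i. N (i, \<sigma> i) \<bullet> z = 0" "\<pi> z = 0"
  shows "z = 0"
proof (rule ccontr)
  assume nz: "z \<noteq> 0"
  let ?I = "sel_graph \<sigma>"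
  let ?F = "\<phi> (wedge_face ?I)"
  have F: "?F = tight_face N \<beta> ?I"
    by (rule \<phi>_wedge_face)
  have Fface: "?F face_of tight_face N \<beta> {}"
    unfolding F by (rule tight_face_face_of)
  have "face_verts ?I \<noteq> {}"
    using sel_graph_in_cells by (simp add: cells_def)
  then have "?F \<noteq> {}"
    by (simp add: \<phi>_hull)
  then obtain K y where K: "?F = tight_face N \<beta> K" "y \<in> ?F" "\<And>k. N k \<bullet> y = \<beta> k \<longleftrightarrow> k \<in> K"
    by (rule face_eq_tight_face[OF Fface]) (rule that)
  \<comment> \<open>No constraint beyond those of the polygon is tight at \<open>y\<close>, because
    the corner at \<open>s i\<close> rules out the other facet over \<open>i\<close>. Hence a short
    move along \<open>z\<close> stays in the polygon.\<close>
  have "K \<subseteq> ?I"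
  proof
    fix k assume k: "k \<in> K"
    obtain i t where it: "k = (i, t)"
      by fastforce
    obtain x where x: "x \<in> X" "J x = vertex_labels s (s i) \<sigma>"
      using ex_vertex by blast
    then have "x \<in> face_verts ?I"
      by (simp add: face_verts_def)
    then have "x \<in> ?F"
      unfolding \<phi>_hull by (rule hull_inc)
    then have "k \<in> J x"
      using k unfolding K(1) by (simp add: tight_face_def J_def)
    then show "k \<in> ?I"
      using s_neq[of i, symmetric] ss_neq[of i, symmetric] by (simp add: x(2) it)
  qed
  obtain \<epsilon> where \<epsilon>: "\<epsilon> > 0" "\<And>k. N k \<bullet> (y + \<epsilon> *\<^sub>R z) \<le> \<beta> k"
  proof (rule eventually_inequalities_near[of N y \<beta> z])
    show "\<And>k. N k \<bullet> y \<le> \<beta> k"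
      using K(2) unfolding F by (rule tight_face_le)
    fix k assume "N k \<bullet> y = \<beta> k"
    then have "k \<in> ?I"
      using K(3) \<open>K \<subseteq> ?I\<close> by blast
    then show "N k \<bullet> z \<le> 0"
      using z(1) by (auto simp: sel_graph_def)
  qed (use that in blast)
  let ?y = "y + \<epsilon> *\<^sub>R z"
  have y': "?y \<in> ?F"
    using \<epsilon>(2) K(2) z(1) unfolding F by (auto simp: tight_face_def sel_graph_def inner_add_right)
  have FW: "?F \<subseteq> W"
    using face_of_imp_subset[OF Fface] by (simp only: W_eq)
  \<comment> \<open>Over the polygon the height is an affine function of the visible coordinates, so
    it cannot change along \<open>z\<close> either.\<close>
  obtain c b where c: "\<And>x. x \<in> W \<Longrightarrow> c \<bullet> \<pi> x + b = \<eta> \<bullet> x \<longleftrightarrow> x \<in> ?F"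
    by (rule supporting_functional[OF sel_graph_in_cells[of \<sigma>]]) (rule that)
  have "c \<bullet> \<pi> y + b = \<eta> \<bullet> y" "c \<bullet> \<pi> ?y + b = \<eta> \<bullet> ?y"
    using c K(2) y' FW by blast+
  then have "\<epsilon> * (\<eta> \<bullet> z) = 0"
    by (simp add: linear_add[OF linear_\<pi>] linear_scale[OF linear_\<pi>] z(2) inner_add_right)
  then have "f z = 0"
    using \<epsilon>(1) z(2) by (intro f_eq_0) auto
  then have "f y = f ?y"
    by (simp add: linear_add[OF linear_f] linear_scale[OF linear_f])
  then have less: "aff_dim (f ` ?F) < aff_dim ?F"
    using aff_dim_linear_image_less[OF linear_f K(2) y'] nz \<epsilon>(1) by simp
  have pres: "preserved_by f W ?F"
    by (rule preserved[OF sel_graph_in_cells])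
  then obtain \<psi> where \<psi>: "face_lattice_iso \<psi> ?F (f ` ?F)"
    unfolding preserved_by_def combinatorially_equivalent_def by blast
  have "polytope ?F"
    using pres polytope_W face_of_polytope_polytope unfolding preserved_by_def by blast
  then have "aff_dim ?F \<le> aff_dim (\<psi> ?F)"
    by (intro aff_dim_face_lattice_iso[OF \<psi>] face_of_refl polytope_imp_convex)
  moreover have "\<psi> ?F \<subseteq> f ` ?F"
    using face_of_imp_subset[OF face_lattice_iso_face[OF \<psi> face_of_refl[OF polytope_imp_convex[OF \<open>polytope ?F\<close>]]]] .
  then have "aff_dim (\<psi> ?F) \<le> aff_dim (f ` ?F)"
    by (rule aff_dim_subset)
  ultimately show False
    using less by simp
qed

sublocale wedge_polytope X J s \<pi> \<eta> N \<beta>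
proof
  show "x \<in> X \<Longrightarrow> N j \<bullet> x \<le> \<beta> j" for x j
    using facet_ineq(1)[of j] X_subset_W by blast
  show "x \<in> X \<Longrightarrow> N j \<bullet> x = \<beta> j \<longleftrightarrow> j \<in> J x" for x j
    by (simp add: J_def)
  show "lower_face \<pi> ((\<bullet>) \<eta>) X (face_verts (sel_graph \<sigma>))" for \<sigma>
  proof -
    obtain c b where c: "\<And>x. x \<in> W \<Longrightarrow> c \<bullet> \<pi> x + b \<le> \<eta> \<bullet> x"
      "\<And>x. x \<in> W \<Longrightarrow> c \<bullet> \<pi> x + b = \<eta> \<bullet> x \<longleftrightarrow> x \<in> \<phi> (wedge_face (sel_graph \<sigma>))"
      by (rule supporting_functional[OF sel_graph_in_cells[of \<sigma>]]) (rule that)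
    have "x \<in> \<phi> (wedge_face (sel_graph \<sigma>)) \<longleftrightarrow> x \<in> face_verts (sel_graph \<sigma>)"
      if "x \<in> X" for x
    proof -
      have "\<forall>k. N k \<bullet> x \<le> \<beta> k"
        using that X_subset_W mem_W_iff[of x] by blast
      with that show ?thesis
        unfolding \<phi>_wedge_face unfolding tight_face_def face_verts_def J_def by blast
    qed
    with c X_subset_W have "c \<bullet> \<pi> x + b \<le> \<eta> \<bullet> x \<and>
        (c \<bullet> \<pi> x + b = \<eta> \<bullet> x \<longleftrightarrow> x \<in> face_verts (sel_graph \<sigma>))" if "x \<in> X" for x
      using that by blast
    moreover have "face_verts (sel_graph \<sigma>) \<subseteq> X"
      unfolding face_verts_def by blast
    ultimately show ?thesis
      unfolding lower_face_def using finite_X by blast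
  qed
qed (use spanning_J \<pi>_inj_polygon surj_\<pi> affinely_spanning no_recession linear_add[OF linear_\<pi>]
    linear_scale[OF linear_\<pi>] in \<open>simp_all, (blast+)?\<close>)

lemma projected_face: "\<pi> ` \<phi> (wedge_face I) = cell I"
  by (simp add: cell_def \<phi>_hull convex_hull_linear_image[OF linear_\<pi>])

end

section \<open>From the wedge product in coordinates to the abstract setting\<close>

text \<open>If no coefficient were negative, or none positive, the interval would contain a ray; the
  points \<open>- (R + 1)\<close> and \<open>R + 1\<close> witness this against the bound
  \<open>R\<close>.\<close>

lemma interval_coefficients_opposite:
  fixes b :: "nat \<Rightarrow> real"
  assumes "facet_inequalities b 2"
  shows "b 0 * b 1 < 0"
proof -
  have "bounded (ineq_set b 2)"
    using assms polytope_imp_bounded by (auto simp: facet_inequalities_def)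
  then obtain R where R: "\<And>x. x \<in> ineq_set b 2 \<Longrightarrow> \<bar>x\<bar> \<le> R"
    by (auto simp: bounded_iff)
  have mem: "x \<in> ineq_set b 2 \<longleftrightarrow> b 0 * x \<le> 1 \<and> b 1 * x \<le> 1" for x
    by (auto simp: ineq_set_def less_2_cases_iff)
  have "0 \<le> R"
    using R[of 0] by (simp add: mem)
  have "\<not> (b 0 \<ge> 0 \<and> b 1 \<ge> 0)"
  proof
    assume "b 0 \<ge> 0 \<and> b 1 \<ge> 0"
    then have "b 0 * - (R + 1) \<le> 0" "b 1 * - (R + 1) \<le> 0"
      using \<open>0 \<le> R\<close> by (auto intro!: mult_nonneg_nonpos simp del: mult_minus_right)
    then have "- (R + 1) \<in> ineq_set b 2"
      by (simp add: mem)
    then show False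
      using R[of "- (R + 1)"] by simp
  qed
  moreover have "\<not> (b 0 \<le> 0 \<and> b 1 \<le> 0)"
  proof
    assume "b 0 \<le> 0 \<and> b 1 \<le> 0"
    then have "b 0 * (R + 1) \<le> 0" "b 1 * (R + 1) \<le> 0"
      using \<open>0 \<le> R\<close> by (auto intro!: mult_nonpos_nonneg)
    then have "R + 1 \<in> ineq_set b 2"
      by (simp add: mem)
    then show False
      using R[of "R + 1"] by simp
  qed
  ultimately show ?thesis
    by (auto simp: mult_less_0_iff)
qed

theorem corollary4p11:
  fixes p :: nat
    and e :: "nat \<Rightarrow> 'p::finite"
    and a :: "nat \<Rightarrow> real^2"
    and b :: "nat \<Rightarrow> real"
    and W :: "((real^2) \<times> (real^'p)) set"
    and \<phi> :: "((real^2) \<times> (real^'p)) set \<Rightarrow> ((real^2) \<times> (real^'p)) set"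
    and S :: "(real^3) set set"
  assumes "p \<ge> 3"
    and "bij_betw e {..<p} UNIV"
    and "cyclic_polygon_inequalities a p"
    and "facet_inequalities b 2"
    and "polytope W"
    and "face_lattice_iso \<phi> (wedge_product e p a b) W"
    and "\<And>F. F \<in> sigma_surface e p a b \<Longrightarrow> preserved_by (first4 e) W (\<phi> F)"
    and "\<And>F. F \<in> sigma_surface e p a b \<Longrightarrow> first4 e ` \<phi> F \<in> lower_hull 4 (first4 e ` W)"
    and "S = (\<lambda>F. first3 e ` \<phi> F) ` sigma_surface e p a b"
  shows "enat (6 * p) \<le> moduli S"
proof -
  note p = assms(1) and e = assms(2)
  \<comment> \<open>Edges are indexed by the type of the fibre coordinates; \<open>idx\<close>
    translates back to the numbers below \<open>p\<close>.\<close>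
  define idx where "idx = inv_into {..<p} e"
  have idx_lt: "idx i < p" and e_idx: "e (idx i) = i" for i
    using e inv_into_into[of i e "{..<p}"] f_inv_into_f[of i e "{..<p}"]
    by (auto simp: idx_def bij_betw_def)
  have idx_e: "idx (e i) = i" if "i < p" for i
    using e that by (simp add: idx_def bij_betw_def)
  have all_idx: "(\<forall>i<p. P i) \<longleftrightarrow> (\<forall>i. P (idx i))" for P
    using idx_lt idx_e by metis
  have idx_eq_iff: "idx i = idx l \<longleftrightarrow> i = l" for i l
    using e_idx by metis
  define A where "A i = a (idx i)" for i
  define s where "s l = e (Suc (idx l) mod p)" for l
  define B where "B t = b (of_bool t)" for t
  have idx_s: "idx (s l) = Suc (idx l) mod p" for l
    using p by (simp add: s_def idx_e)
  have polygon_eq: "ineq_set a p = {x. \<forall>i. A i \<bullet> x \<le> 1}"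
    unfolding ineq_set_def A_def all_idx ..
  have edge_eq: "ineq_facet a p (idx i) = {x. \<forall>i. A i \<bullet> x \<le> 1} \<inter> {x. A i \<bullet> x = 1}" for i
    by (simp add: ineq_facet_def polygon_eq) (simp add: A_def)
  have poly: "facet_inequalities a p"
    and adj: "\<And>i. i < p \<Longrightarrow> ineq_facet a p i \<inter> ineq_facet a p (Suc i mod p) \<noteq> {}"
    using assms(3) by (auto simp: cyclic_polygon_inequalities_def)
  have shift: "Suc i mod p \<noteq> i" "Suc (Suc i mod p) mod p \<noteq> i" if "i < p" for i
    using that p by (auto simp: mod_Suc)
  interpret polygon_wedge A s B
  proof
    show "s l \<noteq> l" "s (s l) \<noteq> l" for l
      using shift[OF idx_lt[of l]] idx_s by metis+
    show "surj s"
    proof (rule surjI)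
      fix l
      \<comment> \<open>The predecessor of an edge; adding \<open>p\<close> first keeps the
        subtraction on natural numbers exact.\<close>
      have "Suc ((idx l + p - 1) mod p) mod p = idx l"
        using idx_lt[of l] p by (simp add: mod_Suc_eq)
      then show "s (e ((idx l + p - 1) mod p)) = l"
        using p by (simp add: s_def idx_e e_idx)
    qed
    show "bounded {x. \<forall>i. A i \<bullet> x \<le> 1}"
      using poly polytope_imp_bounded by (auto simp: facet_inequalities_def simp flip: polygon_eq)
    show "({x. \<forall>i. A i \<bullet> x \<le> 1} \<inter> {x. A i \<bullet> x = 1}) facet_of {x. \<forall>i. A i \<bullet> x \<le> 1}" for i
    proof -
      have "ineq_facet a p (idx i) facet_of ineq_set a p"
        using poly idx_lt[of i] by (simp add: facet_inequalities_def)
      then show ?thesis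
        by (simp only: edge_eq polygon_eq)
    qed
    show "inj (\<lambda>i. {x. \<forall>i. A i \<bullet> x \<le> 1} \<inter> {x. A i \<bullet> x = 1})"
    proof (rule injI)
      fix i l
      assume "{x. \<forall>i. A i \<bullet> x \<le> 1} \<inter> {x. A i \<bullet> x = 1} = {x. \<forall>i. A i \<bullet> x \<le> 1} \<inter> {x. A l \<bullet> x = 1}"
      then have "ineq_facet a p (idx i) = ineq_facet a p (idx l)"
        by (simp only: edge_eq)
      then have "idx i = idx l"
        using poly idx_lt inj_onD[of "ineq_facet a p" "{..<p}" "idx i" "idx l"]
        by (simp add: facet_inequalities_def)
      then show "i = l"
        by (simp add: idx_eq_iff)
    qed
    show "\<exists>x. (\<forall>i. A i \<bullet> x \<le> 1) \<and> A i \<bullet> x = 1 \<and> A (s i) \<bullet> x = 1" for i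
    proof -
      have "ineq_facet a p (idx i) \<inter> ineq_facet a p (idx (s i)) \<noteq> {}"
        unfolding idx_s by (rule adj[OF idx_lt])
      then show ?thesis
        unfolding edge_eq by blast
    qed
    show "B t * B (\<not> t) < 0" for t
      using interval_coefficients_opposite[OF assms(4)] by (cases t) (simp_all add: B_def mult.commute)
  qed
  have normal: "wedge_normal (i, t) \<bullet> (x, y) = a (idx i) \<bullet> x + b (of_bool t) * y $ i" for i t x y
    by (simp add: A_def B_def)
  have all_bool: "(\<forall>j<2. Q j) \<longleftrightarrow> (\<forall>t. Q (of_bool t :: nat))" for Q
    by (auto simp: less_2_cases_iff all_bool_eq)
  have wedge: "wedge_product e p a b = wedge_face {}"
  proof -
    have "(\<forall>i<p. \<forall>j<2. a i \<bullet> x + b j * y $ e i \<le> 1) \<longleftrightarrow> (\<forall>k. wedge_normal k \<bullet> (x, y) \<le> 1)" for x y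
      unfolding all_idx all_bool split_paired_All normal e_idx ..
    then show ?thesis
      by (auto simp: wedge_product_def tight_face_def)
  qed
  have hyperplane: "wedge_hyperplane e a b (idx i) (of_bool t) = {z. wedge_normal (i, t) \<bullet> z = 1}" for i t
    unfolding wedge_hyperplane_def using normal by (auto simp: e_idx)
  interpret wedge_realization A s B W \<phi>
    by unfold_locales (use assms(5,6) wedge in auto)
  have sigma: "sigma_surface e p a b = wedge_face ` cells"
  proof (intro equalityI subsetI)
    fix F assume "F \<in> sigma_surface e p a b"
    then obtain G where F: "F \<noteq> {}" "F face_of G" and G: "G face_of wedge_face {}"
      and vec: "\<forall>i<p. \<exists>j<2. face_vector e a b G i = {j}"
      by (auto simp: sigma_surface_def wedge)
    have "F face_of wedge_face {}"
      using F(2) G by (rule face_of_trans)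
    then obtain I z where I: "F = wedge_face I" "z \<in> F" "\<And>k. wedge_normal k \<bullet> z = 1 \<longleftrightarrow> k \<in> I"
      by (rule face_eq_tight_face[OF _ F(1)]) (rule that)
    \<comment> \<open>\<open>I\<close> consists of all labels tight at a point of \<open>F\<close>,
      and \<open>F\<close> lies in \<open>G\<close>, so the labels of \<open>G\<close> belong to
      \<open>I\<close>.\<close>
    have "\<exists>t. (i, t) \<in> I" for i
    proof -
      obtain j where j: "j < 2" "face_vector e a b G (idx i) = {j}"
        using vec idx_lt by blast
      obtain t :: bool where t: "j = of_bool t"
        using j(1) by (metis less_2_cases of_bool_eq(1) of_bool_eq(2) One_nat_def)
      have "j \<in> face_vector e a b G (idx i)"
        by (simp add: j(2))
      then have "G \<subseteq> wedge_hyperplane e a b (idx i) j"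
        by (simp only: face_vector_def mem_Collect_eq)
      then have "G \<subseteq> {z. wedge_normal (i, t) \<bullet> z = 1}"
        by (simp only: t hyperplane)
      then have "wedge_normal (i, t) \<bullet> z = 1"
        using I(2) face_of_imp_subset[OF F(2)] by blast
      then show ?thesis
        using I(3) by blast
    qed
    then obtain \<sigma> where "\<And>i. (i, \<sigma> i) \<in> I"
      by metis
    then have "sel_graph \<sigma> \<subseteq> I"
      by (auto simp: sel_graph_def)
    moreover have "face_verts I \<noteq> {}"
      using F(1) I(1) wedge_face_nonempty_iff by simp
    ultimately show "F \<in> wedge_face ` cells"
      unfolding I(1) cells_def by blast
  next
    fix F assume "F \<in> wedge_face ` cells"
    then obtain I \<sigma> where I: "F = wedge_face I" "sel_graph \<sigma> \<subseteq> I" "face_verts I \<noteq> {}"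
      by (auto simp: cells_def)
    let ?G = "wedge_face (sel_graph \<sigma>)"
    have "face_vector e a b ?G (idx i) = {of_bool (\<sigma> i)}" for i
    proof -
      have "j \<in> face_vector e a b ?G (idx i) \<longleftrightarrow> j = of_bool (\<sigma> i)" for j
      proof (cases "j < 2")
        case True
        then obtain t :: bool where t: "j = of_bool t"
          by (metis less_2_cases of_bool_eq(1) of_bool_eq(2) One_nat_def)
        have "j \<in> face_vector e a b ?G (idx i) \<longleftrightarrow> t = \<sigma> i"
          using True unfolding face_vector_def mem_Collect_eq t hyperplane wedge_face_selector_subset_iff
          by blast
        then show ?thesis
          by (simp add: t of_bool_eq_iff)
      next
        case False
        then show ?thesis
          by (auto simp: face_vector_def)
      qed
      then show ?thesis
        by blast
    qed
    moreover have "(of_bool t :: nat) < 2" for t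
      by simp
    ultimately have "\<forall>i<p. \<exists>j<2. face_vector e a b ?G i = {j}"
      unfolding all_idx by blast
    moreover have "F \<noteq> {}"
      using I(1,3) wedge_face_nonempty_iff by simp
    moreover have "F face_of ?G"
      unfolding I(1) using I(2) by (rule tight_face_face_of_tight_face)
    ultimately show "F \<in> sigma_surface e p a b"
      unfolding sigma_surface_def wedge using tight_face_face_of by blast
  qed
  \<comment> \<open>The height is the fibre coordinate \<open>y $ e 1\<close>, the fourth coordinate
    overall.\<close>
  let ?\<pi> = "first3 e" and ?f = "first4 e" and ?\<eta> = "(0, axis (e 1) 1) :: (real^2) \<times> (real^'p)"
  have \<pi>_nth: "?\<pi> z $ 1 = fst z $ 1" "?\<pi> z $ 2 = fst z $ 2" "?\<pi> z $ 3 = snd z $ e 0" for z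
    by (simp_all add: first3_def case_prod_beta)
  have f_nth: "?f z $ 1 = fst z $ 1" "?f z $ 2 = fst z $ 2" "?f z $ 3 = snd z $ e 0" "?f z $ 4 = snd z $ e 1" for z
    by (simp_all add: first4_def case_prod_beta vector_def)
  have \<eta>: "?\<eta> \<bullet> z = snd z $ e 1" for z
    by (cases z) (simp add: inner_axis')
  interpret projected_wedge A s B W \<phi> ?\<pi> ?\<eta> ?f
  proof
    show "?\<pi> (x + y) = ?\<pi> x + ?\<pi> y" "?\<pi> (c *\<^sub>R x) = c *\<^sub>R ?\<pi> x" for x y c
      by (simp_all add: vec_eq_iff forall_3 \<pi>_nth)
    show "?f (x + y) = ?f x + ?f y" "?f (c *\<^sub>R x) = c *\<^sub>R ?f x" for x y c
      by (simp_all add: vec_eq_iff forall_4 f_nth)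
    show "surj ?\<pi>"
    proof (rule surjI)
      fix u :: "real^3"
      show "?\<pi> (vector [u $ 1, u $ 2], axis (e 0) (u $ 3)) = u"
        by (simp add: vec_eq_iff forall_3 \<pi>_nth)
    qed
    show "\<exists>c'. \<forall>z. c \<bullet> ?f z = c' \<bullet> ?\<pi> z + c $ 4 * (?\<eta> \<bullet> z)" for c
      unfolding \<eta> inner_vec_def sum_4 sum_3 \<pi>_nth f_nth
      by (intro exI[of _ "vector [c $ 1, c $ 2, c $ 3]"]) simp
    show "?\<pi> z = 0 \<Longrightarrow> ?\<eta> \<bullet> z = 0 \<Longrightarrow> ?f z = 0" for z
      unfolding \<eta> by (simp add: vec_eq_iff forall_3 forall_4 \<pi>_nth f_nth)
    show "preserved_by ?f W (\<phi> (wedge_face I))" "?f ` \<phi> (wedge_face I) \<in> lower_hull 4 (?f ` W)"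
      if "I \<in> cells" for I
      using assms(7,8) that unfolding sigma by blast+
  qed
  have "S = cell ` cells"
    unfolding assms(9) sigma image_image projected_face ..
  moreover have "CARD('p) = p"
    using bij_betw_same_card[OF e] by simp
  ultimately show ?thesis
    using moduli_ge by simp
qed

end
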